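(* There exist absolute constants $C,D_1>0$ such that the following holds. Let $n,p$ be positive integers with $p\ge Cn$, let $\boldsymbol{\beta}\in\mathbb{R}^p$, let $\ell_1,\dots,\ell_n\in\{0,1\}$ be deterministic labels, and let $$\mathbf{y}_i=-\ell_i\boldsymbol{\beta}+(1-\ell_i)\boldsymbol{\beta}+\boldsymbol{\varepsilon}_i\in\mathbb{R}^p,\quad i=1,\dots,n,$$ where $\boldsymbol{\varepsilon}_1,\dots,\boldsymbol{\varepsilon}_n$ are i.i.d. $\mathcal{N}(\mathbf{0},\mathbf{I}_p)$. Let $\mathcal{N}_0=\{i:\ell_i=0\}$ and $\mathcal{N}_1=\{i:\ell_i=1\}$. Let $\hat{\mathbf{u}}\in\mathbb{R}^n$ be the leading left singular vector of the data matrix $\mathbf{Y}=(\mathbf{y}_1,\dots,\mathbf{y}_n)^\top\in\mathbb{R}^{n\times p}$, and let $\hat{\mathcal{N}}_0=\{1\le i\le n:\hat u(i)\ge0\}$ and $\hat{\mathcal{N}}_1=\{1\le i\le n:\hat u(i)<0\}$. If $$\|\boldsymbol{\beta}\|_{\ell_2}\ge D_1\Big(n^{1/6}\vee p^{1/8}\vee\big(p\log(n)/n\big)^{1/4}\Big),$$ then with probability at least $1-\frac1n$, $$\hat{\mathcal{N}}_0=\mathcal{N}_0\quad\text{or}\quad\hat{\mathcal{N}}_0=\mathcal{N}_1.$$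
   Context: $a\vee b=\max(a,b)$. $\|\cdot\|_{\ell_2}$ is the Euclidean norm. The leading left singular vector is a unit left singular vector for the largest singular value, defined up to sign (either sign may be chosen). *)

theory Defs
  imports "HOL-Probability.Probability" "Jordan_Normal_Form.Matrix"
begin

hide_type (open) Finite_Cartesian_Product.vec
hide_const (open) Finite_Cartesian_Product.vec
no_notation Finite_Cartesian_Product.vec_nth (infixl \<open>$\<close> 90)

definition l2_norm :: "real vec \<Rightarrow> real"
  where "l2_norm v = L2_set (($) v) {..<dim_vec v}"

text \<open>
  Left and right unit singular vectors \<open>u\<close>, \<open>v\<close> of \<open>A\<close> for the singular value \<open>\<sigma>\<close>. For a
  non-square \<open>A\<close> the value \<open>\<sigma> = 0\<close> counts only if it has a unit vector on both sides, which is
  the convention that an \<open>n \<times> p\<close> matrix has \<open>min n p\<close> singular values.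
\<close>

definition singular_triple :: "real mat \<Rightarrow> real \<Rightarrow> real vec \<Rightarrow> real vec \<Rightarrow> bool"
  where "singular_triple A \<sigma> u v \<longleftrightarrow>
    0 \<le> \<sigma> \<and> u \<in> carrier_vec (dim_row A) \<and> v \<in> carrier_vec (dim_col A) \<and>
    l2_norm u = 1 \<and> l2_norm v = 1 \<and>
    A *\<^sub>v v = \<sigma> \<cdot>\<^sub>v u \<and> transpose_mat A *\<^sub>v u = \<sigma> \<cdot>\<^sub>v v"

definition singular_value :: "real mat \<Rightarrow> real \<Rightarrow> bool"
  where "singular_value A \<sigma> \<longleftrightarrow> (\<exists>u v. singular_triple A \<sigma> u v)"

definition leading_left_singular_vector :: "real mat \<Rightarrow> real vec \<Rightarrow> bool"
  where "leading_left_singular_vector A u \<longleftrightarrow>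
    (\<exists>\<sigma> v. singular_triple A \<sigma> u v \<and> (\<forall>\<sigma>'. singular_value A \<sigma>' \<longrightarrow> \<sigma>' \<le> \<sigma>))"

definition std_gaussian :: "nat \<Rightarrow> (nat \<Rightarrow> real) measure"
  where "std_gaussian p = (\<Pi>\<^sub>M j\<in>{..<p}. density lborel std_normal_density)"

definition noise_law :: "nat \<Rightarrow> nat \<Rightarrow> (nat \<Rightarrow> nat \<Rightarrow> real) measure"
  where "noise_law n p = (\<Pi>\<^sub>M i\<in>{..<n}. std_gaussian p)"

text \<open>
  Working with \<open>noise_law\<close> loses no generality: it is the joint law of any i.i.d. standard
  Gaussian vectors on any probability space.
\<close>

lemma noise_law_eq_distr:
  assumes "prob_space M" and "0 < n"
    and indep: "prob_space.indep_vars M (\<lambda>_. std_gaussian p) \<epsilon> {..<n}"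
    and law: "\<And>i. i < n \<Longrightarrow> distr M (std_gaussian p) (\<epsilon> i) = std_gaussian p"
  shows "distr M (noise_law n p) (\<lambda>\<omega>. \<lambda>i\<in>{..<n}. \<epsilon> i \<omega>) = noise_law n p"
proof -
  interpret prob_space M by fact
  have rv: "\<epsilon> i \<in> measurable M (std_gaussian p)" if "i < n" for i
    using indep that unfolding indep_vars_def by auto
  have "distr M (\<Pi>\<^sub>M i\<in>{..<n}. std_gaussian p) (\<lambda>\<omega>. \<lambda>i\<in>{..<n}. \<epsilon> i \<omega>)
      = (\<Pi>\<^sub>M i\<in>{..<n}. distr M (std_gaussian p) (\<epsilon> i))"
    using indep_vars_iff_distr_eq_PiM'[of "{..<n}" \<epsilon> "\<lambda>_. std_gaussian p"] indep rv \<open>0 < n\<close>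
    by (auto simp: lessThan_empty_iff)
  also have "\<dots> = (\<Pi>\<^sub>M i\<in>{..<n}. std_gaussian p)"
    by (rule PiM_cong) (simp_all add: law)
  finally show ?thesis by (simp add: noise_law_def)
qed

text \<open>Samples and coordinates are indexed from \<open>0\<close>.\<close>

definition sample :: "nat \<Rightarrow> real vec \<Rightarrow> (nat \<Rightarrow> nat) \<Rightarrow> (nat \<Rightarrow> nat \<Rightarrow> real) \<Rightarrow> nat \<Rightarrow> real vec"
  where "sample p \<beta> l \<epsilon> i =
    (- real (l i)) \<cdot>\<^sub>v \<beta> + (1 - real (l i)) \<cdot>\<^sub>v \<beta> + vec p (\<epsilon> i)"

definition data_matrix :: "nat \<Rightarrow> nat \<Rightarrow> real vec \<Rightarrow> (nat \<Rightarrow> nat) \<Rightarrow> (nat \<Rightarrow> nat \<Rightarrow> real) \<Rightarrow> real mat"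
  where "data_matrix n p \<beta> l \<epsilon> = mat_of_rows p (map (sample p \<beta> l \<epsilon>) [0..<n])"

definition label_class :: "nat \<Rightarrow> (nat \<Rightarrow> nat) \<Rightarrow> nat \<Rightarrow> nat set"
  where "label_class n l c = {i. i < n \<and> l i = c}"

definition estimated_class0 :: "real vec \<Rightarrow> nat set"
  where "estimated_class0 u = {i. i < dim_vec u \<and> u $ i \<ge> 0}"

end

theory Submission
  imports Defs
begin

text \<open>
  Write \<open>s i = 1 - 2 * l i\<close> and \<open>x\<^sub>0 = s / sqrt n\<close>. The law of \<open>Y = s \<beta>\<^sup>T + E\<close> is invariant under every
  orthogonal map of \<open>\<real>\<^sup>n\<close> that fixes \<open>s\<close>. A net argument shows that the leading left singular
  vector \<open>u\<close> has an angle \<open>\<theta>\<close> with \<open>x\<^sub>0\<close> such that \<open>(tan \<theta>)\<^sup>2 \<le> 1 / (12 ln n)\<close>. So it remains to see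
  that the component of \<open>u\<close> orthogonal to \<open>s\<close> is spread out over the coordinates. Complete \<open>x\<^sub>0\<close>
  to an orthonormal basis with entries of size at most \<open>sqrt (2 / n)\<close> (the Hartley basis, twisted
  by \<open>s\<close>). Flipping the signs of any set of the other basis directions preserves the law and
  replaces the coordinates of that component by Rademacher sums, which are sub-Gaussian with
  variance \<open>(2 / n) (sin \<theta>)\<^sup>2\<close>, so that Hoeffding's inequality and a union bound over the
  coordinates apply.
\<close>

section \<open>Reflection invariance of the Gaussian law\<close>

text \<open>The angle bound alone does not recover the signs: every coordinate of
  \<open>x\<^sub>0\<close> has size \<open>1 / sqrt n\<close>, while an orthogonal part of relative
  length \<open>1 / sqrt (12 ln n)\<close> could sit in a single coordinate. Invariance has to
  exclude this, and a finite commuting group of reflections suffices, so that random rotations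
  become a count over \<open>2 ^ (n - 1)\<close> sign patterns. The Hartley basis is real, flat,
  available for every \<open>n\<close>, and contains the constant vector.

  No measurable choice of \<open>u\<close> is made: the bad event speaks of all maximisers of the
  Gram form. By the spectral gap they lie on one line, so the flips can be counted for a single
  fixed vector.

  The constant 12 leaves \<open>n ^ -3\<close> per coordinate in Hoeffding's inequality and
  \<open>n ^ -6\<close> per entry for the noise along \<open>\<beta>\<close>; \<open>C = 256\<close>
  keeps the chi-square deviation used on the net within the range of its exponential bound;
  \<open>D\<^sub>1 = 600\<close> lets \<open>n powr (1/6)\<close> dominate a logarithm
  \<open>96 * ln n\<close>.\<close>

abbreviation gauss :: "'a set \<Rightarrow> ('a \<Rightarrow> real) measure" where
  "gauss L \<equiv> Pi\<^sub>M L (\<lambda>_. density lborel std_normal_density)"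

abbreviation leb :: "'a set \<Rightarrow> ('a \<Rightarrow> real) measure" where
  "leb L \<equiv> Pi\<^sub>M L (\<lambda>_. lborel)"

text \<open>The Householder reflection \<open>I - 2 h h\<^sup>T\<close> when \<open>h\<close> is a
  unit vector. The restriction to \<open>L\<close> keeps the image in the extensional functions that
  carry a product measure.\<close>

definition reflect :: "'a set \<Rightarrow> ('a \<Rightarrow> real) \<Rightarrow> ('a \<Rightarrow> real) \<Rightarrow> 'a \<Rightarrow> real" where
  "reflect L h x = (\<lambda>k\<in>L. x k - 2 * h k * (\<Sum>l\<in>L. h l * x l))"

lemma prob_space_std_normal: "prob_space (density lborel std_normal_density)"
  by (rule prob_space_normal_density) simp

interpretation gauss1: prob_space "density lborel std_normal_density"
  by (rule prob_space_std_normal)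

interpretation gaussP: product_sigma_finite "\<lambda>_. density lborel std_normal_density"
  by standard

interpretation lebP: product_sigma_finite "\<lambda>_. lborel :: real measure"
  by standard

lemma prob_space_gauss: "prob_space (gauss L)"
  by (rule prob_space_PiM) (rule prob_space_std_normal)

lemma sets_gauss[measurable_cong]: "sets (gauss L) = sets (leb L)"
  by (rule sets_PiM_cong) simp_all

text \<open>Comparison on boxes is enough. With the density explicit, invariance splits into that of
  Lebesgue measure and that of the density.\<close>

lemma gauss_eq_density:
  assumes [simp]: "finite L"
  shows "gauss L = density (leb L) (\<lambda>x. \<Prod>k\<in>L. ennreal (std_normal_density (x k)))"
proof (rule sym, rule gaussP.PiM_eqI)
  fix A :: "'a \<Rightarrow> real set"
  assume A: "\<And>i. i \<in> L \<Longrightarrow> A i \<in> sets (density lborel (\<lambda>x. ennreal (std_normal_density x)))"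
  have ind: "indicator (Pi\<^sub>E L A) x = (\<Prod>k\<in>L. indicator (A k) (x k) :: ennreal)" if "x \<in> space (leb L)" for x
    using that by (auto simp: indicator_def space_PiM PiE_iff prod_zero_iff)
  have "emeasure (density (leb L) (\<lambda>x. \<Prod>k\<in>L. ennreal (std_normal_density (x k)))) (Pi\<^sub>E L A)
     = (\<integral>\<^sup>+x. (\<Prod>k\<in>L. ennreal (std_normal_density (x k))) * indicator (Pi\<^sub>E L A) x \<partial>leb L)"
    using A by (intro emeasure_density) (auto intro!: sets_PiM_I_finite)
  also have "\<dots> = (\<integral>\<^sup>+x. (\<Prod>k\<in>L. ennreal (std_normal_density (x k)) * indicator (A k) (x k)) \<partial>leb L)"
    by (intro nn_integral_cong) (simp add: ind prod.distrib)
  also have "\<dots> = (\<Prod>k\<in>L. \<integral>\<^sup>+x. ennreal (std_normal_density x) * indicator (A k) x \<partial>lborel)"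
    using A by (intro lebP.product_nn_integral_prod) auto
  also have "\<dots> = (\<Prod>k\<in>L. emeasure (density lborel std_normal_density) (A k))"
    using A by (intro prod.cong) (auto simp: emeasure_density)
  finally show "emeasure (density (leb L) (\<lambda>x. \<Prod>k\<in>L. ennreal (std_normal_density (x k)))) (Pi\<^sub>E L A)
     = (\<Prod>k\<in>L. emeasure (density lborel std_normal_density) (A k))" .
qed (simp_all cong: sets_PiM_cong)

text \<open>Translation invariance of \<open>lborel\<close> in each coordinate, checked on boxes; it
  absorbs the shear that a reflection produces in adapted coordinates.\<close>

lemma nn_integral_leb_translate:
  assumes [simp]: "finite K" and f[measurable]: "f \<in> borel_measurable (leb K)"
  shows "(\<integral>\<^sup>+x. f (\<lambda>k\<in>K. x k + d k) \<partial>leb K) = (\<integral>\<^sup>+x. f x \<partial>leb K)"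
proof -
  have [measurable]: "(\<lambda>x. \<lambda>k\<in>K. x k + d k) \<in> measurable (leb K) (leb K)"
    by measurable
  have "distr (leb K) (leb K) (\<lambda>x. \<lambda>k\<in>K. x k + d k) = leb K"
  proof (rule lebP.PiM_eqI)
    fix A :: "'a \<Rightarrow> real set"
    assume A: "\<And>i. i \<in> K \<Longrightarrow> A i \<in> sets lborel"
    have m: "(\<lambda>t. t + d k) -` A k \<in> sets borel" if "k \<in> K" for k
      using measurable_sets[of "\<lambda>t. t + d k" borel borel "A k"] A[OF that] by simp
    have "emeasure (distr (leb K) (leb K) (\<lambda>x. \<lambda>k\<in>K. x k + d k)) (Pi\<^sub>E K A)
       = emeasure (leb K) ((\<lambda>x. \<lambda>k\<in>K. x k + d k) -` Pi\<^sub>E K A \<inter> space (leb K))"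
      using A by (intro emeasure_distr) (auto intro!: sets_PiM_I_finite)
    also have "(\<lambda>x. \<lambda>k\<in>K. x k + d k) -` Pi\<^sub>E K A \<inter> space (leb K) = Pi\<^sub>E K (\<lambda>k. (\<lambda>t. t + d k) -` A k)"
      by (auto simp: space_PiM PiE_iff)
    also have "emeasure (leb K) \<dots> = (\<Prod>k\<in>K. emeasure lborel ((\<lambda>t. t + d k) -` A k))"
      using m by (intro lebP.emeasure_PiM) auto
    also have "\<dots> = (\<Prod>k\<in>K. emeasure lborel (A k))"
    proof (rule prod.cong[OF refl])
      fix k assume "k \<in> K"
      have "emeasure lborel (A k) = emeasure (distr lborel borel ((+) (d k))) (A k)"
        by (simp add: lborel_distr_plus)
      also have "\<dots> = emeasure lborel ((\<lambda>t. t + d k) -` A k)"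
        using A[OF \<open>k \<in> K\<close>] by (subst emeasure_distr) (auto intro!: arg_cong[where f = "emeasure lborel"] simp: add.commute)
      finally show "emeasure lborel ((\<lambda>t. t + d k) -` A k) = emeasure lborel (A k)" by simp
    qed
    finally show "emeasure (distr (leb K) (leb K) (\<lambda>x. \<lambda>k\<in>K. x k + d k)) (Pi\<^sub>E K A)
       = (\<Prod>k\<in>K. emeasure lborel (A k))" .
  qed simp_all
  then have "(\<integral>\<^sup>+x. f x \<partial>leb K) = (\<integral>\<^sup>+x. f x \<partial>distr (leb K) (leb K) (\<lambda>x. \<lambda>k\<in>K. x k + d k))"
    by simp
  also have "\<dots> = (\<integral>\<^sup>+x. f (\<lambda>k\<in>K. x k + d k) \<partial>leb K)"
    by (rule nn_integral_distr) auto
  finally show ?thesis by simp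
qed

lemma measurable_reflect[measurable]: "finite L \<Longrightarrow> reflect L h \<in> measurable (leb L) (leb L)"
  unfolding reflect_def by measurable

lemma reflect_norm:
  assumes h: "(\<Sum>k\<in>L. (h k)\<^sup>2) = 1"
  shows "(\<Sum>k\<in>L. (reflect L h x k)\<^sup>2) = (\<Sum>k\<in>L. (x k)\<^sup>2)"
proof -
  let ?s = "\<Sum>l\<in>L. h l * x l"
  have "(\<Sum>k\<in>L. (reflect L h x k)\<^sup>2) = (\<Sum>k\<in>L. (x k)\<^sup>2 - (4 * ?s) * (h k * x k) + (4 * ?s\<^sup>2) * (h k)\<^sup>2)"
    by (intro sum.cong refl) (simp add: reflect_def power2_eq_square algebra_simps)
  also have "\<dots> = (\<Sum>k\<in>L. (x k)\<^sup>2) - (4 * ?s) * ?s + (4 * ?s\<^sup>2) * (\<Sum>k\<in>L. (h k)\<^sup>2)"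
    by (simp add: sum.distrib sum_subtractf sum_distrib_left)
  finally show ?thesis using h by (simp add: power2_eq_square)
qed

text \<open>In the coordinates \<open>y = \<langle>h, x\<rangle>\<close> and \<open>(x k)\<^bsub>k \<noteq> a\<^esub>\<close>, where \<open>h a \<noteq> 0\<close>, the reflection
  flips \<open>y\<close> and translates the other coordinates by \<open>- 2 y h\<close>.\<close>

lemma nn_integral_leb_reflect:
  assumes fin[simp]: "finite L" and h: "(\<Sum>k\<in>L. (h k)\<^sup>2) = 1"
    and f[measurable]: "f \<in> borel_measurable (leb L)"
  shows "(\<integral>\<^sup>+x. f (reflect L h x) \<partial>leb L) = (\<integral>\<^sup>+x. f x \<partial>leb L)"
proof -
  obtain a where a: "a \<in> L" "h a \<noteq> 0"
    using h by (metis (mono_tags, lifting) sum.neutral zero_neq_one power_zero_numeral)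
  define K where "K = L - {a}"
  have K[simp]: "finite K" "a \<notin> K" and L: "L = insert a K"
    using a by (auto simp: K_def)
  define c where "c x = (\<Sum>k\<in>K. h k * x k)" for x
  \<comment> \<open>\<open>P y x\<close> is the point with coordinates \<open>x\<close> off
    \<open>a\<close> whose inner product with \<open>h\<close> is \<open>y\<close>;
    \<open>h a \<noteq> 0\<close> allows solving for the coordinate at \<open>a\<close>.\<close>
  define P where "P y x = x(a := (y - c x) / h a)" for y x
  have c_meas[measurable]: "c \<in> borel_measurable (leb K)"
    unfolding c_def by measurable
  have hK: "(\<Sum>k\<in>K. (h k)\<^sup>2) = 1 - (h a)\<^sup>2"
    using h unfolding L by simp
  interpret K: sigma_finite_measure "leb K" by (rule lebP.sigma_finite) simp
  interpret pair_sigma_finite lborel "leb K" ..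
  have P_meas: "(\<lambda>(y, x). P y x) \<in> measurable (lborel \<Otimes>\<^sub>M leb K) (leb L)"
    unfolding P_def L by measurable
  \<comment> \<open>The coordinate at \<open>a\<close> is affine in \<open>y\<close> with slope
    \<open>1 / h a\<close>, which is the Jacobian factor. Fubini puts \<open>y\<close> outside, so
    that the other coordinates are translated by a constant.\<close>
  have split: "(\<integral>\<^sup>+x. g x \<partial>leb L) = ennreal \<bar>1 / h a\<bar> * (\<integral>\<^sup>+y. (\<integral>\<^sup>+x. g (P y x) \<partial>leb K) \<partial>lborel)"
    if g: "g \<in> borel_measurable (leb L)" for g
  proof -
    have g'[measurable]: "g \<in> borel_measurable (leb (insert a K))" using g L by simp
    have gP[measurable]: "(\<lambda>(y, x). g (P y x)) \<in> borel_measurable (lborel \<Otimes>\<^sub>M leb K)"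
      using measurable_compose[OF P_meas g] by (simp add: case_prod_unfold)
    have "(\<integral>\<^sup>+x. g x \<partial>leb L) = (\<integral>\<^sup>+x. (\<integral>\<^sup>+y. g (x(a := y)) \<partial>lborel) \<partial>leb K)"
      unfolding L by (rule lebP.product_nn_integral_insert) auto
    also have "\<dots> = (\<integral>\<^sup>+x. ennreal \<bar>1 / h a\<bar> * (\<integral>\<^sup>+y. g (P y x) \<partial>lborel) \<partial>leb K)"
    proof (rule nn_integral_cong)
      fix x assume x[measurable]: "x \<in> space (leb K)"
      have "(\<integral>\<^sup>+y. g (x(a := y)) \<partial>lborel)
         = ennreal \<bar>1 / h a\<bar> * (\<integral>\<^sup>+y. g (x(a := - c x / h a + 1 / h a * y)) \<partial>lborel)"
        using a x by (intro nn_integral_real_affine) (auto intro!: measurable_compose[OF _ g'] measurable_fun_upd)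
      then show "(\<integral>\<^sup>+y. g (x(a := y)) \<partial>lborel) = ennreal \<bar>1 / h a\<bar> * (\<integral>\<^sup>+y. g (P y x) \<partial>lborel)"
        by (simp add: P_def diff_divide_distrib)
    qed
    also have "\<dots> = ennreal \<bar>1 / h a\<bar> * (\<integral>\<^sup>+x. (\<integral>\<^sup>+y. g (P y x) \<partial>lborel) \<partial>leb K)"
      by (rule nn_integral_cmult) measurable
    also have "(\<integral>\<^sup>+x. (\<integral>\<^sup>+y. g (P y x) \<partial>lborel) \<partial>leb K) = (\<integral>\<^sup>+y. (\<integral>\<^sup>+x. g (P y x) \<partial>leb K) \<partial>lborel)"
      by (rule Fubini') measurable
    finally show ?thesis .
  qed
  have refl_P: "reflect L h (P y x) = P (- y) (\<lambda>k\<in>K. x k + (- 2 * y * h k))" if x: "x \<in> space (leb K)" for x y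
  proof -
    have "(\<Sum>k\<in>K. h k * P y x k) = c x"
      unfolding c_def by (intro sum.cong) (auto simp: P_def)
    then have y: "(\<Sum>k\<in>L. h k * P y x k) = y"
      using a unfolding L by (simp add: P_def)
    have "c (\<lambda>k\<in>K. x k + (- 2 * y * h k)) = (\<Sum>k\<in>K. h k * x k - 2 * y * (h k)\<^sup>2)"
      unfolding c_def by (intro sum.cong) (auto simp: power2_eq_square algebra_simps)
    also have "\<dots> = c x - 2 * y * (1 - (h a)\<^sup>2)"
      by (simp add: sum_subtractf c_def hK flip: sum_distrib_left)
    finally have c': "c (\<lambda>k\<in>K. x k + (- 2 * y * h k)) = c x - 2 * y * (1 - (h a)\<^sup>2)" .
    show ?thesis
    proof
      fix k
      consider "k = a" | "k \<in> K" | "k \<notin> L" by (auto simp: L)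
      then show "reflect L h (P y x) k = P (- y) (\<lambda>k\<in>K. x k + (- 2 * y * h k)) k"
      proof cases
        case 1
        then show ?thesis using a
          unfolding reflect_def y unfolding P_def c' by (simp add: field_simps power2_eq_square)
      next
        case 2
        then have "k \<noteq> a" "k \<in> L" by (auto simp: L)
        with 2 show ?thesis unfolding reflect_def y by (simp add: P_def)
      next
        case 3
        then have "k \<noteq> a" "k \<notin> K" by (auto simp: L)
        with 3 show ?thesis by (simp add: reflect_def P_def)
      qed
    qed
  qed
  have slice[measurable]: "(\<lambda>x. f (P y x)) \<in> borel_measurable (leb K)" for y
    using measurable_compose[OF measurable_Pair1'[of y lborel "leb K"] measurable_compose[OF P_meas f]] by simp
  have "(\<integral>\<^sup>+x. f (reflect L h x) \<partial>leb L)
      = ennreal \<bar>1 / h a\<bar> * (\<integral>\<^sup>+y. (\<integral>\<^sup>+x. f (reflect L h (P y x)) \<partial>leb K) \<partial>lborel)"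
    by (rule split) measurable
  also have "(\<integral>\<^sup>+y. (\<integral>\<^sup>+x. f (reflect L h (P y x)) \<partial>leb K) \<partial>lborel)
      = (\<integral>\<^sup>+y. (\<integral>\<^sup>+x. f (P (- y) (\<lambda>k\<in>K. x k + (- 2 * y * h k))) \<partial>leb K) \<partial>lborel)"
    by (intro nn_integral_cong) (simp add: refl_P)
  also have "\<dots> = (\<integral>\<^sup>+y. (\<integral>\<^sup>+x. f (P (- y) x) \<partial>leb K) \<partial>lborel)"
    by (intro nn_integral_cong nn_integral_leb_translate) auto
  also have "\<dots> = (\<integral>\<^sup>+y. (\<integral>\<^sup>+x. f (P y x) \<partial>leb K) \<partial>lborel)"
  proof -
    have [measurable]: "(\<lambda>(y, x). f (P y x)) \<in> borel_measurable (lborel \<Otimes>\<^sub>M leb K)"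
      using measurable_compose[OF P_meas f] by (simp add: case_prod_unfold)
    have "(\<lambda>y. \<integral>\<^sup>+x. f (P y x) \<partial>leb K) \<in> borel_measurable lborel" by measurable
    then show ?thesis
      using nn_integral_real_affine[of "\<lambda>y. \<integral>\<^sup>+x. f (P y x) \<partial>leb K" "-1" 0] by simp
  qed
  also have "ennreal \<bar>1 / h a\<bar> * \<dots> = (\<integral>\<^sup>+x. f x \<partial>leb L)"
    by (rule split[symmetric]) fact
  finally show ?thesis .
qed

text \<open>The joint density depends on \<open>x\<close> only through its squared norm, which is
  why a reflection leaves it unchanged.\<close>

lemma prod_std_normal_density:
  assumes "finite L"
  shows "(\<Prod>k\<in>L. ennreal (std_normal_density (x k)))
    = ennreal ((1 / sqrt (2 * pi)) ^ card L * exp (- (\<Sum>k\<in>L. (x k)\<^sup>2) / 2))"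
proof -
  have "(\<Prod>k\<in>L. ennreal (std_normal_density (x k))) = ennreal (\<Prod>k\<in>L. std_normal_density (x k))"
    by (rule prod_ennreal) simp
  also have "(\<Prod>k\<in>L. std_normal_density (x k)) = (1 / sqrt (2 * pi)) ^ card L * exp (- (\<Sum>k\<in>L. (x k)\<^sup>2) / 2)"
    using assms unfolding std_normal_density_def prod.distrib
    by (simp add: exp_sum[symmetric] sum_negf sum_divide_distrib)
  finally show ?thesis .
qed

lemma nn_integral_gauss_reflect:
  assumes [simp]: "finite L" and h: "(\<Sum>k\<in>L. (h k)\<^sup>2) = 1"
    and f[measurable]: "f \<in> borel_measurable (gauss L)"
  shows "(\<integral>\<^sup>+x. f (reflect L h x) \<partial>gauss L) = (\<integral>\<^sup>+x. f x \<partial>gauss L)"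
proof -
  let ?d = "\<lambda>x. \<Prod>k\<in>L. ennreal (std_normal_density (x k))"
  have f'[measurable]: "f \<in> borel_measurable (leb L)"
    using f by (simp cong: measurable_cong_sets add: sets_gauss)
  have d: "?d (reflect L h x) = ?d x" for x
    by (simp add: prod_std_normal_density reflect_norm[OF h])
  have "(\<integral>\<^sup>+x. f (reflect L h x) \<partial>gauss L) = (\<integral>\<^sup>+x. ?d x * f (reflect L h x) \<partial>leb L)"
    unfolding gauss_eq_density[OF \<open>finite L\<close>] by (rule nn_integral_density) auto
  also have "\<dots> = (\<integral>\<^sup>+x. ?d (reflect L h x) * f (reflect L h x) \<partial>leb L)"
    by (simp add: d)
  also have "\<dots> = (\<integral>\<^sup>+x. ?d x * f x \<partial>leb L)"
    by (rule nn_integral_leb_reflect[OF _ h, of "\<lambda>x. ?d x * f x"]) auto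
  also have "\<dots> = (\<integral>\<^sup>+x. f x \<partial>gauss L)"
    unfolding gauss_eq_density[OF \<open>finite L\<close>] by (rule nn_integral_density[symmetric]) auto
  finally show ?thesis .
qed

section \<open>The noise as a family of independent entries\<close>

abbreviation grid :: "nat \<Rightarrow> nat \<Rightarrow> (nat \<times> nat) set" where
  "grid n p \<equiv> {..<n} \<times> {..<p}"

text \<open>One index set \<open>grid n p\<close> makes all entries coordinates of a single product
  measure, where reflections are available. Coordinates are independent, grouping by rows preserves
  this, and each row is standard Gaussian by reindexing.\<close>

lemma noise_law_eq_distr_gauss:
  assumes n: "0 < n" and p: "0 < p"
  shows "noise_law n p = distr (gauss (grid n p)) (noise_law n p) (\<lambda>\<omega>. \<lambda>i\<in>{..<n}. \<lambda>j\<in>{..<p}. \<omega> (i, j))"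
proof -
  let ?N = "density lborel std_normal_density"
  interpret G: prob_space "gauss (grid n p)" by (rule prob_space_gauss)
  have comp: "distr (gauss (grid n p)) ?N (\<lambda>\<omega>. \<omega> z) = ?N" if "z \<in> grid n p" for z
    by (rule distr_PiM_component[OF prob_space_std_normal that])
  have row: "distr (gauss (grid n p)) (std_gaussian p) (\<lambda>\<omega>. \<lambda>j\<in>{..<p}. \<omega> (i, j)) = std_gaussian p" if "i < n" for i
    unfolding std_gaussian_def using that
    by (intro distr_PiM_reindex[OF prob_space_std_normal, of "\<lambda>j. (i, j)" "{..<p}" "grid n p"]) (auto simp: inj_on_def)
  have ind: "G.indep_vars (\<lambda>_. ?N) (\<lambda>z \<omega>. \<omega> z) (grid n p)"
  proof -
    have "distr (gauss (grid n p)) (gauss (grid n p)) (\<lambda>x. \<lambda>z\<in>grid n p. x z) = gauss (grid n p)"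
      by (subst distr_cong[OF refl refl, of _ _ "\<lambda>x. x"]) (auto simp: space_PiM PiE_iff extensional_restrict intro!: distr_id)
    moreover have "Pi\<^sub>M (grid n p) (\<lambda>z. distr (gauss (grid n p)) ?N (\<lambda>\<omega>. \<omega> z)) = gauss (grid n p)"
      by (intro PiM_cong) (simp_all add: comp del: distr_cong)
    ultimately show ?thesis using n p
      by (subst G.indep_vars_iff_distr_eq_PiM') (auto intro!: measurable_component_singleton simp del: sets_density)
  qed
  have "G.indep_vars (\<lambda>i. gauss ({i} \<times> {..<p})) (\<lambda>i \<omega>. \<lambda>z\<in>{i} \<times> {..<p}. \<omega> z) {..<n}"
    by (rule G.indep_vars_restrict[OF ind]) (auto simp: disjoint_family_on_def)
  then have "G.indep_vars (\<lambda>_. std_gaussian p) (\<lambda>i \<omega>. (\<lambda>y. \<lambda>j\<in>{..<p}. y (i, j)) (\<lambda>z\<in>{i} \<times> {..<p}. \<omega> z)) {..<n}"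
  proof (rule G.indep_vars_compose2)
    fix i assume "i \<in> {..<n}"
    show "(\<lambda>y. \<lambda>j\<in>{..<p}. y (i, j)) \<in> measurable (gauss ({i} \<times> {..<p})) (std_gaussian p)"
      unfolding std_gaussian_def by (intro measurable_restrict measurable_component_singleton) auto
  qed
  moreover have "(\<lambda>i \<omega>. (\<lambda>y. \<lambda>j\<in>{..<p}. y (i, j)) (\<lambda>z\<in>{i} \<times> {..<p}. \<omega> z)) = (\<lambda>i (\<omega> :: nat \<times> nat \<Rightarrow> real). \<lambda>j\<in>{..<p}. \<omega> (i, j))"
    by (auto simp: fun_eq_iff restrict_def)
  ultimately have "G.indep_vars (\<lambda>_. std_gaussian p) (\<lambda>i \<omega>. \<lambda>j\<in>{..<p}. \<omega> (i, j)) {..<n}"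
    by simp
  from noise_law_eq_distr[OF prob_space_gauss n this row] show ?thesis by simp
qed

section \<open>Exponential moments of a standard Gaussian variable\<close>

lemma nn_integral_std_normal_exp_square:
  fixes \<theta> :: real
  assumes \<theta>: "\<theta> < 1 / 2"
  shows "(\<integral>\<^sup>+x. ennreal (exp (\<theta> * x\<^sup>2)) \<partial>density lborel std_normal_density) = ennreal (1 / sqrt (1 - 2 * \<theta>))"
proof -
  \<comment> \<open>The weighted density is \<open>1 / sqrt v\<close> times the normal density with
    mean 0 and variance \<open>1 / v\<close>.\<close>
  define v where "v = 1 - 2 * \<theta>"
  have v: "v > 0" using \<theta> by (simp add: v_def)
  interpret V: prob_space "density lborel (normal_density 0 (1 / sqrt v))"
    by (rule prob_space_normal_density) (use v in simp)
  have "(\<integral>\<^sup>+x. ennreal (exp (\<theta> * x\<^sup>2)) \<partial>density lborel std_normal_density)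
      = (\<integral>\<^sup>+x. ennreal (std_normal_density x) * ennreal (exp (\<theta> * x\<^sup>2)) \<partial>lborel)"
    by (rule nn_integral_density) auto
  also have "\<dots> = (\<integral>\<^sup>+x. ennreal (1 / sqrt v) * ennreal (normal_density 0 (1 / sqrt v) x) \<partial>lborel)"
  proof (rule nn_integral_cong)
    fix x :: real
    have "std_normal_density x * exp (\<theta> * x\<^sup>2) = 1 / sqrt (2 * pi) * exp (- x\<^sup>2 / 2 + \<theta> * x\<^sup>2)"
      by (simp add: std_normal_density_def mult_exp_exp)
    also have "- x\<^sup>2 / 2 + \<theta> * x\<^sup>2 = - (v * x\<^sup>2) / 2"
      by (simp add: v_def algebra_simps)
    also have "1 / sqrt (2 * pi) * exp (- (v * x\<^sup>2) / 2) = 1 / sqrt v * normal_density 0 (1 / sqrt v) x"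
      using v by (simp add: normal_density_def real_sqrt_divide real_sqrt_mult power_divide field_simps)
    finally show "ennreal (std_normal_density x) * ennreal (exp (\<theta> * x\<^sup>2)) = ennreal (1 / sqrt v) * ennreal (normal_density 0 (1 / sqrt v) x)"
      using v by (simp add: ennreal_mult[symmetric] normal_density_nonneg)
  qed
  also have "\<dots> = ennreal (1 / sqrt v) * (\<integral>\<^sup>+x. ennreal (normal_density 0 (1 / sqrt v) x) \<partial>lborel)"
    by (rule nn_integral_cmult) auto
  also have "(\<integral>\<^sup>+x. ennreal (normal_density 0 (1 / sqrt v) x) \<partial>lborel) = 1"
    using V.emeasure_space_1 by (simp add: emeasure_density)
  finally show ?thesis by (simp add: v_def)
qed

text \<open>Completing the square shifts the density to mean \<open>t\<close> and leaves the
  constant \<open>exp (t\<^sup>2 / 2)\<close>.\<close>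

lemma nn_integral_std_normal_exp:
  fixes t :: real
  shows "(\<integral>\<^sup>+x. ennreal (exp (t * x)) \<partial>density lborel std_normal_density) = ennreal (exp (t\<^sup>2 / 2))"
proof -
  interpret V: prob_space "density lborel (normal_density t 1)"
    by (rule prob_space_normal_density) simp
  have "(\<integral>\<^sup>+x. ennreal (exp (t * x)) \<partial>density lborel std_normal_density)
      = (\<integral>\<^sup>+x. ennreal (std_normal_density x) * ennreal (exp (t * x)) \<partial>lborel)"
    by (rule nn_integral_density) auto
  also have "\<dots> = (\<integral>\<^sup>+x. ennreal (exp (t\<^sup>2 / 2)) * ennreal (normal_density t 1 x) \<partial>lborel)"
  proof (rule nn_integral_cong)
    fix x :: real
    have "std_normal_density x * exp (t * x) = 1 / sqrt (2 * pi) * exp (- x\<^sup>2 / 2 + t * x)"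
      by (simp add: std_normal_density_def mult_exp_exp)
    also have "- x\<^sup>2 / 2 + t * x = t\<^sup>2 / 2 + - (x - t)\<^sup>2 / 2"
      by (simp add: power2_eq_square field_simps)
    also have "1 / sqrt (2 * pi) * exp (t\<^sup>2 / 2 + - (x - t)\<^sup>2 / 2) = exp (t\<^sup>2 / 2) * normal_density t 1 x"
      unfolding exp_add by (simp add: normal_density_def)
    finally show "ennreal (std_normal_density x) * ennreal (exp (t * x)) = ennreal (exp (t\<^sup>2 / 2)) * ennreal (normal_density t 1 x)"
      by (simp add: ennreal_mult[symmetric] normal_density_nonneg)
  qed
  also have "\<dots> = ennreal (exp (t\<^sup>2 / 2)) * (\<integral>\<^sup>+x. ennreal (normal_density t 1 x) \<partial>lborel)"
    by (rule nn_integral_cmult) auto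
  also have "(\<integral>\<^sup>+x. ennreal (normal_density t 1 x) \<partial>lborel) = 1"
    using V.emeasure_space_1 by (simp add: emeasure_density)
  finally show ?thesis by simp
qed

section \<open>Reflections of n-dimensional space applied to every column of the noise
  matrix\<close>

definition reflect_rows :: "nat \<Rightarrow> nat \<Rightarrow> (nat \<Rightarrow> real) \<Rightarrow> (nat \<times> nat \<Rightarrow> real) \<Rightarrow> nat \<times> nat \<Rightarrow> real" where
  "reflect_rows n p h \<omega> = (\<lambda>(i, j)\<in>grid n p. \<omega> (i, j) - 2 * h i * (\<Sum>k<n. h k * \<omega> (k, j)))"

lemma measurable_reflect_rows[measurable]: "reflect_rows n p h \<in> measurable (gauss (grid n p)) (gauss (grid n p))"
proof -
  have "(\<lambda>\<omega>. case z of (i, j) \<Rightarrow> \<omega> (i, j) - 2 * h i * (\<Sum>k<n. h k * \<omega> (k, j))) \<in> borel_measurable (gauss (grid n p))"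
    if "z \<in> grid n p" for z
  proof -
    obtain i j where z: "z = (i, j)" by force
    have [measurable]: "(\<lambda>\<omega>. \<omega> (k, j)) \<in> borel_measurable (gauss (grid n p))" if "k < n" for k
      using measurable_component_singleton[of "(k, j)" "grid n p" "\<lambda>_. density lborel std_normal_density"] that \<open>z \<in> grid n p\<close>
      by (auto simp: z)
    have "i < n" using that by (auto simp: z)
    then show ?thesis unfolding z prod.case by measurable
  qed
  then show ?thesis unfolding reflect_rows_def by (intro measurable_restrict) auto
qed

text \<open>Reflecting every column along \<open>h\<close> is a composition of \<open>p\<close>
  reflections of the whole matrix space, one per column, each of which preserves the Gaussian
  law.\<close>

lemma nn_integral_reflect_rows:
  assumes h: "(\<Sum>k<n. (h k)\<^sup>2) = 1" and f[measurable]: "f \<in> borel_measurable (gauss (grid n p))"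
  shows "(\<integral>\<^sup>+\<omega>. f (reflect_rows n p h \<omega>) \<partial>gauss (grid n p)) = (\<integral>\<^sup>+\<omega>. f \<omega> \<partial>gauss (grid n p))"
proof -
  \<comment> \<open>\<open>H j\<close> is the unit vector of the matrix space that carries
    \<open>h\<close> in column \<open>j\<close>; \<open>T m\<close> has reflected the columns below
    \<open>m\<close>.\<close>
  define H where "H j = (\<lambda>(i, j'). if j' = j then h i else 0)" for j :: nat
  define T where "T m \<omega> = (\<lambda>(i, j)\<in>grid n p. if j < m then \<omega> (i, j) - 2 * h i * (\<Sum>k<n. h k * \<omega> (k, j)) else \<omega> (i, j))"
    for m and \<omega> :: "nat \<times> nat \<Rightarrow> real"
  have sumH: "(\<Sum>z\<in>grid n p. H m z * g z) = (\<Sum>k<n. h k * g (k, m))" if "m < p" for m g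
  proof -
    have "(\<Sum>z\<in>grid n p. H m z * g z) = (\<Sum>k<n. \<Sum>j<p. if j = m then h k * g (k, j) else 0)"
      unfolding sum.cartesian_product by (intro sum.cong) (auto simp: H_def)
    then show ?thesis using that by simp
  qed
  have T_Suc: "T (Suc m) \<omega> = reflect (grid n p) (H m) (T m \<omega>)" if "m < p" for m \<omega>
  proof
    fix z :: "nat \<times> nat"
    obtain i j where z: "z = (i, j)" by force
    have *: "(\<Sum>k<n. h k * T m \<omega> (k, m)) = (\<Sum>k<n. h k * \<omega> (k, m))"
      using that by (intro sum.cong) (auto simp: T_def)
    show "T (Suc m) \<omega> z = reflect (grid n p) (H m) (T m \<omega>) z"
      unfolding reflect_def sumH[OF that] * unfolding z by (auto simp: T_def H_def less_Suc_eq)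
  qed
  \<comment> \<open>\<open>f\<close> is kept arbitrary, since the induction step passes to
    \<open>f\<close> composed with the reflection of column \<open>m\<close>.\<close>
  have "(\<lambda>\<omega>. f (T m \<omega>)) \<in> borel_measurable (gauss (grid n p)) \<and> (\<integral>\<^sup>+\<omega>. f (T m \<omega>) \<partial>gauss (grid n p)) = (\<integral>\<^sup>+\<omega>. f \<omega> \<partial>gauss (grid n p))"
    if "m \<le> p" "f \<in> borel_measurable (gauss (grid n p))" for m f
    using that
  proof (induction m arbitrary: f)
    case 0
    have eq: "T 0 \<omega> = \<omega>" if "\<omega> \<in> space (gauss (grid n p))" for \<omega>
      using that by (auto simp: T_def space_PiM fun_eq_iff PiE_iff extensional_def restrict_def)
    have "(\<lambda>\<omega>. f (T 0 \<omega>)) \<in> borel_measurable (gauss (grid n p))"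
      using 0 by (subst measurable_cong[of _ _ f]) (auto simp: eq)
    moreover have "(\<integral>\<^sup>+\<omega>. f (T 0 \<omega>) \<partial>gauss (grid n p)) = (\<integral>\<^sup>+\<omega>. f \<omega> \<partial>gauss (grid n p))"
      by (intro nn_integral_cong) (simp add: eq)
    ultimately show ?case by simp
  next
    case (Suc m)
    let ?g = "\<lambda>\<omega>. f (reflect (grid n p) (H m) \<omega>)"
    have m: "m < p" using Suc.prems by simp
    have rm: "reflect (grid n p) (H m) \<in> measurable (gauss (grid n p)) (gauss (grid n p))"
      using measurable_reflect[of "grid n p" "H m"] by (simp cong: measurable_cong_sets add: sets_gauss)
    have g: "?g \<in> borel_measurable (gauss (grid n p))"
      by (rule measurable_compose[OF rm Suc.prems(2)])
    have "(\<Sum>z\<in>grid n p. (H m z)\<^sup>2) = 1"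
      using sumH[OF m, of "H m"] h by (simp add: power2_eq_square H_def)
    then have "(\<integral>\<^sup>+\<omega>. ?g \<omega> \<partial>gauss (grid n p)) = (\<integral>\<^sup>+\<omega>. f \<omega> \<partial>gauss (grid n p))"
      using Suc.prems(2) by (intro nn_integral_gauss_reflect) auto
    with Suc.IH[OF _ g] m show ?case by (simp add: T_Suc)
  qed
  from this[of p f] f have "(\<integral>\<^sup>+\<omega>. f (T p \<omega>) \<partial>gauss (grid n p)) = (\<integral>\<^sup>+\<omega>. f \<omega> \<partial>gauss (grid n p))" by simp
  moreover have "T p \<omega> = reflect_rows n p h \<omega>" for \<omega>
    by (auto simp: T_def reflect_rows_def restrict_def fun_eq_iff)
  ultimately show ?thesis by simp
qed

section \<open>Tail bounds\<close>

text \<open>The form \<open>x\<^sup>T Y Y\<^sup>T y\<close> of the Gram matrix of the rows; the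
  leading left singular vectors maximise it on the sphere.\<close>

definition bform :: "nat \<Rightarrow> nat \<Rightarrow> (nat \<times> nat \<Rightarrow> real) \<Rightarrow> (nat \<Rightarrow> real) \<Rightarrow> (nat \<Rightarrow> real) \<Rightarrow> real" where
  "bform n p Y x y = (\<Sum>j<p. (\<Sum>i<n. x i * Y (i, j)) * (\<Sum>i<n. y i * Y (i, j)))"

lemma measurable_entry:
  assumes "i < n" "j < p"
  shows "(\<lambda>\<omega>. \<omega> (i, j)) \<in> borel_measurable (gauss (grid n p))"
  using measurable_component_singleton[of "(i, j)" "grid n p" "\<lambda>_. density lborel std_normal_density"] assms
  by simp

lemma measurable_bform[measurable]: "(\<lambda>\<omega>. bform n p \<omega> x y) \<in> borel_measurable (gauss (grid n p))"
  unfolding bform_def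
  by (intro borel_measurable_sum borel_measurable_times borel_measurable_const measurable_entry) auto

text \<open>The reflection that exchanges \<open>x\<close> and the first unit vector turns \<open>\<omega>\<^sup>T x\<close> into the first row of \<open>\<omega>\<close>.\<close>

lemma mgf_bform:
  assumes n: "0 < n" and x: "(\<Sum>i<n. (x i)\<^sup>2) = 1" and \<theta>: "\<theta> < 1 / 2"
  shows "(\<integral>\<^sup>+\<omega>. ennreal (exp (\<theta> * bform n p \<omega> x x)) \<partial>gauss (grid n p)) = ennreal ((1 / sqrt (1 - 2 * \<theta>)) ^ p)"
proof -
  define e :: "nat \<Rightarrow> real" where "e i = (if i = 0 then 1 else 0)" for i
  have e_sum: "(\<Sum>i<n. e i * f i) = f 0" for f
  proof -
    have "(\<Sum>i<n. e i * f i) = (\<Sum>i<n. if i = 0 then f i else 0)" by (intro sum.cong) (auto simp: e_def)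
    then show ?thesis using n by simp
  qed
  have base: "(\<integral>\<^sup>+\<omega>. ennreal (exp (\<theta> * bform n p \<omega> e e)) \<partial>gauss (grid n p)) = ennreal ((1 / sqrt (1 - 2 * \<theta>)) ^ p)"
  proof -
    \<comment> \<open>The factor 1 off row 0 turns the exponential into a product over the whole
      grid, whose expectation factorises.\<close>
    let ?f = "\<lambda>(i, j) t. if i = (0::nat) then ennreal (exp (\<theta> * t\<^sup>2)) else 1"
    have "ennreal (exp (\<theta> * bform n p \<omega> e e)) = (\<Prod>z\<in>grid n p. ?f z (\<omega> z))" for \<omega>
    proof -
      have "ennreal (exp (\<theta> * bform n p \<omega> e e)) = (\<Prod>j<p. ennreal (exp (\<theta> * (\<omega> (0, j))\<^sup>2)))"
        unfolding bform_def e_sum by (simp add: sum_distrib_left exp_sum prod_ennreal power2_eq_square)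
      also have "\<dots> = (\<Prod>j<p. \<Prod>i<n. ?f (i, j) (\<omega> (i, j)))"
        using n by (intro prod.cong refl) (subst prod.remove[of _ 0], auto)
      also have "\<dots> = (\<Prod>i<n. \<Prod>j<p. ?f (i, j) (\<omega> (i, j)))" by (rule prod.swap)
      also have "\<dots> = (\<Prod>z\<in>grid n p. ?f z (\<omega> z))"
        unfolding prod.cartesian_product by (intro prod.cong) auto
      finally show ?thesis .
    qed
    then have "(\<integral>\<^sup>+\<omega>. ennreal (exp (\<theta> * bform n p \<omega> e e)) \<partial>gauss (grid n p))
       = (\<Prod>z\<in>grid n p. \<integral>\<^sup>+t. ?f z t \<partial>density lborel std_normal_density)"
      by (simp only:) (rule gaussP.product_nn_integral_prod, auto)
    also have "\<dots> = (\<Prod>z\<in>grid n p. if fst z = 0 then ennreal (1 / sqrt (1 - 2 * \<theta>)) else 1)"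
      by (intro prod.cong refl) (auto simp: nn_integral_std_normal_exp_square[OF \<theta>] gauss1.emeasure_space_1[simplified] split: prod.split)
    also have "\<dots> = (\<Prod>j<p. \<Prod>i<n. if i = 0 then ennreal (1 / sqrt (1 - 2 * \<theta>)) else 1)"
      by (subst prod.swap, unfold prod.cartesian_product) (intro prod.cong, auto)
    also have "\<dots> = (\<Prod>j<p. ennreal (1 / sqrt (1 - 2 * \<theta>)))"
      using n by (intro prod.cong refl) (subst prod.remove[of _ 0], auto)
    also have "\<dots> = ennreal ((1 / sqrt (1 - 2 * \<theta>)) ^ p)"
      using \<theta> by (simp add: ennreal_power)
    finally show ?thesis .
  qed
  define N where "N = sqrt (\<Sum>i<n. (x i - e i)\<^sup>2)"
  \<comment> \<open>Both \<open>x\<close> and \<open>e\<close> are unit vectors; this value of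
    \<open>N\<^sup>2\<close> is what makes the reflection along \<open>x - e\<close> carry
    \<open>e\<close> to \<open>x\<close>.\<close>
  have N2: "N\<^sup>2 = 2 * (1 - x 0)"
  proof -
    have "N\<^sup>2 = (\<Sum>i<n. (x i)\<^sup>2 - 2 * (e i * x i) + e i * e i)"
      by (simp add: N_def sum_nonneg, rule sum.cong) (auto simp: power2_eq_square algebra_simps)
    also have "\<dots> = (\<Sum>i<n. (x i)\<^sup>2) - 2 * (\<Sum>i<n. e i * x i) + (\<Sum>i<n. e i * e i)"
      by (simp add: sum.distrib sum_subtractf sum_distrib_left)
    finally show ?thesis unfolding e_sum x by (simp add: e_def)
  qed
  show ?thesis
  \<comment> \<open>If \<open>x\<close> is already the first unit vector, there is no direction to
    reflect along.\<close>
  proof (cases "N = 0")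
    case True
    then have "(\<Sum>i<n. (x i - e i)\<^sup>2) = 0" by (simp add: N_def)
    then have "\<And>i. i < n \<Longrightarrow> x i = e i" by (subst (asm) sum_nonneg_eq_0_iff) auto
    then have "bform n p \<omega> x x = bform n p \<omega> e e" for \<omega> by (simp add: bform_def)
    then show ?thesis using base by simp
  next
    case False
    define h where "h i = (x i - e i) / N" for i
    have h: "(\<Sum>i<n. (h i)\<^sup>2) = 1"
    proof -
      have "(\<Sum>i<n. (h i)\<^sup>2) = (\<Sum>i<n. (x i - e i)\<^sup>2) / N\<^sup>2"
        by (simp add: h_def power_divide sum_divide_distrib)
      also have "(\<Sum>i<n. (x i - e i)\<^sup>2) = N\<^sup>2" by (simp add: N_def sum_nonneg)
      finally show ?thesis using False by simp
    qed
    have "bform n p (reflect_rows n p h \<omega>) e e = bform n p \<omega> x x" for \<omega>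
      unfolding bform_def e_sum
    proof (rule sum.cong[OF refl])
      fix j assume j: "j \<in> {..<p}"
      have "(\<Sum>k<n. h k * \<omega> (k, j)) = (\<Sum>k<n. x k * \<omega> (k, j) - e k * \<omega> (k, j)) / N"
        by (simp add: h_def sum_divide_distrib algebra_simps diff_divide_distrib)
      also have "\<dots> = ((\<Sum>k<n. x k * \<omega> (k, j)) - \<omega> (0, j)) / N"
        by (simp add: sum_subtractf e_sum)
      finally have *: "(\<Sum>k<n. h k * \<omega> (k, j)) = ((\<Sum>k<n. x k * \<omega> (k, j)) - \<omega> (0, j)) / N" .
      have "reflect_rows n p h \<omega> (0, j) = \<omega> (0, j) - 2 * h 0 * (\<Sum>k<n. h k * \<omega> (k, j))"
        using n j by (simp add: reflect_rows_def)
      also have "\<dots> = \<omega> (0, j) + (2 * (1 - x 0)) / N\<^sup>2 * ((\<Sum>k<n. x k * \<omega> (k, j)) - \<omega> (0, j))"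
        unfolding * using False by (simp add: h_def e_def power2_eq_square field_simps)
      also have "\<dots> = (\<Sum>k<n. x k * \<omega> (k, j))"
        unfolding N2[symmetric] using False by simp
      finally show "reflect_rows n p h \<omega> (0, j) * reflect_rows n p h \<omega> (0, j)
          = (\<Sum>i<n. x i * \<omega> (i, j)) * (\<Sum>i<n. x i * \<omega> (i, j))" by simp
    qed
    then have "(\<integral>\<^sup>+\<omega>. ennreal (exp (\<theta> * bform n p \<omega> x x)) \<partial>gauss (grid n p))
       = (\<integral>\<^sup>+\<omega>. ennreal (exp (\<theta> * bform n p (reflect_rows n p h \<omega>) e e)) \<partial>gauss (grid n p))" by simp
    also have "\<dots> = (\<integral>\<^sup>+\<omega>. ennreal (exp (\<theta> * bform n p \<omega> e e)) \<partial>gauss (grid n p))"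
      by (rule nn_integral_reflect_rows[OF h]) measurable
    finally show ?thesis using base by simp
  qed
qed

text \<open>The linear terms cancel, and
  \<open>\<bar>ln (1 + z) - z\<bar> \<le> 2 * z\<^sup>2\<close> at \<open>z = - 2 * \<theta>\<close>
  controls the rest. That bound is for \<open>\<bar>z\<bar> \<le> 1 / 2\<close>, hence the range of
  \<open>\<theta>\<close>.\<close>

lemma chi_square_mgf_bound:
  fixes \<theta> :: real
  assumes "\<bar>\<theta>\<bar> \<le> 1 / 4"
  shows "exp (- \<theta>) / sqrt (1 - 2 * \<theta>) \<le> exp (4 * \<theta>\<^sup>2)"
proof -
  have "\<bar>ln (1 + (- 2 * \<theta>)) - (- 2 * \<theta>)\<bar> \<le> 2 * (- 2 * \<theta>)\<^sup>2"
    using assms by (intro abs_ln_one_plus_x_minus_x_bound) auto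
  then have l: "ln (1 - 2 * \<theta>) \<ge> - 2 * \<theta> - 8 * \<theta>\<^sup>2"
    by (auto simp: power_mult_distrib abs_le_iff)
  have pos: "1 - 2 * \<theta> > 0" using assms by auto
  have "exp (- \<theta>) / sqrt (1 - 2 * \<theta>) = exp (- \<theta> - ln (1 - 2 * \<theta>) / 2)"
    using pos by (simp add: exp_diff ln_sqrt[symmetric])
  also have "\<dots> \<le> exp (4 * \<theta>\<^sup>2)" using l by simp
  finally show ?thesis .
qed

text \<open>For a unit vector \<open>x\<close> the form is chi-square with \<open>p\<close> degrees
  of freedom. Each side is a Chernoff bound with the quadratic estimate of the centred generating
  function.\<close>

lemma bform_tail:
  assumes n: "0 < n" and p: "0 < p" and x: "(\<Sum>i<n. (x i)\<^sup>2) = 1" and t: "0 < t" "t \<le> 2 * real p"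
  shows "emeasure (gauss (grid n p)) {\<omega>\<in>space (gauss (grid n p)). \<bar>bform n p \<omega> x x - p\<bar> \<ge> t}
    \<le> ennreal (2 * exp (- t\<^sup>2 / (16 * p)))"
proof -
  let ?G = "gauss (grid n p)"
  have side: "emeasure ?G {\<omega>\<in>space ?G. \<sigma> * (bform n p \<omega> x x - p) \<ge> t} \<le> ennreal (exp (- t\<^sup>2 / (16 * p)))"
    if \<sigma>: "\<sigma> \<in> {1, -1}" for \<sigma> :: real
  proof -
    \<comment> \<open>Minimiser of \<open>- l * t + 4 * l\<^sup>2 * p\<close>;
      \<open>t \<le> 2 * p\<close> keeps it in the range \<open>l \<le> 1 / 4\<close>.\<close>
    define l where "l = t / (8 * p)"
    have l: "0 < l" "l \<le> 1 / 4" using t p by (auto simp: l_def field_simps)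
    define \<theta> where "\<theta> = \<sigma> * l"
    have \<theta>: "\<bar>\<theta>\<bar> \<le> 1 / 4" "\<theta>\<^sup>2 = l\<^sup>2" using l \<sigma> by (auto simp: \<theta>_def)
    have "emeasure ?G {\<omega>\<in>space ?G. \<sigma> * (bform n p \<omega> x x - p) \<ge> t}
        \<le> ennreal (exp (- l * t)) * (\<integral>\<^sup>+\<omega>\<in>space ?G. ennreal (exp (l * (\<sigma> * (bform n p \<omega> x x - p)))) \<partial>?G)"
      using l by (intro Chernoff_ineq_nn_integral_ge) auto
    also have "(\<integral>\<^sup>+\<omega>\<in>space ?G. ennreal (exp (l * (\<sigma> * (bform n p \<omega> x x - p)))) \<partial>?G)
        = (\<integral>\<^sup>+\<omega>. ennreal (exp (- \<theta> * p)) * ennreal (exp (\<theta> * bform n p \<omega> x x)) \<partial>?G)"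
      by (intro nn_integral_cong) (simp add: \<theta>_def ennreal_mult[symmetric] mult_exp_exp algebra_simps)
    also have "\<dots> = ennreal (exp (- \<theta> * p)) * ennreal ((1 / sqrt (1 - 2 * \<theta>)) ^ p)"
      using \<theta> by (subst nn_integral_cmult) (auto simp: mgf_bform[OF n x])
    also have "\<dots> = ennreal ((exp (- \<theta>) / sqrt (1 - 2 * \<theta>)) ^ p)"
      using \<theta> by (simp add: ennreal_mult[symmetric] power_divide exp_of_nat_mult[symmetric] mult.commute)
    also have "\<dots> \<le> ennreal (exp (4 * \<theta>\<^sup>2) ^ p)"
      using \<theta> by (intro ennreal_leI power_mono chi_square_mgf_bound) auto
    also have "exp (4 * \<theta>\<^sup>2) ^ p = exp (4 * l\<^sup>2 * p)"
      by (simp add: \<theta> exp_of_nat_mult[symmetric] mult_ac)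
    also have "ennreal (exp (- l * t)) * ennreal (exp (4 * l\<^sup>2 * p)) = ennreal (exp (- l * t + 4 * l\<^sup>2 * p))"
      by (simp add: ennreal_mult[symmetric] mult_exp_exp)
    also have "- l * t + 4 * l\<^sup>2 * p = - t\<^sup>2 / (16 * p)"
      using p by (simp add: l_def power2_eq_square field_simps)
    finally show ?thesis by (simp add: mult_left_mono)
  qed
  have "emeasure ?G {\<omega>\<in>space ?G. \<bar>bform n p \<omega> x x - p\<bar> \<ge> t}
     \<le> emeasure ?G ({\<omega>\<in>space ?G. 1 * (bform n p \<omega> x x - p) \<ge> t} \<union> {\<omega>\<in>space ?G. -1 * (bform n p \<omega> x x - p) \<ge> t})"
    by (intro emeasure_mono) auto
  also have "\<dots> \<le> emeasure ?G {\<omega>\<in>space ?G. 1 * (bform n p \<omega> x x - p) \<ge> t}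
      + emeasure ?G {\<omega>\<in>space ?G. -1 * (bform n p \<omega> x x - p) \<ge> t}"
    by (intro emeasure_subadditive) measurable
  also have "\<dots> \<le> ennreal (exp (- t\<^sup>2 / (16 * p))) + ennreal (exp (- t\<^sup>2 / (16 * p)))"
    by (intro add_mono side) auto
  finally show ?thesis by (simp add: ennreal_plus[symmetric] del: ennreal_plus)
qed

lemma mgf_linear:
  assumes i: "i < n"
  shows "(\<integral>\<^sup>+\<omega>. ennreal (exp (t * (\<Sum>j<p. b j * \<omega> (i, j)))) \<partial>gauss (grid n p)) = ennreal (exp (t\<^sup>2 * (\<Sum>j<p. (b j)\<^sup>2) / 2))"
proof -
  let ?f = "\<lambda>(k, j) s. if k = i then ennreal (exp (t * b j * s)) else 1"
  have "ennreal (exp (t * (\<Sum>j<p. b j * \<omega> (i, j)))) = (\<Prod>z\<in>grid n p. ?f z (\<omega> z))" for \<omega>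
  proof -
    have "ennreal (exp (t * (\<Sum>j<p. b j * \<omega> (i, j)))) = (\<Prod>j<p. ennreal (exp (t * b j * \<omega> (i, j))))"
      by (simp add: sum_distrib_left exp_sum prod_ennreal mult.assoc)
    also have "\<dots> = (\<Prod>j<p. \<Prod>k<n. ?f (k, j) (\<omega> (k, j)))"
      using i by (intro prod.cong refl) (subst prod.remove[of _ i], auto)
    also have "\<dots> = (\<Prod>k<n. \<Prod>j<p. ?f (k, j) (\<omega> (k, j)))" by (rule prod.swap)
    also have "\<dots> = (\<Prod>z\<in>grid n p. ?f z (\<omega> z))"
      unfolding prod.cartesian_product by (intro prod.cong) auto
    finally show ?thesis .
  qed
  then have "(\<integral>\<^sup>+\<omega>. ennreal (exp (t * (\<Sum>j<p. b j * \<omega> (i, j)))) \<partial>gauss (grid n p))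
     = (\<Prod>z\<in>grid n p. \<integral>\<^sup>+s. ?f z s \<partial>density lborel std_normal_density)"
    by (simp only:) (rule gaussP.product_nn_integral_prod, auto)
  also have "\<dots> = (\<Prod>z\<in>grid n p. if fst z = i then ennreal (exp ((t * b (snd z))\<^sup>2 / 2)) else 1)"
    by (intro prod.cong refl) (auto simp: nn_integral_std_normal_exp gauss1.emeasure_space_1[simplified] split: prod.split)
  also have "\<dots> = (\<Prod>j<p. \<Prod>k<n. if k = i then ennreal (exp ((t * b j)\<^sup>2 / 2)) else 1)"
    by (subst prod.swap, unfold prod.cartesian_product) (intro prod.cong, auto)
  also have "\<dots> = (\<Prod>j<p. ennreal (exp ((t * b j)\<^sup>2 / 2)))"
    using i by (intro prod.cong refl) (subst prod.remove[of _ i], auto)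
  also have "\<dots> = ennreal (exp (t\<^sup>2 * (\<Sum>j<p. (b j)\<^sup>2) / 2))"
    by (simp add: prod_ennreal exp_sum[symmetric] sum_distrib_left sum_divide_distrib power_mult_distrib)
  finally show ?thesis .
qed

lemma linear_tail:
  assumes i: "i < n" and b: "B\<^sup>2 = (\<Sum>j<p. (b j)\<^sup>2)" "0 < B" and r: "0 < r"
  shows "emeasure (gauss (grid n p)) {\<omega>\<in>space (gauss (grid n p)). \<bar>\<Sum>j<p. b j * \<omega> (i, j)\<bar> \<ge> r * B}
    \<le> ennreal (2 * exp (- r\<^sup>2 / 2))"
proof -
  let ?G = "gauss (grid n p)"
  let ?g = "\<lambda>\<omega>. \<Sum>j<p. b j * \<omega> (i, j)"
  have [measurable]: "?g \<in> borel_measurable ?G"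
    using i by (intro borel_measurable_sum borel_measurable_times borel_measurable_const measurable_entry) auto
  have side: "emeasure ?G {\<omega>\<in>space ?G. \<sigma> * ?g \<omega> \<ge> r * B} \<le> ennreal (exp (- r\<^sup>2 / 2))"
    if \<sigma>: "\<sigma> \<in> {1, -1}" for \<sigma> :: real
  proof -
    \<comment> \<open>Minimiser of \<open>- l * r * B + l\<^sup>2 * B\<^sup>2 / 2\<close>.\<close>
    define l where "l = r / B"
    have l: "0 < l" using b r by (simp add: l_def)
    have "emeasure ?G {\<omega>\<in>space ?G. \<sigma> * ?g \<omega> \<ge> r * B}
        \<le> ennreal (exp (- l * (r * B))) * (\<integral>\<^sup>+\<omega>\<in>space ?G. ennreal (exp (l * (\<sigma> * ?g \<omega>))) \<partial>?G)"
      using l by (intro Chernoff_ineq_nn_integral_ge) auto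
    also have "(\<integral>\<^sup>+\<omega>\<in>space ?G. ennreal (exp (l * (\<sigma> * ?g \<omega>))) \<partial>?G) = (\<integral>\<^sup>+\<omega>. ennreal (exp (l * \<sigma> * ?g \<omega>)) \<partial>?G)"
      by (intro nn_integral_cong) (simp add: mult.assoc)
    also have "\<dots> = ennreal (exp ((l * \<sigma>)\<^sup>2 * B\<^sup>2 / 2))"
      by (simp add: mgf_linear[OF i] b)
    also have "(l * \<sigma>)\<^sup>2 * B\<^sup>2 / 2 = r\<^sup>2 / 2"
      using \<sigma> b(2) by (auto simp: l_def power_divide)
    also have "ennreal (exp (- l * (r * B))) * ennreal (exp (r\<^sup>2 / 2)) = ennreal (exp (- r\<^sup>2 / 2))"
      using b(2) by (simp add: ennreal_mult[symmetric] mult_exp_exp l_def power2_eq_square)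
    finally show ?thesis by simp
  qed
  have "emeasure ?G {\<omega>\<in>space ?G. \<bar>?g \<omega>\<bar> \<ge> r * B}
     \<le> emeasure ?G ({\<omega>\<in>space ?G. 1 * ?g \<omega> \<ge> r * B} \<union> {\<omega>\<in>space ?G. -1 * ?g \<omega> \<ge> r * B})"
    by (intro emeasure_mono) auto
  also have "\<dots> \<le> emeasure ?G {\<omega>\<in>space ?G. 1 * ?g \<omega> \<ge> r * B} + emeasure ?G {\<omega>\<in>space ?G. -1 * ?g \<omega> \<ge> r * B}"
    by (intro emeasure_subadditive) measurable
  also have "\<dots> \<le> ennreal (exp (- r\<^sup>2 / 2)) + ennreal (exp (- r\<^sup>2 / 2))"
    by (intro add_mono side) auto
  finally show ?thesis by (simp add: ennreal_plus[symmetric] del: ennreal_plus)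
qed

section \<open>Symmetric forms on the sphere\<close>

definition ip :: "nat \<Rightarrow> (nat \<Rightarrow> real) \<Rightarrow> (nat \<Rightarrow> real) \<Rightarrow> real" where
  "ip n x y = (\<Sum>i<n. x i * y i)"

text \<open>Vectors are functions on all naturals, so a form in \<open>n\<close> coordinates has to
  ignore those from \<open>n\<close> on; this is the last clause. Linearity on the left extends to
  the right by symmetry.\<close>

definition symmetric_form :: "nat \<Rightarrow> ((nat \<Rightarrow> real) \<Rightarrow> (nat \<Rightarrow> real) \<Rightarrow> real) \<Rightarrow> bool" where
  "symmetric_form n f \<longleftrightarrow>
    (\<forall>x y. f x y = f y x) \<and>
    (\<forall>a b x y z. f (\<lambda>i. a * x i + b * y i) z = a * f x z + b * f y z) \<and>
    (\<forall>x x' y. (\<forall>i<n. x i = x' i) \<longrightarrow> f x y = f x' y)"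

lemma symmetric_formD:
  assumes "symmetric_form n f"
  shows symmetric_form_commute: "f x y = f y x"
    and symmetric_form_left: "f (\<lambda>i. a * x i + b * y i) z = a * f x z + b * f y z"
    and symmetric_form_cong: "(\<And>i. i < n \<Longrightarrow> x i = x' i) \<Longrightarrow> f x y = f x' y"
  using assms unfolding symmetric_form_def by blast+

lemma symmetric_form_square:
  assumes f: "symmetric_form n f"
  shows "f (\<lambda>i. a * x i + b * y i) (\<lambda>i. a * x i + b * y i) = a\<^sup>2 * f x x + 2 * a * b * f x y + b\<^sup>2 * f y y"
proof -
  let ?z = "\<lambda>i. a * x i + b * y i"
  have "f ?z ?z = a * f x ?z + b * f y ?z" by (rule symmetric_form_left[OF f])
  also have "f x ?z = a * f x x + b * f y x"
    by (subst symmetric_form_commute[OF f]) (rule symmetric_form_left[OF f])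
  also have "f y ?z = a * f x y + b * f y y"
    by (subst symmetric_form_commute[OF f]) (rule symmetric_form_left[OF f])
  finally show ?thesis
    by (simp add: symmetric_form_commute[OF f, of y x] power2_eq_square algebra_simps)
qed

lemma symmetric_form_bform: "symmetric_form n (bform n p Y)"
  unfolding symmetric_form_def
proof (intro conjI allI impI)
  fix x y show "bform n p Y x y = bform n p Y y x"
    by (simp add: bform_def mult.commute)
next
  fix a b x y z
  have "(\<Sum>i<n. (a * x i + b * y i) * Y (i, j)) = a * (\<Sum>i<n. x i * Y (i, j)) + b * (\<Sum>i<n. y i * Y (i, j))" for j
    by (simp add: sum_distrib_left sum.distrib[symmetric] algebra_simps)
  moreover have "(\<Sum>j<p. (a * U j + b * V j) * W j) = a * (\<Sum>j<p. U j * W j) + b * (\<Sum>j<p. V j * W j)"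
    for U V W :: "nat \<Rightarrow> real"
    by (simp add: sum_distrib_left sum.distrib[symmetric] algebra_simps)
  ultimately show "bform n p Y (\<lambda>i. a * x i + b * y i) z = a * bform n p Y x z + b * bform n p Y y z"
    by (simp add: bform_def)
next
  fix x x' y :: "nat \<Rightarrow> real" assume "\<forall>i<n. x i = x' i"
  then show "bform n p Y x y = bform n p Y x' y" by (simp add: bform_def)
qed

lemma symmetric_form_ip: "symmetric_form n (ip n)"
  unfolding symmetric_form_def
  by (auto simp: ip_def sum_distrib_left sum.distrib[symmetric] algebra_simps)

lemma symmetric_form_diff:
  assumes f: "symmetric_form n f" and g: "symmetric_form n g"
  shows "symmetric_form n (\<lambda>x y. a * f x y - b * g x y)"
  unfolding symmetric_form_def
proof (intro conjI allI impI)
  fix x y show "a * f x y - b * g x y = a * f y x - b * g y x"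
    using symmetric_form_commute[OF f, of x y] symmetric_form_commute[OF g, of x y] by simp
next
  fix c d x y z
  show "a * f (\<lambda>i. c * x i + d * y i) z - b * g (\<lambda>i. c * x i + d * y i) z
      = c * (a * f x z - b * g x z) + d * (a * f y z - b * g y z)"
    unfolding symmetric_form_left[OF f] symmetric_form_left[OF g] by (simp add: algebra_simps)
next
  fix x x' y :: "nat \<Rightarrow> real" assume "\<forall>i<n. x i = x' i"
  then show "a * f x y - b * g x y = a * f x' y - b * g x' y"
    using symmetric_form_cong[OF f, of x x' y] symmetric_form_cong[OF g, of x x' y] by simp
qed

lemma ip_nonneg: "0 \<le> ip n x x"
  by (simp add: ip_def sum_nonneg)

lemma ip_zeroD: "ip n x x = 0 \<Longrightarrow> i < n \<Longrightarrow> x i = 0"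
  by (auto simp: ip_def sum_nonneg_eq_0_iff)

lemma symmetric_form_zero:
  assumes f: "symmetric_form n f" and x: "ip n x x = 0"
  shows "f x y = 0"
proof -
  have "f x y = f (\<lambda>i. 0 * x i + 0 * x i) y"
    by (rule symmetric_form_cong[OF f]) (simp add: ip_zeroD[OF x])
  also have "\<dots> = 0" by (subst symmetric_form_left[OF f]) simp
  finally show ?thesis .
qed

text \<open>Polarisation with \<open>sqrt r * x + y / sqrt r\<close> and
  \<open>sqrt r * x - y / sqrt r\<close>, and the parallelogram law. The free weight
  \<open>r\<close> lets a short vector be paired with a long one.\<close>

lemma polarization_bound:
  assumes f: "symmetric_form n f" and A: "\<And>x. \<bar>f x x\<bar> \<le> A * ip n x x" and r: "0 < r"
  shows "2 * \<bar>f x y\<bar> \<le> A * (r * ip n x x + ip n y y / r)"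
proof -
  define t where "t = sqrt r"
  have t: "t > 0" "t\<^sup>2 = r" using r by (auto simp: t_def)
  have c: "t * (1 / t) = 1" using t by simp
  have sq: "(1 / t)\<^sup>2 = 1 / r" "(- (1 / t))\<^sup>2 = 1 / r" using t by (auto simp: power_divide)
  let ?u = "\<lambda>i. t * x i + (1 / t) * y i" and ?v = "\<lambda>i. t * x i + (- (1 / t)) * y i"
  have "f ?u ?u - f ?v ?v = 4 * (t * (1 / t)) * f x y"
    unfolding symmetric_form_square[OF f] by (simp add: algebra_simps)
  then have 1: "f ?u ?u - f ?v ?v = 4 * f x y" unfolding c by simp
  have 2: "ip n ?u ?u + ip n ?v ?v = 2 * (r * ip n x x + ip n y y / r)"
    unfolding symmetric_form_square[OF symmetric_form_ip] t sq by (simp add: algebra_simps)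
  have "4 * \<bar>f x y\<bar> \<le> \<bar>f ?u ?u\<bar> + \<bar>f ?v ?v\<bar>" using 1 by linarith
  also have "\<dots> \<le> A * (ip n ?u ?u + ip n ?v ?v)" using A[of ?u] A[of ?v] by (simp add: distrib_left)
  finally show ?thesis unfolding 2 mult.left_commute[of A 2] by linarith
qed

text \<open>The quotient of the two lengths as weight makes both terms equal. Null vectors are
  treated apart, since they admit no such weight.\<close>

lemma polarization_bound_sqrt:
  assumes f: "symmetric_form n f" and A: "\<And>x. \<bar>f x x\<bar> \<le> A * ip n x x"
  shows "\<bar>f x y\<bar> \<le> A * sqrt (ip n x x) * sqrt (ip n y y)"
proof (cases "ip n x x = 0 \<or> ip n y y = 0")
  case True
  then have "f x y = 0"
    using symmetric_form_zero[OF f, of x y] symmetric_form_zero[OF f, of y x] symmetric_form_commute[OF f, of x y] by auto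
  then show ?thesis using True by auto
next
  case False
  then have pos: "0 < ip n x x" "0 < ip n y y" using ip_nonneg[of n x] ip_nonneg[of n y] by auto
  define a b where "a = sqrt (ip n x x)" and "b = sqrt (ip n y y)"
  have ab: "a > 0" "b > 0" "ip n x x = a\<^sup>2" "ip n y y = b\<^sup>2" using pos by (auto simp: a_def b_def)
  have "2 * \<bar>f x y\<bar> \<le> A * (b / a * ip n x x + ip n y y / (b / a))"
    by (rule polarization_bound[OF f A]) (use ab in simp)
  also have "\<dots> = 2 * (A * a * b)" unfolding ab(3,4) using ab by (simp add: power2_eq_square field_simps)
  finally show ?thesis by (simp add: a_def b_def)
qed

lemma ip_Cauchy_Schwarz: "\<bar>ip n x y\<bar> \<le> sqrt (ip n x x) * sqrt (ip n y y)"
  using polarization_bound_sqrt[OF symmetric_form_ip, of n 1 x y] by (simp add: abs_of_nonneg ip_nonneg)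

text \<open>The form \<open>\<mu> * ip - f\<close> is positive semidefinite and vanishes at
  \<open>y\<close>, so \<open>y\<close> lies in its kernel. For the Gram form this is the
  eigenvector equation of a maximiser.\<close>

lemma stationary:
  assumes f: "symmetric_form n f" and le: "\<And>x. f x x \<le> \<mu> * ip n x x" and eq: "f y y = \<mu> * ip n y y"
  shows "f z y = \<mu> * ip n z y"
proof -
  let ?g = "\<lambda>x y. \<mu> * ip n x y - 1 * f x y"
  have g: "symmetric_form n ?g" by (rule symmetric_form_diff[OF symmetric_form_ip f])
  \<comment> \<open>At \<open>y + t * z\<close> the semidefinite form is
    \<open>t\<^sup>2 * c + 2 * t * d\<close>, which this \<open>t\<close> turns into
    \<open>- t\<^sup>2 * (c + 2)\<close>; the \<open>+ 1\<close> avoids a zero denominator.\<close>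
  define c d t where "c = ?g z z" and "d = ?g z y" and "t = - d / (c + 1)"
  have c: "c \<ge> 0" using le[of z] by (simp add: c_def)
  have dt: "d = - t * (c + 1)" using c by (simp add: t_def)
  have "0 \<le> ?g (\<lambda>i. t * z i + 1 * y i) (\<lambda>i. t * z i + 1 * y i)" using le by simp
  also have "\<dots> = t\<^sup>2 * c + 2 * t * d"
    unfolding symmetric_form_square[OF g] using eq by (simp add: c_def d_def)
  also have "\<dots> = - (t\<^sup>2 * (c + 2))"
    unfolding dt by (simp add: power2_eq_square algebra_simps)
  finally have "t\<^sup>2 \<le> 0" using c by (simp add: mult_le_0_iff)
  then show ?thesis using dt by (simp add: d_def)
qed

section \<open>The unit sphere, its compactness and a lattice net for it\<close>

definition sphere_n :: "nat \<Rightarrow> (nat \<Rightarrow> real) set" where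
  "sphere_n n = {x. (\<forall>i\<ge>n. x i = 0) \<and> ip n x x = 1}"

lemma continuous_coord[continuous_intros]: "continuous_on S (\<lambda>x :: nat \<Rightarrow> real. x i)"
  by (rule continuous_on_subset[OF continuous_on_product_coordinates]) simp

lemma continuous_on_ip[continuous_intros]: "continuous_on S (\<lambda>x. ip n x x)"
  and continuous_on_ip2[continuous_intros]: "continuous_on S (\<lambda>x. ip n x y)"
  and continuous_on_bform[continuous_intros]: "continuous_on S (\<lambda>x. bform n p Y x x)"
  unfolding ip_def bform_def by (intro continuous_intros)+

text \<open>A closed subset of a product of compact intervals. Pinning the coordinates from
  \<open>n\<close> on to 0 makes the sphere compact among functions on the naturals.\<close>

lemma compact_sphere_n: "compact (sphere_n n)"
proof -
  let ?S = "\<lambda>i. if i < n then {-1..1::real} else {0}"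
  have "compactin (product_topology (\<lambda>_. euclidean) UNIV) (Pi\<^sub>E UNIV ?S)"
    unfolding compactin_PiE by auto
  then have c: "compact (Pi\<^sub>E UNIV ?S)"
    by (simp add: euclidean_product_topology)
  have "sphere_n n = (\<Inter>i\<in>{n..}. {x. x i = 0}) \<inter> {x. ip n x x = 1}"
    by (auto simp: sphere_n_def)
  moreover have "closed (\<Inter>i\<in>{n..}. {x :: nat \<Rightarrow> real. x i = 0})"
    by (intro closed_INT ballI closed_Collect_eq continuous_intros)
  moreover have "closed {x :: nat \<Rightarrow> real. ip n x x = 1}"
    by (intro closed_Collect_eq continuous_intros)
  ultimately have cl: "closed (sphere_n n)" by (simp only: closed_Int)
  have "x \<in> Pi\<^sub>E UNIV ?S" if x: "x \<in> sphere_n n" for x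
  proof (rule PiE_I)
    fix i
    show "x i \<in> ?S i"
    proof (cases "i < n")
      case True
      have "(x i)\<^sup>2 \<le> ip n x x"
        unfolding ip_def using True member_le_sum[of i "{..<n}" "\<lambda>i. x i * x i"] by (simp add: power2_eq_square)
      also have "\<dots> = 1" using x by (simp add: sphere_n_def)
      finally have "\<bar>x i\<bar> \<le> 1" by (simp add: abs_square_le_1)
      then show ?thesis using True by auto
    next
      case False
      then show ?thesis using x by (simp add: sphere_n_def)
    qed
  qed simp
  then have "sphere_n n = Pi\<^sub>E UNIV ?S \<inter> sphere_n n" by blast
  moreover have "compact (Pi\<^sub>E UNIV ?S \<inter> sphere_n n)" using c cl by (rule compact_Int_closed)
  ultimately show ?thesis by simp
qed

lemma unit_coordinate_in_sphere: "0 < n \<Longrightarrow> (\<lambda>i. if i = 0 then 1 else 0) \<in> sphere_n n"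
  by (simp add: sphere_n_def ip_def if_distrib cong: if_cong)

lemma sphere_bound_extend:
  assumes f: "symmetric_form n f" and le: "\<And>x. x \<in> sphere_n n \<Longrightarrow> f x x \<le> c"
  shows "f x x \<le> c * ip n x x"
proof (cases "ip n x x = 0")
  case True
  then show ?thesis using symmetric_form_zero[OF f True] by simp
next
  case False
  define r where "r = sqrt (ip n x x)"
  have r: "r > 0" "ip n x x = r\<^sup>2" using False ip_nonneg[of n x] by (auto simp: r_def)
  define y where "y i = (if i < n then x i / r else 0)" for i
  have "ip n y y = ip n x x / r\<^sup>2"
    by (simp add: ip_def y_def sum_divide_distrib power2_eq_square)
  then have y: "y \<in> sphere_n n" using r by (simp add: sphere_n_def y_def)
  have "f x x = f (\<lambda>i. r * y i + 0 * y i) (\<lambda>i. r * y i + 0 * y i)"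
  proof -
    have *: "\<And>i. i < n \<Longrightarrow> x i = r * y i + 0 * y i" using r by (simp add: y_def)
    have "f x x = f (\<lambda>i. r * y i + 0 * y i) x" by (rule symmetric_form_cong[OF f *])
    also have "\<dots> = f x (\<lambda>i. r * y i + 0 * y i)" by (rule symmetric_form_commute[OF f])
    also have "\<dots> = f (\<lambda>i. r * y i + 0 * y i) (\<lambda>i. r * y i + 0 * y i)" by (rule symmetric_form_cong[OF f *])
    finally show ?thesis .
  qed
  also have "\<dots> = r\<^sup>2 * f y y" unfolding symmetric_form_square[OF f] by simp
  also have "\<dots> \<le> r\<^sup>2 * c" using le[OF y] by (intro mult_left_mono) auto
  finally show ?thesis by (simp add: r(2) mult.commute)
qed

text \<open>Let \<open>z\<close> be the maximiser \<open>x0\<close> of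
  \<open>\<bar>f x x\<bar>\<close> rounded to the lattice. Since
  \<open>f x0 x0 - f z z = f (x0 - z) (x0 + z)\<close>, the error is at most half of the maximum and
  can be absorbed.\<close>

lemma net_bound:
  assumes n: "0 < n" and f: "symmetric_form n f" and cont: "continuous_on UNIV (\<lambda>x. f x x)"
    and net: "\<And>m :: nat \<Rightarrow> int. (\<Sum>i<n. (m i)\<^sup>2) \<le> 33 * int n \<Longrightarrow>
      \<bar>f (\<lambda>i. real_of_int (m i) / (4 * sqrt n)) (\<lambda>i. real_of_int (m i) / (4 * sqrt n))\<bar> \<le> T"
  shows "\<bar>f x x\<bar> \<le> 2 * T * ip n x x"
proof -
  have "\<exists>x0\<in>sphere_n n. \<forall>y\<in>sphere_n n. \<bar>f y y\<bar> \<le> \<bar>f x0 x0\<bar>"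
    using unit_coordinate_in_sphere[OF n]
    by (intro continuous_attains_sup compact_sphere_n continuous_intros continuous_on_subset[OF cont]) auto
  then obtain x0 where x0: "x0 \<in> sphere_n n" and max: "\<And>y. y \<in> sphere_n n \<Longrightarrow> \<bar>f y y\<bar> \<le> \<bar>f x0 x0\<bar>"
    by blast
  define A where "A = \<bar>f x0 x0\<bar>"
  have x1: "ip n x0 x0 = 1" using x0 by (simp add: sphere_n_def)
  have mf: "symmetric_form n (\<lambda>x0 y. 0 * ip n x0 y - 1 * f x0 y)"
    by (rule symmetric_form_diff[OF symmetric_form_ip f])
  have A: "\<bar>f y y\<bar> \<le> A * ip n y y" for y
  proof -
    have "f y y \<le> A * ip n y y"
      by (rule sphere_bound_extend[OF f]) (use max in \<open>force simp: A_def\<close>)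
    moreover have "0 * ip n y y - 1 * f y y \<le> A * ip n y y"
      by (rule sphere_bound_extend[OF mf]) (use max in \<open>force simp: A_def\<close>)
    ultimately show ?thesis by (simp add: abs_le_iff)
  qed
  \<comment> \<open>Mesh \<open>1 / (4 * sqrt n)\<close>: each coordinate moves by at most
    \<open>1 / (8 * sqrt n)\<close>, the vector by at most \<open>1 / 8\<close>.\<close>
  define m where "m i = round (x0 i * (4 * sqrt n))" for i
  define z where "z i = real_of_int (m i) / (4 * sqrt n)" for i
  have z_eq: "z = (\<lambda>i. real_of_int (m i) / (4 * sqrt n))" by (rule ext) (simp add: z_def)
  let ?d = "\<lambda>i. 1 * x0 i + (- 1) * z i" and ?e = "\<lambda>i. 1 * x0 i + 1 * z i"
  have sn: "sqrt n > 0" using n by simp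
  have d: "ip n ?d ?d \<le> 1 / 64"
  proof -
    have "?d i * ?d i \<le> 1 / (64 * n)" for i
    proof -
      have "\<bar>x0 i * (4 * sqrt n) - real_of_int (m i)\<bar> \<le> 1 / 2"
        unfolding m_def using of_int_round_abs_le[of "x0 i * (4 * sqrt n)"] by (simp add: abs_minus_commute)
      then have "(x0 i * (4 * sqrt n) - real_of_int (m i))\<^sup>2 \<le> (1 / 2)\<^sup>2"
        by (metis abs_ge_zero power2_abs power_mono)
      moreover have "?d i * ?d i = (x0 i * (4 * sqrt n) - real_of_int (m i))\<^sup>2 / (16 * n)"
        using sn by (simp add: z_def power2_eq_square field_simps)
      ultimately show ?thesis using n by (simp add: field_simps power2_eq_square)
    qed
    then have "ip n ?d ?d \<le> (\<Sum>i<n. 1 / (64 * n))" unfolding ip_def by (intro sum_mono)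
    then show ?thesis using n by simp
  qed
  have de: "ip n ?d ?d + ip n ?e ?e = 2 + 2 * ip n z z"
    unfolding symmetric_form_square[OF symmetric_form_ip] x1 by simp
  have z: "ip n z z \<le> 2 + 1 / 32"
  proof -
    have "ip n z z = ip n (\<lambda>i. 1 * x0 i + (- 1) * ?d i) (\<lambda>i. 1 * x0 i + (- 1) * ?d i)" by simp
    also have "\<dots> = 1 - 2 * ip n x0 ?d + ip n ?d ?d"
      unfolding symmetric_form_square[OF symmetric_form_ip, of n 1 x0 "-1" ?d] x1 by simp
    also have "\<dots> \<le> 2 * 1 + 2 * ip n ?d ?d"
    proof -
      have "0 \<le> ip n (\<lambda>i. 1 * x0 i + 1 * ?d i) (\<lambda>i. 1 * x0 i + 1 * ?d i)" by (rule ip_nonneg)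
      then show ?thesis unfolding symmetric_form_square[OF symmetric_form_ip, of n 1 x0 "1" ?d] x1 by simp
    qed
    finally show ?thesis using d by simp
  qed
  \<comment> \<open>\<open>16 * n * (2 + 1 / 32)\<close> is \<open>32.5 * n\<close>, the origin of
    the bound \<open>33 * n\<close> in the net.\<close>
  have "(\<Sum>i<n. (real_of_int (m i))\<^sup>2) = 16 * n * ip n z z"
    using sn n by (simp add: ip_def z_def power2_eq_square sum_distrib_left field_simps)
  also have "\<dots> \<le> 16 * n * (2 + 1 / 32)" using z by (intro mult_left_mono) auto
  finally have "real_of_int (\<Sum>i<n. (m i)\<^sup>2) \<le> real_of_int (33 * int n)" by simp
  then have "(\<Sum>i<n. (m i)\<^sup>2) \<le> 33 * int n" by (simp only: of_int_le_iff)
  from net[OF this] have T: "\<bar>f z z\<bar> \<le> T" unfolding z_eq .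
  have fd: "f x0 x0 = f z z + f ?d ?e"
  proof -
    have "f ?d ?e = 1 * f x0 ?e + (- 1) * f z ?e" by (rule symmetric_form_left[OF f])
    moreover have "f x0 ?e = 1 * f x0 x0 + 1 * f z x0" "f z ?e = 1 * f x0 z + 1 * f z z"
      by (subst symmetric_form_commute[OF f], rule symmetric_form_left[OF f])+
    ultimately show ?thesis using symmetric_form_commute[OF f, of x0 z] by simp
  qed
  \<comment> \<open>Squared lengths are at most \<open>1 / 64\<close> and \<open>6.0625\<close>, so
    with weight 8 the bracket stays below 1.\<close>
  have "2 * \<bar>f ?d ?e\<bar> \<le> A * (8 * ip n ?d ?d + ip n ?e ?e / 8)"
    by (rule polarization_bound[OF f A]) simp
  also have "\<dots> \<le> A * 1"
    using d de z ip_nonneg[of n ?d] by (intro mult_left_mono) (auto simp: A_def)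
  finally have "2 * \<bar>f ?d ?e\<bar> \<le> A" by simp
  then have "A \<le> 2 * T" using fd T by (simp add: A_def)
  then have "A * ip n x x \<le> 2 * T * ip n x x" by (intro mult_right_mono ip_nonneg)
  then show ?thesis using A[of x] by linarith
qed

section \<open>Deterministic analysis of the leading direction\<close>

definition data :: "(nat \<Rightarrow> real) \<Rightarrow> (nat \<Rightarrow> real) \<Rightarrow> (nat \<times> nat \<Rightarrow> real) \<Rightarrow> nat \<times> nat \<Rightarrow> real" where
  "data s b \<omega> = (\<lambda>(i, j). s i * b j + \<omega> (i, j))"

text \<open>For \<open>Y = s b\<^sup>T + \<omega>\<close>, the terms that mix signal and noise see
  the noise only through \<open>g = \<omega> b\<close>.\<close>

lemma bform_data:
  assumes B: "B\<^sup>2 = (\<Sum>j<p. (b j)\<^sup>2)"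
  defines "g \<equiv> \<lambda>\<omega> i. \<Sum>j<p. b j * \<omega> (i, j)"
  shows "bform n p (data s b \<omega>) x y
    = ip n x s * ip n y s * B\<^sup>2 + ip n x s * ip n y (g \<omega>) + ip n y s * ip n x (g \<omega>) + bform n p \<omega> x y"
proof -
  let ?l = "\<lambda>x j. \<Sum>i<n. x i * \<omega> (i, j)"
  have l: "(\<Sum>i<n. x i * data s b \<omega> (i, j)) = ip n x s * b j + ?l x j" for x j
    by (simp add: data_def ip_def sum_distrib_right sum.distrib distrib_left mult.assoc)
  have g: "ip n x (g \<omega>) = (\<Sum>j<p. b j * ?l x j)" for x
  proof -
    have "ip n x (g \<omega>) = (\<Sum>i<n. \<Sum>j<p. b j * (x i * \<omega> (i, j)))"
      by (simp add: ip_def g_def sum_distrib_left algebra_simps)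
    also have "\<dots> = (\<Sum>j<p. \<Sum>i<n. b j * (x i * \<omega> (i, j)))" by (rule sum.swap)
    finally show ?thesis by (simp add: sum_distrib_left)
  qed
  have "(\<Sum>j<p. (u * b j + U j) * (v * b j + V j))
      = u * v * B\<^sup>2 + u * (\<Sum>j<p. b j * V j) + v * (\<Sum>j<p. b j * U j) + (\<Sum>j<p. U j * V j)"
    for u v :: real and U V :: "nat \<Rightarrow> real"
  proof -
    have "(u * b j + U j) * (v * b j + V j) = u * v * (b j)\<^sup>2 + u * (b j * V j) + v * (b j * U j) + U j * V j" for j
      by (simp add: power2_eq_square algebra_simps)
    then show ?thesis unfolding B by (simp add: sum.distrib sum_distrib_left)
  qed
  then show ?thesis unfolding bform_def l g .
qed

text \<open>\<open>A\<close> bounds the operator norm of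
  \<open>\<omega> \<omega>\<^sup>T - p I\<close>, and \<open>H\<close> each entry of
  \<open>\<omega> b\<close>. The deterministic analysis uses nothing else about the noise.\<close>

definition good :: "nat \<Rightarrow> nat \<Rightarrow> (nat \<Rightarrow> real) \<Rightarrow> real \<Rightarrow> real \<Rightarrow> (nat \<times> nat \<Rightarrow> real) \<Rightarrow> bool" where
  "good n p b A H \<omega> \<longleftrightarrow>
    (\<forall>x. \<bar>bform n p \<omega> x x - real p * ip n x x\<bar> \<le> A * ip n x x) \<and>
    (\<forall>i<n. \<bar>\<Sum>j<p. b j * \<omega> (i, j)\<bar> \<le> H)"

locale sign_vector =
  fixes n :: nat and s :: "nat \<Rightarrow> real"
  assumes n: "0 < n" and s: "\<And>i. i < n \<Longrightarrow> s i * s i = 1"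

text \<open>\<open>n * B\<^sup>2 - 2 * n * H - 2 * A\<close> bounds from below the gap between
  \<open>f x0 x0\<close> and the values of \<open>f\<close> on unit vectors orthogonal to
  \<open>x0\<close>; \<open>n * H + A\<close> bounds the coupling between the two. Their ratio is at
  least \<open>R\<close>, which becomes a lower bound for the cotangent of the angle.\<close>

locale spiked = sign_vector n s for n s +
  fixes p :: nat and b :: "nat \<Rightarrow> real" and B A H R :: real and \<omega> :: "nat \<times> nat \<Rightarrow> real"
  assumes B: "B\<^sup>2 = (\<Sum>j<p. (b j)\<^sup>2)" and R: "0 < R"
    and good: "good n p b A H \<omega>"
    and gap: "R * (n * H + A) \<le> n * B\<^sup>2 - 2 * n * H - 2 * A"
      "0 < n * B\<^sup>2 - 2 * n * H - 2 * A"
begin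

abbreviation "f \<equiv> bform n p (data s b \<omega>)"
definition "x0 i = s i / sqrt n"
definition "g i = (\<Sum>j<p. b j * \<omega> (i, j))"
abbreviation "cf \<equiv> \<lambda>x y. 1 * bform n p \<omega> x y - real p * ip n x y"

lemma f: "symmetric_form n f" by (rule symmetric_form_bform)

lemma cf: "symmetric_form n cf" by (rule symmetric_form_diff[OF symmetric_form_bform symmetric_form_ip])

lemma cf_bound: "\<bar>cf x x\<bar> \<le> A * ip n x x"
  using good by (simp add: good_def)

lemma g_bound: "i < n \<Longrightarrow> \<bar>g i\<bar> \<le> H"
  using good by (simp add: good_def g_def)

lemma H_nonneg: "0 \<le> H" using g_bound[OF n] by linarith

lemma ip_s: "ip n x s = sqrt n * ip n x x0"
  unfolding ip_def x0_def sum_distrib_left using n by (intro sum.cong) auto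

lemma ip_x0: "ip n x0 x0 = 1"
proof -
  have "ip n x0 x0 = (\<Sum>i<n. 1 / n)"
    unfolding ip_def x0_def using s by (intro sum.cong) auto
  then show ?thesis using n by simp
qed

lemma ip_g: "ip n g g \<le> n * H\<^sup>2"
proof -
  have "ip n g g \<le> (\<Sum>i<n. H\<^sup>2)"
    unfolding ip_def
  proof (rule sum_mono)
    fix i assume "i \<in> {..<n}"
    then have "\<bar>g i\<bar>\<^sup>2 \<le> H\<^sup>2" using g_bound[of i] by (intro power_mono) auto
    then show "g i * g i \<le> H\<^sup>2" by (simp add: power2_eq_square)
  qed
  then show ?thesis by simp
qed

lemma ip_xg: "sqrt n * \<bar>ip n x g\<bar> \<le> n * H * sqrt (ip n x x)"
proof -
  have "\<bar>ip n x g\<bar> \<le> sqrt (ip n x x) * sqrt (ip n g g)" by (rule ip_Cauchy_Schwarz)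
  also have "\<dots> \<le> sqrt (ip n x x) * sqrt (n * H\<^sup>2)" using ip_g by (intro mult_left_mono) (auto simp: ip_nonneg)
  also have "\<dots> = sqrt (ip n x x) * (sqrt n * H)" using H_nonneg by (simp add: real_sqrt_mult)
  finally have "sqrt n * \<bar>ip n x g\<bar> \<le> sqrt n * (sqrt (ip n x x) * (sqrt n * H))" by (intro mult_left_mono) auto
  also have "\<dots> = n * H * sqrt (ip n x x)" by simp
  finally show ?thesis .
qed

lemma f_eq: "f x y = ip n x s * ip n y s * B\<^sup>2 + ip n x s * ip n y g + ip n y s * ip n x g + bform n p \<omega> x y"
proof -
  have "g = (\<lambda>i. \<Sum>j<p. b j * \<omega> (i, j))" by (rule ext) (simp add: g_def)
  then show ?thesis by (simp add: bform_data[OF B])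
qed

lemma f_x0: "n * B\<^sup>2 - 2 * n * H + p - A \<le> f x0 x0"
proof -
  have s0: "ip n x0 s = sqrt n" by (simp add: ip_s ip_x0)
  have "f x0 x0 = n * B\<^sup>2 + 2 * (sqrt n * ip n x0 g) + (p + cf x0 x0)"
    unfolding f_eq s0 ip_x0 by simp
  moreover have "sqrt n * \<bar>ip n x0 g\<bar> \<le> n * H" using ip_xg[of x0] by (simp add: ip_x0)
  then have "- (n * H) \<le> sqrt n * ip n x0 g"
    by (smt (verit) mult_minus_right mult_left_mono real_sqrt_ge_zero of_nat_0_le_iff)
  moreover have "- A \<le> cf x0 x0" using cf_bound[of x0] by (simp add: ip_x0)
  ultimately show ?thesis by linarith
qed

text \<open>The signal and the cross terms carry the factor \<open>ip n w s = 0\<close>, so only the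
  noise form remains.\<close>

lemma f_perp:
  assumes "ip n w x0 = 0"
  shows "f w w \<le> (p + A) * ip n w w"
proof -
  have "f w w = p * ip n w w + cf w w" unfolding f_eq ip_s assms by simp
  then show ?thesis using cf_bound[of w] by (simp add: algebra_simps abs_le_iff)
qed

lemma f_cross:
  assumes "ip n w x0 = 0"
  shows "\<bar>f w x0\<bar> \<le> (n * H + A) * sqrt (ip n w w)"
proof -
  have "f w x0 = sqrt n * ip n w g + cf w x0" unfolding f_eq ip_s assms ip_x0 by simp
  moreover have "\<bar>cf w x0\<bar> \<le> A * sqrt (ip n w w) * sqrt (ip n x0 x0)"
    by (rule polarization_bound_sqrt[OF cf cf_bound])
  then have "\<bar>cf w x0\<bar> \<le> A * sqrt (ip n w w)" by (simp add: ip_x0)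
  moreover have "\<bar>sqrt n * ip n w g\<bar> \<le> n * H * sqrt (ip n w w)"
    using ip_xg[of w] by (simp add: abs_mult)
  ultimately show ?thesis by (simp add: algebra_simps)
qed

definition "maximiser y \<longleftrightarrow> ip n y y = 1 \<and> (\<forall>x. f x x \<le> f y y * ip n x x)"

text \<open>Decompose \<open>y = w + c * x0\<close> and test the eigenvector equation of
  \<open>y\<close> against \<open>w\<close>, of length \<open>r\<close>. The gap multiplies
  \<open>r\<^sup>2\<close>, the coupling only \<open>\<bar>c\<bar> * r\<close>, so
  \<open>R * r \<le> \<bar>c\<bar>\<close>: a perturbation bound of Davis-Kahan type.\<close>

lemma maximiser_angle:
  assumes y: "maximiser y"
  defines "c \<equiv> ip n y x0"
  shows "R\<^sup>2 * (1 - c\<^sup>2) \<le> c\<^sup>2" and "c \<noteq> 0"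
proof -
  define w where "w = (\<lambda>i. 1 * y i + (- c) * x0 i)"
  define M where "M = n * B\<^sup>2 - 2 * n * H - 2 * A"
  have M: "0 < M" "R * (n * H + A) \<le> M" using gap by (auto simp: M_def)
  have y1: "ip n y y = 1" and max: "\<And>x. f x x \<le> f y y * ip n x x" using y by (auto simp: maximiser_def)
  have w0: "ip n w x0 = 0"
    unfolding w_def symmetric_form_left[OF symmetric_form_ip] by (simp add: ip_x0 c_def)
  have ww: "ip n w w = 1 - c\<^sup>2"
    unfolding w_def symmetric_form_square[OF symmetric_form_ip] by (simp add: y1 ip_x0 flip: c_def) (simp add: power2_eq_square)
  define r where "r = sqrt (ip n w w)"
  have r: "r \<ge> 0" "ip n w w = r\<^sup>2" by (auto simp: r_def ip_nonneg)
  have yw: "y = (\<lambda>i. 1 * w i + c * x0 i)" by (auto simp: w_def)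
  have wy: "ip n w y = r\<^sup>2"
    by (subst yw, subst symmetric_form_commute[OF symmetric_form_ip], subst symmetric_form_left[OF symmetric_form_ip])
       (simp add: r(2) symmetric_form_commute[OF symmetric_form_ip, of n x0 w] w0)
  have "f w y = f y y * r\<^sup>2"
    using stationary[OF f max, of y w] y1 by (simp add: wy)
  moreover have "f w y = 1 * f w w + c * f x0 w"
    by (subst yw, subst symmetric_form_commute[OF f]) (rule symmetric_form_left[OF f])
  ultimately have "f y y * r\<^sup>2 = f w w + c * f w x0" using symmetric_form_commute[OF f, of x0 w] by simp
  moreover have "f x0 x0 * r\<^sup>2 \<le> f y y * r\<^sup>2" using max[of x0] by (intro mult_right_mono) (auto simp: ip_x0)
  moreover have "(M + (p + A)) * r\<^sup>2 \<le> f x0 x0 * r\<^sup>2" using f_x0 by (intro mult_right_mono) (auto simp: M_def)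
  moreover have "f w w \<le> (p + A) * r\<^sup>2" using f_perp[OF w0] by (simp add: r(2))
  moreover have "c * f w x0 \<le> \<bar>c\<bar> * ((n * H + A) * r)"
  proof -
    have "c * f w x0 \<le> \<bar>c\<bar> * \<bar>f w x0\<bar>" by (metis abs_ge_self abs_mult)
    also have "\<dots> \<le> \<bar>c\<bar> * ((n * H + A) * r)" using f_cross[OF w0] by (intro mult_left_mono) (auto simp: r_def)
    finally show ?thesis .
  qed
  ultimately have "M * r\<^sup>2 \<le> \<bar>c\<bar> * ((n * H + A) * r)" by (simp add: algebra_simps)
  then have "R * (M * r\<^sup>2) \<le> R * (\<bar>c\<bar> * ((n * H + A) * r))" using R by (intro mult_left_mono) auto
  also have "\<dots> = (R * (n * H + A)) * (\<bar>c\<bar> * r)" by simp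
  also have "\<dots> \<le> M * (\<bar>c\<bar> * r)" using M r by (intro mult_right_mono) auto
  finally have "M * (r * (R * r)) \<le> M * (r * \<bar>c\<bar>)" by (simp add: power2_eq_square mult_ac)
  then have "r * (R * r) \<le> r * \<bar>c\<bar>" using M by simp
  then have "R * r \<le> \<bar>c\<bar>" using r by (cases "r = 0") auto
  then have "(R * r)\<^sup>2 \<le> \<bar>c\<bar>\<^sup>2" using R r by (intro power_mono) auto
  then show 1: "R\<^sup>2 * (1 - c\<^sup>2) \<le> c\<^sup>2" by (simp add: power_mult_distrib ww[symmetric] r(2))
  show "c \<noteq> 0"
  proof
    assume "c = 0"
    with 1 R show False by simp
  qed
qed

text \<open>The combination \<open>d * y - c * z\<close> is orthogonal to \<open>x0\<close> and yet
  attains the top value \<open>\<mu>\<close>. By the gap only the zero vector can do so.\<close>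

lemma maximiser_unique:
  assumes y: "maximiser y" and z: "maximiser z" and i: "i < n"
  shows "ip n z x0 * y i = ip n y x0 * z i"
proof -
  define c d where "c = ip n y x0" and "d = ip n z x0"
  define v where "v = (\<lambda>i. d * y i + (- c) * z i)"
  define \<mu> where "\<mu> = f y y"
  have max: "f x x \<le> \<mu> * ip n x x" for x using y by (simp add: maximiser_def \<mu>_def)
  have mu: "f z z = \<mu>" using y z unfolding maximiser_def \<mu>_def
    by (metis mult.right_neutral order_antisym)
  have st: "f x y = \<mu> * ip n x y" "f x z = \<mu> * ip n x z" for x
    using stationary[OF f max, of y x] stationary[OF f max, of z x] y z mu by (auto simp: maximiser_def \<mu>_def)
  have v0: "ip n v x0 = 0"
    unfolding v_def symmetric_form_left[OF symmetric_form_ip] by (simp add: c_def d_def)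
  have "f v v = \<mu> * ip n v v"
  proof -
    have "f v v = d * f y v + (- c) * f z v"
      by (subst (1) v_def) (rule symmetric_form_left[OF f])
    also have "\<dots> = d * (\<mu> * ip n v y) + (- c) * (\<mu> * ip n v z)"
      using st[of v] symmetric_form_commute[OF f, of v] by simp
    also have "\<dots> = \<mu> * (d * ip n y v + (- c) * ip n z v)"
      using symmetric_form_commute[OF symmetric_form_ip, of n v] by (simp add: algebra_simps)
    also have "d * ip n y v + (- c) * ip n z v = ip n v v"
      by (subst (3) v_def) (rule symmetric_form_left[OF symmetric_form_ip, symmetric])
    finally show ?thesis .
  qed
  moreover have "f v v \<le> (p + A) * ip n v v" by (rule f_perp[OF v0])
  moreover have "\<mu> > p + A" using max[of x0] f_x0 gap by (simp add: ip_x0)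
  ultimately have "ip n v v = 0"
    using ip_nonneg[of n v] by (metis mult_le_cancel_right not_less order_le_less)
  from ip_zeroD[OF this i] show ?thesis by (simp add: v_def c_def d_def)
qed

end

section \<open>The good event\<close>

lemma sum_half_powers: "(\<Sum>k=- int K..int K. (1 / 2 :: real) ^ nat \<bar>k\<bar>) = 3 - 2 * (1 / 2) ^ K"
proof (induction K)
  case (Suc K)
  have "{- int (Suc K)..int (Suc K)} = insert (- int (Suc K)) (insert (int (Suc K)) {- int K..int K})"
    by auto
  moreover have "nat (1 + int K) = Suc K" by linarith
  ultimately show ?case using Suc by (simp add: add.commute[of "int K" 1])
qed simp

text \<open>The box makes the set finite at sight; as \<open>\<bar>k\<bar> \<le> k\<^sup>2\<close>
  for integers, it holds every integer vector within the radius. Extensionality identifies vectors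
  that agree below \<open>n\<close>.\<close>

definition lattice_net :: "nat \<Rightarrow> (nat \<Rightarrow> int) set" where
  "lattice_net n = {m \<in> {..<n} \<rightarrow>\<^sub>E {- int (33 * n)..int (33 * n)}. (\<Sum>i<n. (m i)\<^sup>2) \<le> 33 * int n}"

lemma finite_lattice_net: "finite (lattice_net n)"
  by (rule finite_subset[of _ "{..<n} \<rightarrow>\<^sub>E {- int (33 * n)..int (33 * n)}"]) (auto simp: lattice_net_def intro!: finite_PiE)

lemma abs_le_square_int: "\<bar>k :: int\<bar> \<le> k\<^sup>2"
proof (cases "k = 0")
  case False
  then have "\<bar>k\<bar> * 1 \<le> \<bar>k\<bar> * \<bar>k\<bar>" by (intro mult_left_mono) auto
  then show ?thesis by (simp add: power2_eq_square flip: abs_mult)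
qed simp

text \<open>Weighting the lattice point \<open>m\<close> by \<open>2\<^bsup>33n - \<Sum>\<bar>m i\<bar>\<^esup> \<ge> 1\<close> makes the count factorise.\<close>

lemma card_lattice_net: "real (card (lattice_net n)) \<le> 2 ^ (35 * n)"
proof -
  let ?P = "{..<n} \<rightarrow>\<^sub>E {- int (33 * n)..int (33 * n)}"
  have "real (card (lattice_net n)) = (\<Sum>m\<in>lattice_net n. 1)" by simp
  also have "\<dots> \<le> (\<Sum>m\<in>lattice_net n. 2 ^ (33 * n) * (\<Prod>i<n. (1 / 2) ^ nat \<bar>m i\<bar>))"
  proof (rule sum_mono)
    fix m assume m: "m \<in> lattice_net n"
    have "int (\<Sum>i<n. nat \<bar>m i\<bar>) = (\<Sum>i<n. \<bar>m i\<bar>)" by simp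
    also have "\<dots> \<le> (\<Sum>i<n. (m i)\<^sup>2)" by (intro sum_mono abs_le_square_int)
    also have "\<dots> \<le> int (33 * n)" using m by (simp add: lattice_net_def)
    finally have le: "(\<Sum>i<n. nat \<bar>m i\<bar>) \<le> 33 * n" by linarith
    have "(1 / 2 :: real) ^ (33 * n) \<le> (1 / 2) ^ (\<Sum>i<n. nat \<bar>m i\<bar>)" by (rule power_decreasing[OF le]) auto
    also have "\<dots> = (\<Prod>i<n. (1 / 2) ^ nat \<bar>m i\<bar>)" by (simp add: power_sum)
    finally have "2 ^ (33 * n) * (1 / 2 :: real) ^ (33 * n) \<le> 2 ^ (33 * n) * (\<Prod>i<n. (1 / 2) ^ nat \<bar>m i\<bar>)"
      by (intro mult_left_mono) auto
    then show "1 \<le> 2 ^ (33 * n) * (\<Prod>i<n. (1 / 2 :: real) ^ nat \<bar>m i\<bar>)" by (simp add: power_one_over)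
  qed
  also have "\<dots> \<le> (\<Sum>m\<in>?P. 2 ^ (33 * n) * (\<Prod>i<n. (1 / 2) ^ nat \<bar>m i\<bar>))"
  proof (rule sum_mono2)
    show "finite ?P" by (rule finite_PiE) auto
    show "lattice_net n \<subseteq> ?P" unfolding lattice_net_def by blast
  qed (intro mult_nonneg_nonneg prod_nonneg; simp)
  also have "\<dots> = 2 ^ (33 * n) * (\<Prod>i<n. \<Sum>k=- int (33 * n)..int (33 * n). (1 / 2) ^ nat \<bar>k\<bar>)"
    by (simp only: sum_distrib_left[symmetric]) (subst prod_sum_PiE; simp)
  \<comment> \<open>Each factor is below 3; rounding it up to \<open>4 = 2\<^sup>2\<close> gives the
    exponent \<open>33 + 2 = 35\<close>.\<close>
  also have "\<dots> \<le> 2 ^ (33 * n) * (\<Prod>i<n. 4)"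
  proof (intro mult_left_mono prod_mono)
    have "0 \<le> (1 / 2 :: real) ^ (33 * n)" "(1 / 2 :: real) ^ (33 * n) \<le> 1" by (simp_all add: power_le_one)
    then show "0 \<le> (\<Sum>k=- int (33 * n)..int (33 * n). (1 / 2 :: real) ^ nat \<bar>k\<bar>) \<and>
        (\<Sum>k=- int (33 * n)..int (33 * n). (1 / 2 :: real) ^ nat \<bar>k\<bar>) \<le> 4"
      unfolding sum_half_powers by linarith
  qed simp
  also have "\<dots> = 2 ^ (35 * n)"
  proof -
    have "(4 :: real) ^ n = 2 ^ (2 * n)" by (simp add: power_mult)
    then show ?thesis by (simp add: power_add[symmetric])
  qed
  finally show ?thesis .
qed

lemma exp_neg_le_half_power: "exp (- real k) \<le> (1 / 2) ^ k"
proof -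
  have "exp (- real k) = exp (- 1) ^ k" by (simp add: exp_of_nat_mult[symmetric])
  also have "\<dots> \<le> (1 / 2) ^ k"
    using exp_ge_add_one_self[of "1 :: real"] by (intro power_mono) (auto simp: exp_minus field_simps)
  finally show ?thesis .
qed

text \<open>Union bound over at most \<open>2 ^ (35 * n)\<close> net points, each failing with
  probability at most \<open>2 * exp (- 64 * n)\<close>, and \<open>n\<close> rows with
  \<open>2 / n ^ 6\<close> each. The constant is \<open>132 = 2 * (33 / 16) * 32\<close>: 2 from the
  net, \<open>33 / 16\<close> from the longest net vector, 32 from the deviation
  \<open>t\<close>.\<close>

lemma good_event:
  assumes n: "2 \<le> n" and p: "256 * n \<le> p" and B: "B\<^sup>2 = (\<Sum>j<p. (b j)\<^sup>2)" "0 < B"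
    and R: "R\<^sup>2 = 12 * ln n" "0 < R"
  shows "\<exists>E\<in>sets (gauss (grid n p)). emeasure (gauss (grid n p)) (space (gauss (grid n p)) - E) \<le> ennreal (1 / (4 * real n)) \<and>
    (\<forall>\<omega>\<in>E. good n p b (132 * sqrt (real n * p)) (R * B) \<omega>)"
proof -
  let ?G = "gauss (grid n p)"
  have n0: "0 < n" and p0: "0 < p" using n p by auto
  \<comment> \<open>The factor 32 makes \<open>t\<^sup>2 / (16 * p) = 64 * n\<close>, enough to beat
    the size of the net; \<open>256 * n \<le> p\<close> is what gives
    \<open>t \<le> 2 * p\<close>.\<close>
  define t where "t = 32 * sqrt (real n * p)"
  define T where "T = 33 / 16 * t"
  have t: "0 < t" "t \<le> 2 * real p" "t\<^sup>2 = 1024 * (real n * p)"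
  proof -
    show "0 < t" using n0 p0 by (simp add: t_def)
    have "256 * real n \<le> p" using p by (metis of_nat_le_iff of_nat_mult of_nat_numeral)
    then have "256 * real n * p \<le> real p * p" by (intro mult_right_mono) auto
    then have "sqrt (256 * (real n * p)) \<le> sqrt ((real p)\<^sup>2)" by (intro real_sqrt_le_mono) (simp add: power2_eq_square)
    moreover have "sqrt (256 * (real n * p)) = 16 * sqrt (real n * p)"
      using real_sqrt_mult[of 256 "real n * p"] real_sqrt_unique[of 16 256] by simp
    ultimately show "t \<le> 2 * real p" by (simp add: t_def)
    show "t\<^sup>2 = 1024 * (real n * p)" by (simp add: t_def power_mult_distrib)
  qed
  define z where "z m = (\<lambda>i. real_of_int (m i) / (4 * sqrt n))" for m :: "nat \<Rightarrow> int"
  define cf where "cf \<omega> x = bform n p \<omega> x x - real p * ip n x x" for \<omega> x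
  have [measurable]: "(\<lambda>\<omega>. cf \<omega> x) \<in> borel_measurable ?G" for x unfolding cf_def by measurable
  have [measurable]: "(\<lambda>\<omega>. \<Sum>j<p. b j * \<omega> (i, j)) \<in> borel_measurable ?G" if "i < n" for i
    using that by (intro borel_measurable_sum borel_measurable_times borel_measurable_const measurable_entry) auto
  define B1 where "B1 m = {\<omega>\<in>space ?G. \<not> \<bar>cf \<omega> (z m)\<bar> \<le> T}" for m
  define B2 where "B2 i = {\<omega>\<in>space ?G. \<bar>\<Sum>j<p. b j * \<omega> (i, j)\<bar> \<ge> R * B}" for i
  have B1m[measurable]: "B1 m \<in> sets ?G" for m unfolding B1_def by measurable
  have B2m[measurable]: "B2 i \<in> sets ?G" if "i < n" for i unfolding B2_def using that by measurable
  have B1_le: "emeasure ?G (B1 m) \<le> ennreal (2 * exp (- (64 * real n)))" if m: "m \<in> lattice_net n" for m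
  \<comment> \<open>The zero lattice point cannot be normalised, but both forms vanish
    there.\<close>
  proof (cases "ip n (z m) (z m) = 0")
    case True
    then have "cf \<omega> (z m) = 0" for \<omega>
      using symmetric_form_zero[OF symmetric_form_bform True] by (simp add: cf_def)
    then have "B1 m = {}" using t by (auto simp: B1_def T_def)
    then show ?thesis by simp
  next
    case False
    define r where "r = ip n (z m) (z m)"
    have r: "0 < r" using False ip_nonneg[of n "z m"] by (simp add: r_def)
    have "r = (\<Sum>i<n. (real_of_int (m i))\<^sup>2) / (16 * n)"
      unfolding r_def ip_def z_def sum_divide_distrib by (intro sum.cong) (auto simp: power2_eq_square)
    also have "\<dots> = real_of_int (\<Sum>i<n. (m i)\<^sup>2) / (16 * n)" by simp
    also have "\<dots> \<le> real_of_int (33 * int n) / (16 * n)"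
      using m unfolding lattice_net_def by (intro divide_right_mono) (auto simp del: of_int_sum of_int_mult)
    also have "\<dots> = 33 / 16" using n0 by simp
    finally have r33: "r \<le> 33 / 16" .
    \<comment> \<open>The zero summand brings the scaled vector into the shape of
      \<open>symmetric_form_square\<close>.\<close>
    define x where "x = (\<lambda>i. (1 / sqrt r) * z m i + 0 * z m i)"
    have xx: "ip n x x = 1" unfolding x_def symmetric_form_square[OF symmetric_form_ip]
      using r by (simp add: r_def[symmetric] power_divide)
    have bx: "bform n p \<omega> x x = bform n p \<omega> (z m) (z m) / r" for \<omega>
      unfolding x_def symmetric_form_square[OF symmetric_form_bform] using r by (simp add: power_divide)
    have "B1 m \<subseteq> {\<omega>\<in>space ?G. \<bar>bform n p \<omega> x x - p\<bar> \<ge> t}"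
    proof
      fix \<omega> assume w: "\<omega> \<in> B1 m"
      have "cf \<omega> (z m) = r * (bform n p \<omega> x x - p)" using r by (simp add: cf_def bx r_def[symmetric] algebra_simps)
      then have "T < r * \<bar>bform n p \<omega> x x - p\<bar>" using w r by (simp add: B1_def abs_mult)
      moreover have "r * t \<le> T" unfolding T_def using r33 t by (intro mult_right_mono) auto
      ultimately have "r * t < r * \<bar>bform n p \<omega> x x - p\<bar>" by linarith
      then show "\<omega> \<in> {\<omega>\<in>space ?G. \<bar>bform n p \<omega> x x - p\<bar> \<ge> t}" using r w by (simp add: B1_def)
    qed
    then have "emeasure ?G (B1 m) \<le> emeasure ?G {\<omega>\<in>space ?G. \<bar>bform n p \<omega> x x - p\<bar> \<ge> t}"
      by (intro emeasure_mono) measurable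
    also have "\<dots> \<le> ennreal (2 * exp (- t\<^sup>2 / (16 * p)))"
      using xx by (intro bform_tail n0 p0 t) (simp add: ip_def power2_eq_square)
    also have "- t\<^sup>2 / (16 * p) = - (64 * real n)" using p0 by (simp add: t)
    finally show ?thesis .
  qed
  have B2_le: "emeasure ?G (B2 i) \<le> ennreal (2 / n ^ 6)" if "i < n" for i
  proof -
    have "emeasure ?G (B2 i) \<le> ennreal (2 * exp (- R\<^sup>2 / 2))"
      unfolding B2_def by (rule linear_tail[OF that B R(2)])
    also have "exp (- R\<^sup>2 / 2) = exp (- (real 6 * ln n))" by (simp add: R)
    also have "\<dots> = 1 / n ^ 6"
      unfolding exp_minus exp_of_nat_mult using n0 by (simp add: divide_inverse)
    finally show ?thesis by simp
  qed
  define Bad where "Bad = (\<Union>m\<in>lattice_net n. B1 m) \<union> (\<Union>i<n. B2 i)"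
  have Bad_m[measurable]: "Bad \<in> sets ?G"
    unfolding Bad_def using finite_lattice_net by (intro sets.Un sets.finite_UN) auto
  have "emeasure ?G Bad \<le> emeasure ?G (\<Union>m\<in>lattice_net n. B1 m) + emeasure ?G (\<Union>i<n. B2 i)"
    unfolding Bad_def using finite_lattice_net by (intro emeasure_subadditive sets.finite_UN) auto
  also have "\<dots> \<le> (\<Sum>m\<in>lattice_net n. emeasure ?G (B1 m)) + (\<Sum>i<n. emeasure ?G (B2 i))"
    using finite_lattice_net by (intro add_mono emeasure_subadditive_finite) auto
  also have "\<dots> \<le> (\<Sum>m\<in>lattice_net n. ennreal (2 * exp (- (64 * real n)))) + (\<Sum>i<n. ennreal (2 / n ^ 6))"
    by (intro add_mono sum_mono B1_le B2_le) auto
  also have "\<dots> = ennreal (card (lattice_net n) * (2 * exp (- (64 * real n))) + n * (2 / n ^ 6))"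
  proof -
    have "(\<Sum>m\<in>lattice_net n. ennreal (2 * exp (- (64 * real n)))) = ennreal (card (lattice_net n) * (2 * exp (- (64 * real n))))"
      using sum_ennreal[of "lattice_net n" "\<lambda>_. 2 * exp (- (64 * real n))"] by simp
    moreover have "(\<Sum>i<n. ennreal (2 / n ^ 6)) = ennreal (n * (2 / n ^ 6))"
      using sum_ennreal[of "{..<n}" "\<lambda>_. 2 / real n ^ 6"] by simp
    ultimately show ?thesis by (simp only:) (simp flip: ennreal_plus)
  qed
  also have "\<dots> \<le> ennreal (1 / (4 * real n))"
  proof (rule ennreal_leI)
    have "card (lattice_net n) * (2 * exp (- (64 * real n))) \<le> 2 ^ (35 * n) * (2 * (1 / 2) ^ (64 * n))"
      using exp_neg_le_half_power[of "64 * n"] by (intro mult_mono card_lattice_net) auto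
    also have "\<dots> = 2 * (1 / 2) ^ (29 * n)"
    proof -
      have "(1 / 2 :: real) ^ (64 * n) = (1 / 2) ^ (35 * n) * (1 / 2) ^ (29 * n)"
        unfolding power_add[symmetric] by (rule arg_cong[where f = "power _"]) simp
      then show ?thesis unfolding power_one_over by simp
    qed
    also have "\<dots> \<le> 2 * (1 / 2) ^ (n + 4)" using n by (intro mult_left_mono power_decreasing) auto
    also have "\<dots> \<le> 1 / (8 * real n)"
    proof -
      have "real n \<le> 2 ^ n" by (rule less_imp_le[OF of_nat_less_two_power])
      then show ?thesis using n0 by (simp add: power_add power_one_over field_simps)
    qed
    finally have 1: "card (lattice_net n) * (2 * exp (- (64 * real n))) \<le> 1 / (8 * real n)" .
    have "(2 :: real) ^ 4 \<le> real n ^ 4" using n by (intro power_mono) auto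
    then have "n * (2 / n ^ 6) \<le> 1 / (8 * real n)"
    proof -
      have "real n * (2 / real n ^ 6) = 2 / (real n * real n ^ 4)"
        using n0 by (simp add: power_numeral_reduce)
      also have "\<dots> \<le> 2 / (real n * 2 ^ 4)"
        using \<open>2 ^ 4 \<le> real n ^ 4\<close> n0 by (intro divide_left_mono mult_left_mono) auto
      finally show ?thesis by simp
    qed
    with 1 have "card (lattice_net n) * (2 * exp (- (64 * real n))) + n * (2 / n ^ 6) \<le> 1 / (8 * real n) + 1 / (8 * real n)" by linarith
    then show "card (lattice_net n) * (2 * exp (- (64 * real n))) + n * (2 / n ^ 6) \<le> 1 / (4 * real n)" by simp
  qed
  finally have Bad_le: "emeasure ?G Bad \<le> ennreal (1 / (4 * real n))" .
  have Bad_sub: "Bad \<subseteq> space ?G" by (auto simp: Bad_def B1_def B2_def)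
  show ?thesis
  proof (intro bexI[of _ "space ?G - Bad"] conjI ballI)
    have "space ?G - (space ?G - Bad) = Bad" using Bad_sub by auto
    then show "emeasure ?G (space ?G - (space ?G - Bad)) \<le> ennreal (1 / (4 * real n))" using Bad_le by simp
    fix \<omega> assume w: "\<omega> \<in> space ?G - Bad"
    show "good n p b (132 * sqrt (real n * p)) (R * B) \<omega>"
      unfolding good_def
    proof (intro conjI allI impI)
      fix i assume "i < n"
      then have "\<omega> \<notin> B2 i" using w by (auto simp: Bad_def)
      then show "\<bar>\<Sum>j<p. b j * \<omega> (i, j)\<bar> \<le> R * B" using w by (auto simp: B2_def)
    next
      fix x
      let ?f = "\<lambda>x y. 1 * bform n p \<omega> x y - real p * ip n x y"
      have f: "symmetric_form n ?f" by (rule symmetric_form_diff[OF symmetric_form_bform symmetric_form_ip])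
      have "\<bar>?f x x\<bar> \<le> 2 * T * ip n x x"
      proof (rule net_bound[OF n0 f])
        show "continuous_on UNIV (\<lambda>x. ?f x x)" by (intro continuous_intros)
        fix m :: "nat \<Rightarrow> int" assume m: "(\<Sum>i<n. (m i)\<^sup>2) \<le> 33 * int n"
        \<comment> \<open>The net consists of extensional functions, while \<open>m\<close> is
          arbitrary from \<open>n\<close> on; the forms do not see the difference.\<close>
        define m' where "m' = restrict m {..<n}"
        have "\<bar>m i\<bar> \<le> 33 * int n" if "i < n" for i
        proof -
          have "\<bar>m i\<bar> \<le> (m i)\<^sup>2" by (rule abs_le_square_int)
          also have "\<dots> \<le> (\<Sum>i<n. (m i)\<^sup>2)" using that by (intro member_le_sum) auto
          finally show ?thesis using m by linarith
        qed
        then have "m' \<in> lattice_net n" using m by (force simp: lattice_net_def m'_def abs_le_iff)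
        then have "\<omega> \<notin> B1 m'" using w by (auto simp: Bad_def)
        then have c: "\<bar>?f (z m') (z m')\<bar> \<le> T" using w by (simp add: B1_def cf_def)
        have "z m' i = z m i" if "i < n" for i using that by (simp add: z_def m'_def)
        then have "?f (z m') (z m') = ?f (z m) (z m)" by (simp add: bform_def ip_def)
        then show "\<bar>?f (\<lambda>i. real_of_int (m i) / (4 * sqrt n)) (\<lambda>i. real_of_int (m i) / (4 * sqrt n))\<bar> \<le> T"
          using c by (simp add: z_def)
      qed
      then show "\<bar>bform n p \<omega> x x - real p * ip n x x\<bar> \<le> 132 * sqrt (real n * p) * ip n x x"
        by (simp add: T_def t_def)
    qed
  qed measurable
qed

section \<open>The Hartley basis and random signs\<close>

text \<open>A geometric sum in the root of unity \<open>z\<close>, which is 1 exactly when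
  \<open>n\<close> divides \<open>m\<close>.\<close>

lemma sum_cis:
  fixes m :: int
  assumes n: "0 < n"
  shows "(\<Sum>i<n. cis (2 * pi * real_of_int m * real i / real n)) = (if int n dvd m then of_nat n else 0)"
proof -
  define z where "z = cis (2 * pi * real_of_int m / real n)"
  have pow: "cis (2 * pi * real_of_int m * real i / real n) = z ^ i" for i
  proof -
    have "z ^ i = cis (real i * (2 * pi * real_of_int m / real n))" unfolding z_def by (rule Complex.DeMoivre)
    also have "real i * (2 * pi * real_of_int m / real n) = 2 * pi * real_of_int m * real i / real n" by simp
    finally show ?thesis by (rule sym)
  qed
  have zn: "z ^ n = 1"
  proof -
    have "z ^ n = cis (2 * pi * real_of_int m)" using pow[of n] n by simp
    also have "\<dots> = 1" by (rule cis_multiple_2pi) simp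
    finally show ?thesis .
  qed
  show ?thesis
  proof (cases "int n dvd m")
    case True
    then obtain k where "m = int n * k" by (elim dvdE)
    then have "z = cis (2 * pi * real_of_int k)" using n by (simp add: z_def field_simps)
    also have "\<dots> = 1" by (rule cis_multiple_2pi) simp
    finally show ?thesis using True by (simp add: pow)
  next
    case False
    have "z \<noteq> 1"
    proof
      assume "z = 1"
      then have "cos (2 * pi * real_of_int m / real n) = 1" by (metis z_def cis.sel(1) one_complex.sel(1))
      then obtain k :: int where "2 * pi * real_of_int m / real n = real_of_int k * 2 * pi"
        using cos_one_2pi_int by blast
      then have "real_of_int m = real_of_int (k * int n)" using n by (simp add: field_simps)
      then have "m = k * int n" by (simp only: of_int_eq_iff)
      then show False using False by simp
    qed
    then show ?thesis using False zn by (simp add: pow geometric_sum)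
  qed
qed

text \<open>The kernel of the discrete Hartley transform, a real relative of the Fourier basis:
  symmetric in \<open>k\<close> and \<open>i\<close>, constant for \<open>k = 0\<close>, and bounded
  by \<open>sqrt 2\<close>.\<close>

definition cas :: "nat \<Rightarrow> nat \<Rightarrow> nat \<Rightarrow> real" where
  "cas n k i = cos (2 * pi * real k * real i / real n) + sin (2 * pi * real k * real i / real n)"

lemma cas_commute: "cas n k i = cas n i k"
  by (simp add: cas_def mult_ac)

text \<open>With phases \<open>a\<close> and \<open>b\<close> the product of the kernels is
  \<open>cos (a - b) + sin (a + b)\<close>. Full sums of powers of a root of unity are real, so the
  sine part vanishes, and the cosine part survives only for \<open>k = l\<close>.\<close>

lemma cas_orthogonal:
  assumes n: "0 < n" and k: "k < n" and l: "l < n"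
  shows "(\<Sum>i<n. cas n k i * cas n l i) = (if k = l then real n else 0)"
proof -
  have "cas n k i * cas n l i = Re (cis (2 * pi * real_of_int (int k - int l) * real i / real n))
      + Im (cis (2 * pi * real_of_int (int k + int l) * real i / real n))" for i
  proof -
    define a b where "a = 2 * pi * real k * real i / real n" and "b = 2 * pi * real l * real i / real n"
    have "2 * pi * real_of_int (int k - int l) * real i / real n = a - b"
      "2 * pi * real_of_int (int k + int l) * real i / real n = a + b"
      by (simp_all add: a_def b_def algebra_simps add_divide_distrib diff_divide_distrib)
    then show ?thesis
      unfolding cas_def a_def[symmetric] b_def[symmetric]
      by (simp only: cis.sel cos_diff sin_add) (simp add: algebra_simps)
  qed
  then have "(\<Sum>i<n. cas n k i * cas n l i)
      = Re (\<Sum>i<n. cis (2 * pi * real_of_int (int k - int l) * real i / real n))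
      + Im (\<Sum>i<n. cis (2 * pi * real_of_int (int k + int l) * real i / real n))"
    by (simp only: sum.distrib Re_sum Im_sum)
  also have "\<dots> = (if int n dvd (int k - int l) then real n else 0)"
    unfolding sum_cis[OF n] by simp
  also have "int n dvd (int k - int l) \<longleftrightarrow> k = l"
    using k l dvd_imp_le_int[of "int k - int l" "int n"] by (cases "k = l") auto
  finally show ?thesis .
qed

lemma cas_square_le: "(cas n k i)\<^sup>2 \<le> 2"
proof -
  define a where "a = 2 * pi * real k * real i / real n"
  have "(cas n k i)\<^sup>2 = (cos a)\<^sup>2 + (sin a)\<^sup>2 + 2 * (cos a * sin a)"
    by (simp add: cas_def a_def power2_sum)
  also have "\<dots> \<le> 2 * ((cos a)\<^sup>2 + (sin a)\<^sup>2)"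
    using sum_squares_bound[of "cos a" "sin a"] by simp
  also have "(cos a)\<^sup>2 + (sin a)\<^sup>2 = 1" by (rule cos_squared_eq[THEN eq_diff_eq[THEN iffD1]])
  finally show ?thesis by simp
qed

definition hartley :: "nat \<Rightarrow> (nat \<Rightarrow> real) \<Rightarrow> nat \<Rightarrow> nat \<Rightarrow> real" where
  "hartley n s k i = s i * cas n k i / sqrt n"

lemma hartley_orthonormal:
  assumes s: "\<And>i. i < n \<Longrightarrow> s i * s i = 1" and k: "k < n" and l: "l < n"
  shows "ip n (hartley n s k) (hartley n s l) = (if k = l then 1 else 0)"
proof -
  have n: "0 < n" using k by simp
  have "ip n (hartley n s k) (hartley n s l) = (\<Sum>i<n. (s i * s i) * (cas n k i * cas n l i) / n)"
    unfolding ip_def hartley_def by (intro sum.cong) auto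
  also have "\<dots> = (\<Sum>i<n. cas n k i * cas n l i) / n"
    unfolding sum_divide_distrib by (intro sum.cong) (auto simp: s)
  finally show ?thesis using n by (simp add: cas_orthogonal[OF n k l])
qed

text \<open>The kernel is symmetric in its two indices, so orthogonality across coordinates reduces
  to orthogonality across basis vectors.\<close>

lemma hartley_complete:
  assumes s: "\<And>i. i < n \<Longrightarrow> s i * s i = 1" and i: "i < n" and j: "j < n"
  shows "(\<Sum>k<n. hartley n s k i * hartley n s k j) = (if i = j then 1 else 0)"
proof -
  have n: "0 < n" using i by simp
  have "(\<Sum>k<n. hartley n s k i * hartley n s k j) = (\<Sum>k<n. (s i * s j) * (cas n i k * cas n j k) / n)"
    unfolding hartley_def by (intro sum.cong) (auto simp: cas_commute[of n _ i] cas_commute[of n _ j])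
  also have "\<dots> = (s i * s j) * (\<Sum>k<n. cas n i k * cas n j k) / n"
    by (simp add: sum_divide_distrib sum_distrib_left)
  finally show ?thesis using n s[OF i] by (auto simp: cas_orthogonal[OF n i j])
qed

lemma hartley_0: "hartley n s 0 i = s i / sqrt n"
  by (simp add: hartley_def cas_def)

lemma hartley_square_le:
  assumes "s i * s i = 1"
  shows "(hartley n s k i)\<^sup>2 \<le> 2 / n"
proof -
  have "(hartley n s k i)\<^sup>2 = (s i * s i) * (cas n k i)\<^sup>2 / n"
    by (simp add: hartley_def power_divide power_mult_distrib power2_eq_square)
  also have "\<dots> \<le> 2 / n" using assms cas_square_le[of n k i] by (simp add: divide_right_mono)
  finally show ?thesis .
qed

section \<open>Sub-Gaussian bound for Rademacher sums\<close>

lemma exp_add_exp_neg_le: "exp x + exp (- x) \<le> 2 * exp (x\<^sup>2 / 2)" for x :: real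
proof -
  have pos: "exp x + exp (- x) \<le> 2 * exp (x\<^sup>2 / 2)" if "0 < x" for x :: real
  proof -
    \<comment> \<open>The estimate behind Hoeffding's lemma, for a fair two-point variable of width
      \<open>2 * x\<close>; factoring out \<open>exp x\<close> leaves the hyperbolic cosine.\<close>
    have "- (2 * x) * (1 / 2) + ln (1 + 1 / 2 * (exp (2 * x) - 1)) \<le> (2 * x)\<^sup>2 / 8"
      by (rule Hoeffdings_lemma_aux) (use that in auto)
    then have "ln (1 + 1 / 2 * (exp (2 * x) - 1)) \<le> x + x\<^sup>2 / 2" by (simp add: power_mult_distrib)
    then have "1 + 1 / 2 * (exp (2 * x) - 1) \<le> exp (x + x\<^sup>2 / 2)"
    proof -
      have "0 < 1 + 1 / 2 * (exp (2 * x) - 1)" using that by (intro add_pos_nonneg) auto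
      then show ?thesis using \<open>ln _ \<le> _\<close> by (metis exp_le_cancel_iff exp_ln)
    qed
    also have "1 + 1 / 2 * (exp (2 * x) - 1) = exp x * ((exp x + exp (- x)) / 2)"
      by (simp add: field_simps flip: exp_add)
    finally show ?thesis by (simp add: exp_add)
  qed
  consider "0 < x" | "x = 0" | "0 < - x" by linarith
  then show ?thesis using pos[of x] pos[of "- x"] by cases auto
qed

text \<open>Hoeffding's inequality for independent signs as a count: \<open>T\<close> is the set of
  indices with sign -1. Summed over all subsets, the exponential becomes the expansion of a product
  of factors \<open>exp (l * a k) + exp (- l * a k)\<close>.\<close>

lemma rademacher_tail:
  fixes a :: "'b \<Rightarrow> real"
  assumes K: "finite K" and V: "(\<Sum>k\<in>K. (a k)\<^sup>2) \<le> V" "0 < V" and t: "0 < t"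
  shows "real (card {T \<in> Pow K. (\<Sum>k\<in>K. (if k \<in> T then - 1 else 1) * a k) \<le> - t}) \<le> 2 ^ card K * exp (- t\<^sup>2 / (2 * V))"
proof -
  let ?S = "\<lambda>T. \<Sum>k\<in>K. (if k \<in> T then - 1 else 1) * a k"
  \<comment> \<open>Minimiser of \<open>- l * t + l\<^sup>2 * V / 2\<close>.\<close>
  define l where "l = t / V"
  have l: "0 < l" using V t by (simp add: l_def)
  have fin: "finite (Pow K)" using K by simp
  have "real (card {T \<in> Pow K. ?S T \<le> - t}) = (\<Sum>T\<in>{T \<in> Pow K. ?S T \<le> - t}. 1)" by simp
  also have "\<dots> \<le> (\<Sum>T\<in>{T \<in> Pow K. ?S T \<le> - t}. exp (- l * (?S T + t)))"
    using l by (intro sum_mono) (auto simp: mult_le_0_iff intro: mult_nonneg_nonpos)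
  also have "\<dots> \<le> (\<Sum>T\<in>Pow K. exp (- l * (?S T + t)))"
    using fin by (intro sum_mono2) auto
  also have "\<dots> = (\<Sum>T\<in>Pow K. exp (- l * t) * ((\<Prod>k\<in>T. exp (l * a k)) * (\<Prod>k\<in>K - T. exp (- l * a k))))"
  proof (rule sum.cong[OF refl])
    fix T assume T: "T \<in> Pow K"
    have S: "?S T = (\<Sum>k\<in>T. - a k) + (\<Sum>k\<in>K - T. a k)"
      using T K by (subst sum.subset_diff[of T K]) (auto intro!: arg_cong2[where f = "(+)"] sum.cong simp: add.commute)
    have "- l * (?S T + t) = - l * t + ((\<Sum>k\<in>T. l * a k) + (\<Sum>k\<in>K - T. - l * a k))"
      unfolding S sum_negf sum_distrib_left[symmetric] by (simp add: algebra_simps)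
    moreover have "finite T" "finite (K - T)" using T K by (auto intro: finite_subset)
    ultimately show "exp (- l * (?S T + t)) = exp (- l * t) * ((\<Prod>k\<in>T. exp (l * a k)) * (\<Prod>k\<in>K - T. exp (- l * a k)))"
      by (simp only: exp_add exp_sum)
  qed
  also have "\<dots> = exp (- l * t) * (\<Prod>k\<in>K. exp (l * a k) + exp (- l * a k))"
    by (simp only: prod_add[OF K] sum_distrib_left)
  also have "\<dots> \<le> exp (- l * t) * (\<Prod>k\<in>K. 2 * exp ((l * a k)\<^sup>2 / 2))"
    using exp_add_exp_neg_le[of "l * a k" for k] by (intro mult_left_mono prod_mono) auto
  also have "(\<Prod>k\<in>K. 2 * exp ((l * a k)\<^sup>2 / 2)) = 2 ^ card K * exp (l\<^sup>2 / 2 * (\<Sum>k\<in>K. (a k)\<^sup>2))"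
    using K by (simp add: prod.distrib exp_sum[symmetric] sum_distrib_left power_mult_distrib)
  also have "exp (- l * t) * (2 ^ card K * exp (l\<^sup>2 / 2 * (\<Sum>k\<in>K. (a k)\<^sup>2)))
      \<le> exp (- l * t) * (2 ^ card K * exp (l\<^sup>2 / 2 * V))"
    using V by (intro mult_left_mono iffD2[OF exp_le_cancel_iff]) auto
  also have "\<dots> = 2 ^ card K * exp (- l * t + l\<^sup>2 / 2 * V)" by (simp add: mult_exp_exp)
  also have "- l * t + l\<^sup>2 / 2 * V = - t\<^sup>2 / (2 * V)"
    using V by (simp add: l_def power2_eq_square field_simps)
  finally show ?thesis .
qed

section \<open>Sign flips in the Hartley basis\<close>

text \<open>Reverses the Hartley coefficients with index in \<open>T\<close>; by orthogonality the
  composed reflections reduce to one sum. The value 0 from \<open>n\<close> on keeps the sphere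
  invariant.\<close>

definition flip :: "nat \<Rightarrow> (nat \<Rightarrow> real) \<Rightarrow> nat set \<Rightarrow> (nat \<Rightarrow> real) \<Rightarrow> nat \<Rightarrow> real" where
  "flip n s T x = (\<lambda>i. if i < n then x i - 2 * (\<Sum>k\<in>T. ip n (hartley n s k) x * hartley n s k i) else 0)"

text \<open>The same orthogonal map on each column of the noise, restricted to the grid so that the
  product space is mapped to itself.\<close>

definition flip_rows :: "nat \<Rightarrow> nat \<Rightarrow> (nat \<Rightarrow> real) \<Rightarrow> nat set \<Rightarrow> (nat \<times> nat \<Rightarrow> real) \<Rightarrow> nat \<times> nat \<Rightarrow> real" where
  "flip_rows n p s T \<omega> = (\<lambda>(i, j)\<in>grid n p.
    \<omega> (i, j) - 2 * (\<Sum>k\<in>T. hartley n s k i * (\<Sum>m<n. hartley n s k m * \<omega> (m, j))))"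

context sign_vector
begin

lemma hartley_expansion:
  assumes i: "i < n"
  shows "x i = (\<Sum>k<n. ip n (hartley n s k) x * hartley n s k i)"
proof -
  have "(\<Sum>k<n. ip n (hartley n s k) x * hartley n s k i)
      = (\<Sum>k<n. \<Sum>m<n. x m * (hartley n s k m * hartley n s k i))"
    unfolding ip_def sum_distrib_right by (intro sum.cong refl) simp
  also have "\<dots> = (\<Sum>m<n. x m * (\<Sum>k<n. hartley n s k m * hartley n s k i))"
    by (subst sum.swap) (simp add: sum_distrib_left)
  also have "\<dots> = (\<Sum>m<n. if m = i then x m else 0)"
    using i by (intro sum.cong refl) (simp add: hartley_complete[OF s])
  finally show ?thesis using i by simp
qed

lemma parseval: "ip n x y = (\<Sum>k<n. ip n (hartley n s k) x * ip n (hartley n s k) y)"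
proof -
  have "ip n x y = (\<Sum>i<n. (\<Sum>k<n. ip n (hartley n s k) x * hartley n s k i) * y i)"
    unfolding ip_def[of n x y] by (intro sum.cong refl) (subst hartley_expansion[of _ x], auto)
  also have "\<dots> = (\<Sum>i<n. \<Sum>k<n. ip n (hartley n s k) x * (hartley n s k i * y i))"
    unfolding sum_distrib_right by (intro sum.cong refl) simp
  also have "\<dots> = (\<Sum>k<n. ip n (hartley n s k) x * ip n (hartley n s k) y)"
    by (subst sum.swap) (simp add: sum_distrib_left ip_def[of n _ y])
  finally show ?thesis .
qed

lemma ip_flip:
  assumes T: "T \<subseteq> {..<n}" and l: "l < n"
  shows "ip n (hartley n s l) (flip n s T x) = (if l \<in> T then - 1 else 1) * ip n (hartley n s l) x"
proof -
  have fin: "finite T" using T finite_subset by blast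
  have "ip n (hartley n s l) (flip n s T x)
     = (\<Sum>i<n. hartley n s l i * x i - 2 * (\<Sum>k\<in>T. ip n (hartley n s k) x * (hartley n s l i * hartley n s k i)))"
    unfolding ip_def[of n _ "flip n s T x"] unfolding flip_def
    by (intro sum.cong refl) (simp add: algebra_simps sum_distrib_left)
  also have "\<dots> = ip n (hartley n s l) x - 2 * (\<Sum>i<n. \<Sum>k\<in>T. ip n (hartley n s k) x * (hartley n s l i * hartley n s k i))"
    by (simp add: sum_subtractf ip_def[of n _ x] sum_distrib_left)
  also have "(\<Sum>i<n. \<Sum>k\<in>T. ip n (hartley n s k) x * (hartley n s l i * hartley n s k i))
     = (\<Sum>k\<in>T. ip n (hartley n s k) x * ip n (hartley n s l) (hartley n s k))"
    by (subst sum.swap) (simp add: sum_distrib_left ip_def[of n "hartley n s l" "hartley n s k" for k])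
  also have "\<dots> = (\<Sum>k\<in>T. if k = l then ip n (hartley n s k) x else 0)"
    using T l by (intro sum.cong refl) (auto simp: hartley_orthonormal[OF s])
  finally show ?thesis using fin by auto
qed

text \<open>The source of the Rademacher sums: a flip changes only signs in the expansion of a
  coordinate.\<close>

lemma flip_expansion:
  assumes T: "T \<subseteq> {..<n}" and i: "i < n"
  shows "flip n s T x i = (\<Sum>k<n. (if k \<in> T then - 1 else 1) * (ip n (hartley n s k) x * hartley n s k i))"
  by (subst hartley_expansion[OF i]) (intro sum.cong refl, simp add: ip_flip[OF T])

lemma flip_flip:
  assumes T: "T \<subseteq> {..<n}" and i: "i < n"
  shows "flip n s T (flip n s T x) i = x i"
  by (subst (2) hartley_expansion[OF i], subst flip_expansion[OF T i]) (intro sum.cong refl, simp add: ip_flip[OF T])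

lemma ip_flip_flip:
  assumes T: "T \<subseteq> {..<n}"
  shows "ip n (flip n s T x) (flip n s T y) = ip n x y"
  unfolding parseval[of "flip n s T x"] parseval[of x] by (intro sum.cong refl) (simp add: ip_flip[OF T])

lemma ip_hartley_0: "ip n x (hartley n s 0) = ip n (hartley n s 0) x"
  by (rule symmetric_form_commute[OF symmetric_form_ip])

lemma flip_sphere:
  assumes T: "T \<subseteq> {..<n}" and x: "x \<in> sphere_n n"
  shows "flip n s T x \<in> sphere_n n"
  using x ip_flip_flip[OF T, of x x] by (simp add: sphere_n_def flip_def)

text \<open>With index 0 excluded from \<open>T\<close>, the flip fixes \<open>s\<close> and hence
  the signal, so flipping the noise flips the data. Being self-adjoint, the flip can be moved onto
  the arguments of the form.\<close>

lemma bform_flip_rows: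
  assumes T: "T \<subseteq> {1..<n}"
  shows "bform n p (data s b (flip_rows n p s T \<omega>)) x y = bform n p (data s b \<omega>) (flip n s T x) (flip n s T y)"
proof -
  have fin: "finite T" using T finite_subset by blast
  have lin: "(\<Sum>i<n. x i * data s b (flip_rows n p s T \<omega>) (i, j)) = (\<Sum>i<n. flip n s T x i * data s b \<omega> (i, j))"
    if j: "j < p" for x j
  proof -
    let ?h = "hartley n s"
    \<comment> \<open>\<open>s\<close> is a multiple of Hartley vector 0, hence orthogonal to those
      in \<open>T\<close>; this lets the noise be completed to the data inside the inner
      sums.\<close>
    have hs: "(\<Sum>i<n. ?h k i * (s i * b j)) = 0" if "k \<in> T" for k
    proof -
      have "0 < n" "k < n" "k \<noteq> 0" using that T by force+
      have "(\<Sum>i<n. ?h k i * (s i * b j)) = (sqrt n * b j) * ip n (?h k) (?h 0)"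
        unfolding ip_def sum_distrib_left using \<open>0 < n\<close> by (intro sum.cong refl) (simp add: hartley_0)
      then show ?thesis using hartley_orthonormal[OF s \<open>k < n\<close> \<open>0 < n\<close>] \<open>k \<noteq> 0\<close> by simp
    qed
    have "(\<Sum>i<n. x i * data s b (flip_rows n p s T \<omega>) (i, j))
       = (\<Sum>i<n. x i * data s b \<omega> (i, j) - 2 * (\<Sum>k\<in>T. (x i * ?h k i) * (\<Sum>m<n. ?h k m * \<omega> (m, j))))"
      using j by (intro sum.cong refl) (simp add: data_def flip_rows_def algebra_simps sum_distrib_left)
    also have "\<dots> = (\<Sum>i<n. x i * data s b \<omega> (i, j)) - 2 * (\<Sum>i<n. \<Sum>k\<in>T. (x i * ?h k i) * (\<Sum>m<n. ?h k m * \<omega> (m, j)))"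
      by (simp only: sum_subtractf sum_distrib_left)
    also have "(\<Sum>i<n. \<Sum>k\<in>T. (x i * ?h k i) * (\<Sum>m<n. ?h k m * \<omega> (m, j))) = (\<Sum>k\<in>T. ip n (?h k) x * (\<Sum>m<n. ?h k m * \<omega> (m, j)))"
      by (subst sum.swap) (simp only: ip_def sum_distrib_right[symmetric] mult.commute[of "x _"])
    also have "\<dots> = (\<Sum>k\<in>T. ip n (?h k) x * (\<Sum>m<n. ?h k m * data s b \<omega> (m, j)))"
      using hs by (intro sum.cong refl) (simp add: data_def distrib_left sum.distrib)
    also have "\<dots> = (\<Sum>k\<in>T. \<Sum>m<n. (ip n (?h k) x * ?h k m) * data s b \<omega> (m, j))"
      by (simp only: sum_distrib_left mult.assoc)
    also have "\<dots> = (\<Sum>m<n. (\<Sum>k\<in>T. ip n (?h k) x * ?h k m) * data s b \<omega> (m, j))"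
      by (subst sum.swap) (simp only: sum_distrib_right)
    also have "(\<Sum>i<n. x i * data s b \<omega> (i, j)) - 2 * \<dots> = (\<Sum>i<n. flip n s T x i * data s b \<omega> (i, j))"
      unfolding sum_distrib_left sum_subtractf[symmetric] by (intro sum.cong refl) (simp add: flip_def algebra_simps)
    finally show ?thesis .
  qed
  show ?thesis unfolding bform_def by (intro sum.cong refl) (simp add: lin)
qed

text \<open>Direction \<open>k\<close> is orthogonal to those in \<open>T\<close>, so the earlier
  flips leave the component of each column along it unchanged.\<close>

lemma flip_rows_insert:
  assumes T: "T \<subseteq> {..<n}" and k: "k < n" "k \<notin> T"
  shows "flip_rows n p s (insert k T) \<omega> = reflect_rows n p (hartley n s k) (flip_rows n p s T \<omega>)"
proof
  fix z :: "nat \<times> nat"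
  obtain i j where z: "z = (i, j)" by force
  let ?h = "hartley n s"
  have fin: "finite T" using T finite_subset by blast
  show "flip_rows n p s (insert k T) \<omega> z = reflect_rows n p (?h k) (flip_rows n p s T \<omega>) z"
  proof (cases "i < n \<and> j < p")
    case True
    have "(\<Sum>m<n. ?h k m * flip_rows n p s T \<omega> (m, j))
       = (\<Sum>m<n. ?h k m * \<omega> (m, j) - 2 * (\<Sum>l\<in>T. (?h k m * ?h l m) * (\<Sum>r<n. ?h l r * \<omega> (r, j))))"
      using True by (intro sum.cong refl) (simp add: flip_rows_def algebra_simps sum_distrib_left)
    also have "\<dots> = (\<Sum>m<n. ?h k m * \<omega> (m, j)) - 2 * (\<Sum>m<n. \<Sum>l\<in>T. (?h k m * ?h l m) * (\<Sum>r<n. ?h l r * \<omega> (r, j)))"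
      by (simp only: sum_subtractf sum_distrib_left)
    also have "(\<Sum>m<n. \<Sum>l\<in>T. (?h k m * ?h l m) * (\<Sum>r<n. ?h l r * \<omega> (r, j)))
       = (\<Sum>l\<in>T. ip n (?h k) (?h l) * (\<Sum>r<n. ?h l r * \<omega> (r, j)))"
      by (subst sum.swap) (simp only: ip_def sum_distrib_right[symmetric])
    also have "\<dots> = 0"
      using k T by (intro sum.neutral) (auto simp: hartley_orthonormal[OF s])
    finally have *: "(\<Sum>m<n. ?h k m * flip_rows n p s T \<omega> (m, j)) = (\<Sum>m<n. ?h k m * \<omega> (m, j))" by simp
    show ?thesis unfolding z using True k fin *
      by (simp add: reflect_rows_def) (simp add: flip_rows_def algebra_simps)
  qed (auto simp: z flip_rows_def reflect_rows_def)
qed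

lemma flip_rows_invariant:
  assumes T: "T \<subseteq> {..<n}"
  shows "flip_rows n p s T \<in> measurable (gauss (grid n p)) (gauss (grid n p)) \<and>
    (\<forall>f\<in>borel_measurable (gauss (grid n p)).
      (\<integral>\<^sup>+\<omega>. f (flip_rows n p s T \<omega>) \<partial>gauss (grid n p)) = (\<integral>\<^sup>+\<omega>. f \<omega> \<partial>gauss (grid n p)))"
proof -
  have "finite T" using T finite_subset by blast
  then show ?thesis using T
  proof (induction T rule: finite_induct)
    case empty
    have eq: "flip_rows n p s {} \<omega> = \<omega>" if "\<omega> \<in> space (gauss (grid n p))" for \<omega>
      using that by (auto simp: flip_rows_def space_PiM fun_eq_iff PiE_iff extensional_def restrict_def)
    have "flip_rows n p s {} \<in> measurable (gauss (grid n p)) (gauss (grid n p))"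
      by (subst measurable_cong[of _ _ "\<lambda>\<omega>. \<omega>"]) (auto simp: eq)
    moreover have "(\<integral>\<^sup>+\<omega>. f (flip_rows n p s {} \<omega>) \<partial>gauss (grid n p)) = (\<integral>\<^sup>+\<omega>. f \<omega> \<partial>gauss (grid n p))" for f
      by (intro nn_integral_cong) (simp add: eq)
    ultimately show ?case by simp
  next
    case (insert k T)
    have IH: "flip_rows n p s T \<in> measurable (gauss (grid n p)) (gauss (grid n p))"
      "\<And>f. f \<in> borel_measurable (gauss (grid n p)) \<Longrightarrow>
        (\<integral>\<^sup>+\<omega>. f (flip_rows n p s T \<omega>) \<partial>gauss (grid n p)) = (\<integral>\<^sup>+\<omega>. f \<omega> \<partial>gauss (grid n p))"
      using insert by auto
    have k: "k < n" "T \<subseteq> {..<n}" using insert.prems by auto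
    have eq: "flip_rows n p s (insert k T) = (\<lambda>\<omega>. reflect_rows n p (hartley n s k) (flip_rows n p s T \<omega>))"
      by (rule ext, rule flip_rows_insert) (use k insert in auto)
    have unit: "(\<Sum>i<n. (hartley n s k i)\<^sup>2) = 1"
      using hartley_orthonormal[OF s k(1) k(1)] by (simp add: ip_def power2_eq_square)
    have "flip_rows n p s (insert k T) \<in> measurable (gauss (grid n p)) (gauss (grid n p))"
      unfolding eq by (rule measurable_compose[OF IH(1) measurable_reflect_rows])
    moreover have "(\<integral>\<^sup>+\<omega>. f (flip_rows n p s (insert k T) \<omega>) \<partial>gauss (grid n p)) = (\<integral>\<^sup>+\<omega>. f \<omega> \<partial>gauss (grid n p))"
      if f: "f \<in> borel_measurable (gauss (grid n p))" for f
    proof -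
      have "(\<integral>\<^sup>+\<omega>. f (flip_rows n p s (insert k T) \<omega>) \<partial>gauss (grid n p))
         = (\<integral>\<^sup>+\<omega>. f (reflect_rows n p (hartley n s k) \<omega>) \<partial>gauss (grid n p))"
        unfolding eq by (rule IH(2)) (rule measurable_compose[OF measurable_reflect_rows f])
      also have "\<dots> = (\<integral>\<^sup>+\<omega>. f \<omega> \<partial>gauss (grid n p))" by (rule nn_integral_reflect_rows[OF unit f])
      finally show ?thesis .
    qed
    ultimately show ?case by blast
  qed
qed

end

section \<open>Singular vectors as maximisers\<close>

lemma l2_norm_eq_1: "l2_norm v = 1 \<longleftrightarrow> (\<Sum>i<dim_vec v. v $ i * v $ i) = 1"
  by (simp add: l2_norm_def L2_set_def power2_eq_square)

lemma bform_nonneg: "0 \<le> bform n p Y x x"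
  by (simp add: bform_def sum_nonneg)

text \<open>A triple with value \<open>\<sigma>\<close> gives the form the value
  \<open>\<sigma>\<^sup>2\<close>. Conversely a maximiser \<open>y\<close> on the sphere solves the
  eigenvector equation and yields a triple with value \<open>sqrt \<mu>\<close>, which cannot exceed
  \<open>\<sigma>\<close>.\<close>

lemma leading_left_singular_vector_maximises:
  assumes n: "0 < n" and A: "A \<in> carrier_mat n p" and Y: "\<And>i j. i < n \<Longrightarrow> j < p \<Longrightarrow> A $$ (i, j) = Y (i, j)"
    and u: "leading_left_singular_vector A u"
  defines "x \<equiv> \<lambda>i. if i < n then u $ i else 0"
  shows "dim_vec u = n" and "x \<in> sphere_n n" and "bform n p Y z z \<le> bform n p Y x x * ip n z z"
proof -
  from u obtain \<sigma> v where tr: "singular_triple A \<sigma> u v" and max: "\<And>\<sigma>'. singular_value A \<sigma>' \<Longrightarrow> \<sigma>' \<le> \<sigma>"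
    unfolding leading_left_singular_vector_def by blast
  have u_dim: "dim_vec u = n" "dim_vec v = p" and \<sigma>: "0 \<le> \<sigma>"
    and norms: "l2_norm u = 1" "l2_norm v = 1" and Atu: "transpose_mat A *\<^sub>v u = \<sigma> \<cdot>\<^sub>v v"
    using tr A unfolding singular_triple_def by auto
  show "dim_vec u = n" by fact
  show "x \<in> sphere_n n"
    using norms(1) unfolding l2_norm_eq_1 u_dim by (simp add: sphere_n_def ip_def x_def)
  have col_sum: "(transpose_mat A *\<^sub>v w) $ j = (\<Sum>i<n. w $ i * Y (i, j))" if "dim_vec w = n" "j < p" for w j
  proof -
    have "(transpose_mat A *\<^sub>v w) $ j = (\<Sum>i\<in>{0..<n}. A $$ (i, j) * w $ i)"
      using that A by (auto simp: scalar_prod_def intro!: sum.cong)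
    also have "\<dots> = (\<Sum>i<n. w $ i * Y (i, j))"
      unfolding lessThan_atLeast0 using that Y by (intro sum.cong) auto
    finally show ?thesis .
  qed
  have row_sum: "(A *\<^sub>v w) $ i = (\<Sum>j<p. Y (i, j) * w $ j)" if "dim_vec w = p" "i < n" for w i
  proof -
    have "(A *\<^sub>v w) $ i = (\<Sum>j\<in>{0..<p}. A $$ (i, j) * w $ j)"
      using that A by (auto simp: scalar_prod_def intro!: sum.cong)
    also have "\<dots> = (\<Sum>j<p. Y (i, j) * w $ j)"
      unfolding lessThan_atLeast0 using that Y by (intro sum.cong) auto
    finally show ?thesis .
  qed
  have fx: "bform n p Y x x = \<sigma>\<^sup>2"
  proof -
    have "(\<Sum>i<n. x i * Y (i, j)) = \<sigma> * v $ j" if "j < p" for j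
    proof -
      have "(\<Sum>i<n. x i * Y (i, j)) = (\<Sum>i<n. u $ i * Y (i, j))" by (simp add: x_def)
      also have "\<dots> = (transpose_mat A *\<^sub>v u) $ j" using that u_dim by (simp add: col_sum)
      also have "\<dots> = \<sigma> * v $ j" unfolding Atu using that u_dim by simp
      finally show ?thesis .
    qed
    then have "bform n p Y x x = (\<Sum>j<p. \<sigma>\<^sup>2 * (v $ j * v $ j))"
      unfolding bform_def by (intro sum.cong refl) (simp add: power2_eq_square)
    also have "\<dots> = \<sigma>\<^sup>2" using norms(2) unfolding l2_norm_eq_1 u_dim by (simp flip: sum_distrib_left)
    finally show ?thesis .
  qed
  have "\<exists>y\<in>sphere_n n. \<forall>z\<in>sphere_n n. bform n p Y z z \<le> bform n p Y y y"
    using unit_coordinate_in_sphere[OF n]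
    by (intro continuous_attains_sup compact_sphere_n continuous_on_bform) auto
  then obtain y where y: "y \<in> sphere_n n" and ymax: "\<And>z. z \<in> sphere_n n \<Longrightarrow> bform n p Y z z \<le> bform n p Y y y"
    by blast
  define \<mu> where "\<mu> = bform n p Y y y"
  have le: "bform n p Y z z \<le> \<mu> * ip n z z" for z
    by (rule sphere_bound_extend[OF symmetric_form_bform]) (simp add: \<mu>_def ymax)
  have y1: "ip n y y = 1" using y by (simp add: sphere_n_def)
  have st: "bform n p Y z y = \<mu> * ip n z y" for z
    by (rule stationary[OF symmetric_form_bform le]) (simp add: y1 \<mu>_def)
  have "\<mu> \<le> \<sigma>\<^sup>2"
  \<comment> \<open>For \<open>\<mu> = 0\<close> there is nothing to normalise to a right singular
    vector, but the bound is trivial.\<close>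
  proof (cases "\<mu> = 0")
    case False
    then have mu: "0 < \<mu>" using bform_nonneg[of n p Y y] by (simp add: \<mu>_def)
    define r where "r = sqrt \<mu>"
    have r: "0 < r" "r * r = \<mu>" using mu by (auto simp: r_def)
    define c where "c j = (\<Sum>i<n. y i * Y (i, j))" for j
    have cc: "(\<Sum>j<p. c j * c j) = \<mu>" by (simp add: \<mu>_def bform_def c_def)
    have Yc: "(\<Sum>j<p. Y (i, j) * c j) = \<mu> * y i" if "i < n" for i
    proof -
      \<comment> \<open>Testing the eigenvector equation with a coordinate vector reads off its
        coordinate \<open>i\<close>.\<close>
      let ?e = "\<lambda>k. if k = i then 1 else 0 :: real"
      have e: "(\<Sum>k<n. ?e k * g k) = g i" for g
        using that by (simp add: if_distrib[of "\<lambda>x. x * _"] cong: if_cong)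
      show ?thesis using st[of ?e] unfolding bform_def ip_def e c_def .
    qed
    let ?y = "vec n y" and ?v = "vec p (\<lambda>j. c j / r)"
    have "singular_triple A r ?y ?v"
      unfolding singular_triple_def
    proof (intro conjI)
      show "l2_norm ?y = 1" unfolding l2_norm_eq_1 using y1 by (simp add: ip_def)
      have "(\<Sum>j<p. c j / r * (c j / r)) = (\<Sum>j<p. c j * c j) / (r * r)"
        by (simp add: sum_divide_distrib)
      then show "l2_norm ?v = 1" unfolding l2_norm_eq_1 using mu by (simp add: cc r(2))
      show "A *\<^sub>v ?v = r \<cdot>\<^sub>v ?y"
      proof (rule eq_vecI)
        fix i assume "i < dim_vec (r \<cdot>\<^sub>v ?y)"
        then have i: "i < n" by simp
        have "(A *\<^sub>v ?v) $ i = (\<Sum>j<p. Y (i, j) * c j) / r"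
          using i by (simp add: row_sum sum_divide_distrib)
        also have "\<dots> = r * y i" using r unfolding Yc[OF i] by (simp flip: r(2))
        finally show "(A *\<^sub>v ?v) $ i = (r \<cdot>\<^sub>v ?y) $ i" using i by simp
      qed (use A in simp)
      show "transpose_mat A *\<^sub>v ?y = r \<cdot>\<^sub>v ?v"
      proof (rule eq_vecI)
        fix j assume "j < dim_vec (r \<cdot>\<^sub>v ?v)"
        then have j: "j < p" by simp
        have "(transpose_mat A *\<^sub>v ?y) $ j = c j" using j by (simp add: col_sum c_def)
        then show "(transpose_mat A *\<^sub>v ?y) $ j = (r \<cdot>\<^sub>v ?v) $ j" using j r by simp
      qed (use A in simp)
    qed (use A r in auto)
    then have "r \<le> \<sigma>" by (intro max) (auto simp: singular_value_def)
    then have "r * r \<le> \<sigma> * \<sigma>" using r by (intro mult_mono) auto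
    then show ?thesis using r by (simp add: power2_eq_square)
  qed simp
  then have "\<mu> * ip n z z \<le> \<sigma>\<^sup>2 * ip n z z" by (intro mult_right_mono ip_nonneg)
  then show "bform n p Y z z \<le> bform n p Y x x * ip n z z" unfolding fx using le[of z] by linarith
qed

lemma data_matrix_entry:
  assumes b: "\<beta> \<in> carrier_vec p" and i: "i < n" and j: "j < p"
  shows "data_matrix n p \<beta> l \<epsilon> $$ (i, j) = (1 - 2 * real (l i)) * \<beta> $ j + \<epsilon> i j"
proof -
  have "data_matrix n p \<beta> l \<epsilon> $$ (i, j) = sample p \<beta> l \<epsilon> i $ j"
    using i j by (simp add: data_matrix_def mat_of_rows_def)
  also have "\<dots> = (1 - 2 * real (l i)) * \<beta> $ j + \<epsilon> i j"
    using b j by (simp add: sample_def algebra_simps)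
  finally show ?thesis .
qed

lemma data_matrix_carrier: "data_matrix n p \<beta> l \<epsilon> \<in> carrier_mat n p"
  by (simp add: data_matrix_def mat_of_rows_def)

section \<open>The bad event\<close>

text \<open>One failing maximiser is enough, so outside this event every choice of the singular
  vector succeeds. The product with \<open>ip n y (hartley n s 0)\<close> makes the condition
  independent of the sign of \<open>y\<close>, and \<open>\<le>\<close> counts zero coordinates as
  failures.\<close>

definition bad :: "nat \<Rightarrow> nat \<Rightarrow> (nat \<Rightarrow> real) \<Rightarrow> (nat \<Rightarrow> real) \<Rightarrow> (nat \<times> nat \<Rightarrow> real) \<Rightarrow> bool" where
  "bad n p s b \<omega> \<longleftrightarrow> (\<exists>y\<in>sphere_n n. (\<exists>i<n. s i * y i * ip n y (hartley n s 0) \<le> 0) \<and>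
    (\<forall>x\<in>sphere_n n. bform n p (data s b \<omega>) x x \<le> bform n p (data s b \<omega>) y y))"

text \<open>One point is picked from each basic open set that meets \<open>S\<close>.\<close>

lemma countable_dense_subset:
  fixes S :: "'a :: second_countable_topology set"
  obtains T where "countable T" "T \<subseteq> S" "S \<subseteq> closure T"
proof -
  obtain \<B> :: "'a set set" where \<B>: "countable \<B>" "topological_basis \<B>"
    using ex_countable_basis by blast
  define T where "T = (\<lambda>U. SOME x. x \<in> U \<inter> S) ` {U \<in> \<B>. U \<inter> S \<noteq> {}}"
  have some: "(SOME x. x \<in> U \<inter> S) \<in> U \<inter> S" if "U \<inter> S \<noteq> {}" for U
    using that someI_ex[of "\<lambda>x. x \<in> U \<inter> S"] by auto
  have "countable {U \<in> \<B>. U \<inter> S \<noteq> {}}" by (rule countable_subset[OF _ \<B>(1)]) blast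
  then have "countable T" unfolding T_def by (rule countable_image)
  moreover have "T \<subseteq> S" unfolding T_def using some by blast
  moreover have "x \<in> closure T" if x: "x \<in> S" for x
    unfolding closure_iff_nhds_not_empty
  proof (intro allI impI)
    fix A V assume V: "V \<subseteq> A" "open V" "x \<in> V"
    then obtain U where U: "U \<in> \<B>" "x \<in> U" "U \<subseteq> V" using \<B>(2) by (meson topological_basisE)
    then have "(SOME x. x \<in> U \<inter> S) \<in> T" unfolding T_def using x by blast
    moreover have "(SOME x. x \<in> U \<inter> S) \<in> U" using some[of U] U x by blast
    ultimately show "T \<inter> A \<noteq> {}" using U V by blast
  qed
  ultimately show ?thesis using that by blast
qed

lemma measurable_bform_data[measurable]:
  "(\<lambda>\<omega>. bform n p (data s b \<omega>) x y) \<in> borel_measurable (gauss (grid n p))"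
  unfolding bform_def data_def prod.case
  by (intro borel_measurable_sum borel_measurable_times borel_measurable_add borel_measurable_const measurable_entry) auto

text \<open>\<open>bad\<close> compares two suprema of a continuous function over compact sets, and each of them
  may be taken over a countable dense subset.\<close>

lemma bad_measurable:
  assumes n: "0 < n"
  shows "{\<omega>\<in>space (gauss (grid n p)). bad n p s b \<omega>} \<in> sets (gauss (grid n p))"
proof -
  define F where "F = sphere_n n \<inter> (\<Union>i<n. {y. s i * y i * ip n y (hartley n s 0) \<le> 0})"
  have F: "compact F"
    unfolding F_def by (intro compact_Int_closed compact_sphere_n closed_UN closed_Collect_le ballI continuous_intros) auto
  obtain T0 where T0: "countable T0" "T0 \<subseteq> sphere_n n" "sphere_n n \<subseteq> closure T0" by (rule countable_dense_subset)
  obtain T1 where T1: "countable T1" "T1 \<subseteq> F" "F \<subseteq> closure T1" by (rule countable_dense_subset)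
  have "T0 \<noteq> {}" using T0(3) unit_coordinate_in_sphere[OF n] by auto
  \<comment> \<open>The right side says that the supremum over \<open>F\<close> reaches that over
    the sphere. The slack \<open>1 / (m + 1)\<close> is there because \<open>T1\<close> may miss the
    maximiser; compactness of \<open>F\<close> restores it.\<close>
  have eq: "bad n p s b \<omega> \<longleftrightarrow> (\<forall>x\<in>T0. \<forall>m::nat. \<exists>y\<in>T1.
      bform n p (data s b \<omega>) x x - 1 / (real m + 1) < bform n p (data s b \<omega>) y y)" (is "_ \<longleftrightarrow> ?R") for \<omega>
  proof -
    let ?q = "\<lambda>x. bform n p (data s b \<omega>) x x"
    have bad: "bad n p s b \<omega> \<longleftrightarrow> (\<exists>y\<in>F. \<forall>x\<in>sphere_n n. ?q x \<le> ?q y)"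
      unfolding bad_def F_def by blast
    show ?thesis
    proof
      assume "bad n p s b \<omega>"
      then obtain y where y: "y \<in> F" "\<And>x. x \<in> sphere_n n \<Longrightarrow> ?q x \<le> ?q y" unfolding bad by blast
      show ?R
      proof (intro ballI allI)
        fix x and m :: nat assume "x \<in> T0"
        then have "?q x \<le> ?q y" using y T0 by blast
        then have "?q x - 1 / (real m + 1) < ?q y"
          by (smt (verit) divide_pos_pos of_nat_0_le_iff)
        moreover have "open {z. ?q x - 1 / (real m + 1) < ?q z}"
          by (intro open_Collect_less continuous_intros continuous_on_bform)
        moreover have "y \<in> closure T1" using y T1 by blast
        ultimately show "\<exists>y\<in>T1. ?q x - 1 / (real m + 1) < ?q y"
          unfolding closure_iff_nhds_not_empty by blast
      qed
    next
      assume R: ?R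
      then have "F \<noteq> {}" using \<open>T0 \<noteq> {}\<close> T1 by blast
      then obtain y where y: "y \<in> F" "\<And>z. z \<in> F \<Longrightarrow> ?q z \<le> ?q y"
        using continuous_attains_sup[OF F _ continuous_on_bform] by blast
      have "?q x \<le> ?q y" if "x \<in> T0" for x
      proof (rule ccontr)
        assume "\<not> ?q x \<le> ?q y"
        then obtain m :: nat where "inverse (real (Suc m)) < ?q x - ?q y" using reals_Archimedean[of "?q x - ?q y"] by auto
        then have m: "1 / (real m + 1) < ?q x - ?q y" by (simp add: inverse_eq_divide add.commute)
        obtain z where "z \<in> T1" "?q x - 1 / (real m + 1) < ?q z" using R \<open>x \<in> T0\<close> by blast
        then show False using y(2)[of z] T1 m by force
      qed
      then have "T0 \<subseteq> {x. ?q x \<le> ?q y}" by blast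
      moreover have "closed {x. ?q x \<le> ?q y}"
        by (intro closed_Collect_le continuous_intros continuous_on_bform)
      ultimately have "closure T0 \<subseteq> {x. ?q x \<le> ?q y}" by (rule closure_minimal)
      then show "bad n p s b \<omega>" unfolding bad using y T0 by blast
    qed
  qed
  show ?thesis unfolding eq using T0(1) T1(1) by measurable
qed

section \<open>Counting the flips that lead to a bad configuration\<close>

context spiked
begin

lemma x0_hartley: "x0 = hartley n s 0"
  by (rule ext) (simp add: x0_def hartley_0)

lemma maximiser_exists: "\<exists>u. maximiser u"
proof -
  have "\<exists>y\<in>sphere_n n. \<forall>z\<in>sphere_n n. f z z \<le> f y y"
    using unit_coordinate_in_sphere[OF n]
    by (intro continuous_attains_sup compact_sphere_n continuous_on_bform) auto
  then obtain y where y: "y \<in> sphere_n n" "\<And>z. z \<in> sphere_n n \<Longrightarrow> f z z \<le> f y y" by blast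
  have "f z z \<le> f y y * ip n z z" for z by (rule sphere_bound_extend[OF f y(2)])
  then show ?thesis using y unfolding maximiser_def sphere_n_def by blast
qed

text \<open>Maximisers for flipped noise are flips of maximisers for \<open>\<omega>\<close>, and
  those lie on the line of one fixed \<open>u\<close>. A flip that fails at coordinate
  \<open>i\<close> thus forces a Rademacher sum in the Hartley coefficients of \<open>u\<close> down
  to \<open>- t\<close> or below; a union bound covers the \<open>n\<close> coordinates.\<close>

lemma card_bad_flips:
  "real (card {T \<in> Pow {1..<n}. bad n p s b (flip_rows n p s T \<omega>)}) \<le> n * (2 ^ (n - 1) * exp (- R\<^sup>2 / 4))"
proof -
  obtain u where u: "maximiser u" using maximiser_exists by blast
  define c where "c = ip n u x0"
  have c: "c \<noteq> 0" "R\<^sup>2 * (1 - c\<^sup>2) \<le> c\<^sup>2" using maximiser_angle[OF u] by (auto simp: c_def)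
  have u1: "ip n u u = 1" using u by (simp add: maximiser_def)
  define a where "a k = ip n (hartley n s k) u" for k
  \<comment> \<open>\<open>t\<close> is the share of Hartley direction 0, which no flip touches;
    \<open>V\<close> bounds the variance of the rest by the angle bound and flatness. Together
    \<open>t\<^sup>2 / (2 * V) = R\<^sup>2 / 4\<close>.\<close>
  define t where "t = c\<^sup>2 / sqrt n"
  define V where "V = 2 * c ^ 4 / (n * R\<^sup>2)"
  define S where "S i = {T \<in> Pow {1..<n}. (\<Sum>k\<in>{1..<n}. (if k \<in> T then - 1 else 1) * (c * s i * a k * hartley n s k i)) \<le> - t}" for i
  have t: "0 < t" using c n by (simp add: t_def)
  have V: "0 < V" using c n R by (simp add: V_def)
  have split0: "{..<n} = insert 0 {1..<n}" using n by auto
  have a0: "a 0 = c" unfolding a_def c_def x0_hartley by (rule symmetric_form_commute[OF symmetric_form_ip])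
  have asum: "(\<Sum>k\<in>{1..<n}. (a k)\<^sup>2) = 1 - c\<^sup>2"
    using parseval[of u u] unfolding u1 a_def[symmetric] split0 by (simp add: a0 power2_eq_square)
  have cardS: "real (card (S i)) \<le> 2 ^ (n - 1) * exp (- R\<^sup>2 / 4)" if i: "i < n" for i
  proof -
    have "(\<Sum>k\<in>{1..<n}. (c * s i * a k * hartley n s k i)\<^sup>2) \<le> (\<Sum>k\<in>{1..<n}. c\<^sup>2 * (2 / n) * (a k)\<^sup>2)"
    proof (rule sum_mono)
      fix k
      have "(c * s i * a k * hartley n s k i)\<^sup>2 = (s i * s i) * (c\<^sup>2 * (a k)\<^sup>2 * (hartley n s k i)\<^sup>2)"
        by (simp add: power2_eq_square)
      also have "\<dots> \<le> c\<^sup>2 * (a k)\<^sup>2 * (2 / n)"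
        unfolding s[OF i] using hartley_square_le[of s i n k, OF s[OF i]] by (simp only: mult_1) (intro mult_left_mono, auto)
      finally show "(c * s i * a k * hartley n s k i)\<^sup>2 \<le> c\<^sup>2 * (2 / n) * (a k)\<^sup>2" by (simp add: mult_ac)
    qed
    also have "\<dots> = c\<^sup>2 * (2 / n) * (1 - c\<^sup>2)" by (simp only: sum_distrib_left[symmetric] asum)
    also have "\<dots> \<le> c\<^sup>2 * (2 / n) * (c\<^sup>2 / R\<^sup>2)"
      using c(2) R by (intro mult_left_mono) (auto simp: field_simps)
    also have "\<dots> = V" by (simp add: V_def power_numeral_reduce power2_eq_square)
    finally have "(\<Sum>k\<in>{1..<n}. (c * s i * a k * hartley n s k i)\<^sup>2) \<le> V" .
    then have "real (card (S i)) \<le> 2 ^ card {1..<n} * exp (- t\<^sup>2 / (2 * V))"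
      unfolding S_def using V t by (intro rademacher_tail) auto
    also have "- t\<^sup>2 / (2 * V) = - R\<^sup>2 / 4"
      using c n R by (simp add: t_def V_def power_divide field_simps power_numeral_reduce)
    finally show ?thesis by simp
  qed
  have "{T \<in> Pow {1..<n}. bad n p s b (flip_rows n p s T \<omega>)} \<subseteq> (\<Union>i<n. S i)"
  proof safe
    fix T assume T: "T \<subseteq> {1..<n}" and "bad n p s b (flip_rows n p s T \<omega>)"
    then obtain y i where y: "y \<in> sphere_n n" and i: "i < n" and fail: "s i * y i * ip n y x0 \<le> 0"
      and max: "\<And>x. x \<in> sphere_n n \<Longrightarrow> f (flip n s T x) (flip n s T x) \<le> f (flip n s T y) (flip n s T y)"
      unfolding bad_def bform_flip_rows[OF T] x0_hartley by blast
    have T': "T \<subseteq> {..<n}" and T0: "0 \<notin> T" using T by auto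
    define v where "v = flip n s T y"
    have v: "v \<in> sphere_n n" unfolding v_def by (rule flip_sphere[OF T' y])
    have "f x x \<le> f v v" if x: "x \<in> sphere_n n" for x
    proof -
      have "flip n s T (flip n s T x) k = x k" for k
      proof (cases "k < n")
        case False
        then show ?thesis using x by (simp add: sphere_n_def flip_def)
      qed (rule flip_flip[OF T'])
      then have eq: "flip n s T (flip n s T x) = x" by (rule ext)
      show ?thesis using max[OF flip_sphere[OF T' x]] unfolding eq v_def[symmetric] .
    qed
    then have "f x x \<le> f v v * ip n x x" for x by (intro sphere_bound_extend[OF f])
    then have v_max: "maximiser v" using v by (simp add: maximiser_def sphere_n_def)
    define d where "d = ip n v x0"
    have d: "d \<noteq> 0" using maximiser_angle(2)[OF v_max] by (simp add: d_def)
    have dy: "ip n y x0 = d"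
      unfolding d_def v_def x0_hartley ip_hartley_0 using ip_flip[OF T' n, of y] T0 by simp
    \<comment> \<open>Proportionality without division: \<open>c\<close> and \<open>d\<close> carry
      the scale and sign between \<open>u\<close> and \<open>v\<close>.\<close>
    have uv: "d * u k = c * v k" if "k < n" for k
      using maximiser_unique[OF u v_max that] by (simp add: c_def d_def)
    have proj: "c * ip n (hartley n s k) v = d * a k" for k
      unfolding a_def ip_def sum_distrib_left
      by (intro sum.cong refl) (use uv in \<open>simp add: mult.left_commute\<close>)
    define z where "z = flip n s T u"
    have yz: "c * y i = d * z i"
    proof -
      have "c * y i = c * flip n s T v i" unfolding v_def by (simp add: flip_flip[OF T' i])
      also have "\<dots> = (\<Sum>k<n. (if k \<in> T then - 1 else 1) * ((c * ip n (hartley n s k) v) * hartley n s k i))"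
        unfolding flip_expansion[OF T' i] sum_distrib_left by (intro sum.cong refl) simp
      also have "\<dots> = d * z i"
        unfolding proj z_def flip_expansion[OF T' i] sum_distrib_left a_def by (intro sum.cong refl) simp
      finally show ?thesis .
    qed
    \<comment> \<open>Squares as multipliers transfer the failure from \<open>y\<close> to the
      flipped \<open>u\<close>, whatever the signs of \<open>c\<close> and \<open>d\<close>.\<close>
    have "d\<^sup>2 * (s i * z i * c) = c\<^sup>2 * (s i * y i * d)"
    proof -
      have "d\<^sup>2 * (s i * z i * c) = s i * (d * z i) * (c * d)" by (simp add: power2_eq_square)
      also have "\<dots> = c\<^sup>2 * (s i * y i * d)" unfolding yz[symmetric] by (simp add: power2_eq_square)
      finally show ?thesis .
    qed
    also have "\<dots> \<le> 0" using fail unfolding dy by (rule mult_nonneg_nonpos[OF zero_le_power2])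
    finally have "s i * z i * c \<le> 0" using d by (simp add: mult_le_0_iff)
    moreover have "s i * z i * c = t + (\<Sum>k\<in>{1..<n}. (if k \<in> T then - 1 else 1) * (c * s i * a k * hartley n s k i))"
    proof -
      have "s i * z i * c = (\<Sum>k<n. (if k \<in> T then - 1 else 1) * (c * s i * a k * hartley n s k i))"
        unfolding z_def flip_expansion[OF T' i] sum_distrib_left sum_distrib_right a_def[symmetric]
        by (intro sum.cong refl) simp
      also have "\<dots> = c * s i * c * (s i / sqrt n) + (\<Sum>k\<in>{1..<n}. (if k \<in> T then - 1 else 1) * (c * s i * a k * hartley n s k i))"
        unfolding split0 using T0 by (simp add: a0 hartley_0)
      also have "c * s i * c * (s i / sqrt n) = (s i * s i) * t" by (simp add: t_def power2_eq_square)
      finally show ?thesis unfolding s[OF i] by simp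
    qed
    ultimately have "T \<in> S i" using T by (simp add: S_def)
    then show "T \<in> (\<Union>i<n. S i)" using i by blast
  qed
  then have "card {T \<in> Pow {1..<n}. bad n p s b (flip_rows n p s T \<omega>)} \<le> card (\<Union>i<n. S i)"
    by (intro card_mono) (auto simp: S_def)
  also have "\<dots> \<le> (\<Sum>i<n. card (S i))" by (rule card_UN_le) simp
  finally have "real (card {T \<in> Pow {1..<n}. bad n p s b (flip_rows n p s T \<omega>)}) \<le> (\<Sum>i<n. real (card (S i)))"
    by (simp flip: of_nat_sum)
  also have "\<dots> \<le> (\<Sum>i<n. 2 ^ (n - 1) * exp (- R\<^sup>2 / 4))" by (intro sum_mono cardS) auto
  finally show ?thesis by simp
qed

end

text \<open>Each flip preserves the law, so \<open>N\<close> times the probability of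
  \<open>Bad\<close> is the expected number of flips that lead into it. That number is at most
  \<open>N / n\<^sup>2 \<le> N / (2 * n)\<close> on the good event and at most \<open>N\<close>
  elsewhere, which gives \<open>1 / (2 * n) + 1 / (4 * n)\<close>.\<close>

lemma measure_bad:
  fixes n p :: nat and b s :: "nat \<Rightarrow> real" and B R :: real
  assumes n2: "2 \<le> n" and p: "256 * n \<le> p" and s: "\<And>i. i < n \<Longrightarrow> s i * s i = 1"
    and B: "B\<^sup>2 = (\<Sum>j<p. (b j)\<^sup>2)" "0 < B" and R12: "R\<^sup>2 = 12 * ln n" "0 < R"
    and gap: "R * (n * (R * B) + 132 * sqrt (real n * p)) \<le> n * B\<^sup>2 - 2 * n * (R * B) - 2 * (132 * sqrt (real n * p))"
  shows "measure (gauss (grid n p)) {\<omega>\<in>space (gauss (grid n p)). bad n p s b \<omega>} \<le> 1 / n"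
proof -
  let ?G = "gauss (grid n p)"
  interpret G: prob_space ?G by (rule prob_space_gauss)
  interpret sign_vector n s by standard (use n2 s in auto)
  define Bad where "Bad = {\<omega>\<in>space ?G. bad n p s b \<omega>}"
  have Bad_m[measurable]: "Bad \<in> sets ?G" unfolding Bad_def by (rule bad_measurable) (use n2 in simp)
  obtain E where E[measurable]: "E \<in> sets ?G" and E_le: "emeasure ?G (space ?G - E) \<le> ennreal (1 / (4 * real n))"
    and good: "\<And>\<omega>. \<omega> \<in> E \<Longrightarrow> good n p b (132 * sqrt (real n * p)) (R * B) \<omega>"
    using good_event[OF n2 p B R12] by blast
  let ?K = "{1..<n}"
  define N :: real where "N = 2 ^ (n - 1)"
  have N: "0 < N" "real (card (Pow ?K)) = N" by (simp_all add: N_def card_Pow)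
  have flip_m[measurable]: "flip_rows n p s T \<in> measurable ?G ?G"
    and flip_int: "\<And>f. f \<in> borel_measurable ?G \<Longrightarrow> (\<integral>\<^sup>+\<omega>. f (flip_rows n p s T \<omega>) \<partial>?G) = (\<integral>\<^sup>+\<omega>. f \<omega> \<partial>?G)"
    if "T \<in> Pow ?K" for T
    using flip_rows_invariant[of T p] that by force+
  have count: "(\<Sum>T\<in>Pow ?K. indicator Bad (flip_rows n p s T \<omega>)) \<le> ennreal (N / (2 * n)) + ennreal N * indicator (space ?G - E) \<omega>"
    if \<omega>: "\<omega> \<in> space ?G" for \<omega>
  proof -
    let ?C = "{T \<in> Pow ?K. bad n p s b (flip_rows n p s T \<omega>)}"
    have ind: "(indicator Bad (flip_rows n p s T \<omega>) :: ennreal) = (if T \<in> ?C then 1 else 0)" if "T \<in> Pow ?K" for T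
      using measurable_space[OF flip_m[OF that] \<omega>] that by (auto simp: Bad_def)
    have "(\<Sum>T\<in>Pow ?K. indicator Bad (flip_rows n p s T \<omega>)) = (\<Sum>T\<in>Pow ?K. if T \<in> ?C then 1 else (0 :: ennreal))"
      by (rule sum.cong[OF refl]) (rule ind)
    also have "\<dots> = of_nat (card ?C)"
      by (subst sum.inter_restrict[symmetric]) (auto intro!: arg_cong[where f = card])
    also have "\<dots> = ennreal (card ?C)" by (simp add: ennreal_of_nat_eq_real_of_nat)
    finally have eq: "(\<Sum>T\<in>Pow ?K. indicator Bad (flip_rows n p s T \<omega>)) = ennreal (card ?C)" .
    show ?thesis
    proof (cases "\<omega> \<in> E")
      case True
      \<comment> \<open>Positivity of the left side of \<open>gap\<close> yields the strict
        inequality that the locale asks for.\<close>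
      have pos: "0 < R * (n * (R * B) + 132 * sqrt (real n * p))"
        using n B R12 p by (intro mult_pos_pos add_pos_nonneg) auto
      interpret spiked n s p b B "132 * sqrt (real n * p)" "R * B" R \<omega>
        by standard (use n s B R12 good[OF True] gap pos in auto)
      have "real (card ?C) \<le> n * (N * exp (- R\<^sup>2 / 4))" unfolding N_def by (rule card_bad_flips)
      also have "exp (- R\<^sup>2 / 4) = exp (- (real 3 * ln n))" by (simp add: R12)
      also have "\<dots> = 1 / n ^ 3" unfolding exp_minus exp_of_nat_mult using n by (simp add: divide_inverse)
      also have "n * (N * (1 / n ^ 3)) = N / n * (1 / n)" using n by (simp add: power_numeral_reduce)
      also have "\<dots> \<le> N / n * (1 / 2)" using n2 N by (intro mult_left_mono) (auto simp: field_simps)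
      finally have "real (card ?C) \<le> N / (2 * n)" by simp
      then show ?thesis unfolding eq by (simp add: add_increasing2 ennreal_leI)
    next
      case False
      have "card ?C \<le> card (Pow ?K)" by (intro card_mono) auto
      then have "real (card ?C) \<le> N" using N by simp
      then show ?thesis unfolding eq using False \<omega> by (simp add: add_increasing ennreal_leI)
    qed
  qed
  have "ennreal N * emeasure ?G Bad = (\<Sum>T\<in>Pow ?K. emeasure ?G Bad)"
    using N by (simp add: ennreal_of_nat_eq_real_of_nat)
  also have "\<dots> = (\<Sum>T\<in>Pow ?K. \<integral>\<^sup>+\<omega>. indicator Bad (flip_rows n p s T \<omega>) \<partial>?G)"
    by (rule sum.cong[OF refl], subst flip_int) auto
  also have "\<dots> = (\<integral>\<^sup>+\<omega>. (\<Sum>T\<in>Pow ?K. indicator Bad (flip_rows n p s T \<omega>)) \<partial>?G)"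
    by (rule nn_integral_sum[symmetric]) (auto intro!: measurable_compose[OF flip_m] borel_measurable_indicator)
  also have "\<dots> \<le> (\<integral>\<^sup>+\<omega>. ennreal (N / (2 * n)) + ennreal N * indicator (space ?G - E) \<omega> \<partial>?G)"
    by (rule nn_integral_mono) (rule count)
  also have "\<dots> = ennreal (N / (2 * n)) + ennreal N * emeasure ?G (space ?G - E)"
    by (subst nn_integral_add) (auto simp: nn_integral_cmult_indicator G.emeasure_space_1)
  also have "\<dots> \<le> ennreal (N / (2 * n)) + ennreal N * ennreal (1 / (4 * real n))"
    by (intro add_mono mult_left_mono E_le) auto
  also have "\<dots> = ennreal (N / (2 * n) + N * (1 / (4 * real n)))"
  proof -
    have "ennreal N * ennreal (1 / (4 * real n)) = ennreal (N * (1 / (4 * real n)))"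
      by (rule ennreal_mult[symmetric]) (use N in auto)
    then show ?thesis using N by (simp only:) (rule ennreal_plus[symmetric], auto)
  qed
  finally have "ennreal (N * measure ?G Bad) \<le> ennreal (N / (2 * n) + N * (1 / (4 * real n)))"
    using N by (simp add: G.emeasure_eq_measure ennreal_mult)
  then have "N * measure ?G Bad \<le> N / (2 * n) + N * (1 / (4 * real n))"
    using N by (subst (asm) ennreal_le_iff) auto
  also have "\<dots> \<le> N * (1 / n)" using N n by (simp add: field_simps)
  finally have "measure ?G Bad \<le> 1 / n" using N(1) by (simp only: mult_le_cancel_left_pos)
  then show ?thesis unfolding Bad_def .
qed

text \<open>The terms are allotted \<open>1 / 8\<close>, \<open>1 / 16\<close>, \<open>1 / 4\<close>
  and \<open>1 / 8\<close> of \<open>n * B\<^sup>2\<close>, in the order of the statement.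
  \<open>n powr (1/6)\<close> pays for those with \<open>R * B\<close>, the fourth root for those
  with \<open>sqrt (n * p)\<close>.\<close>

lemma gap_condition:
  fixes n p :: nat and B R :: real
  assumes n: "2 \<le> n" and R: "R = sqrt (12 * ln n)"
    and B: "B \<ge> 600 * max (real n powr (1/6)) (max (real p powr (1/8)) ((real p * ln (real n) / real n) powr (1/4)))"
  shows "R * (n * (R * B) + 132 * sqrt (real n * p)) \<le> n * B\<^sup>2 - 2 * n * (R * B) - 2 * (132 * sqrt (real n * p))"
proof -
  have "ln (2 :: real) \<le> ln n" using n by simp
  then have ln: "2 / 3 \<le> ln n" using ln2_ge_two_thirds by linarith
  have R2: "R * R = 12 * ln n" using ln by (simp add: R)
  have R1: "1 \<le> R" unfolding R using ln by simp
  define a where "a = real n powr (1/6)"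
  define d where "d = (real p * ln (real n) / real n) powr (1/4)"
  have Ba: "600 * a \<le> B" and Bd: "600 * d \<le> B" using B by (auto simp: a_def d_def)
  have a: "0 < a" using n by (simp add: a_def)
  have B0: "0 < B" using a Ba by linarith
  \<comment> \<open>As \<open>ln n \<le> 6 * a\<close>, \<open>8 * R\<^sup>2 = 96 * ln n\<close> is
    at most \<open>576 * a\<close>, which \<open>600 * a \<le> B\<close> covers.\<close>
  have "ln n = 6 * ln a" using n by (simp add: a_def ln_powr)
  also have "\<dots> \<le> 6 * a" using ln_bound[of a] a by simp
  finally have RB: "8 * (R * R) \<le> B" unfolding R2 using Ba a by simp
  have R_le: "8 * R \<le> B" using RB mult_left_mono[OF R1, of R] R1 by linarith
  \<comment> \<open>The fourth root makes \<open>n * d\<^sup>2\<close> equal to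
    \<open>sqrt (n * p) * sqrt (ln n)\<close>, the order of \<open>R * sqrt (n * p)\<close>.\<close>
  have "d\<^sup>2 = sqrt (real p * ln n / n)"
    using ln by (simp add: d_def powr_half_sqrt[symmetric] powr_powr flip: powr_realpow' powr_numeral)
  then have "n * d\<^sup>2 = sqrt (real n * p) * sqrt (ln n)"
    using n by (simp add: real_sqrt_mult real_sqrt_divide real_div_sqrt flip: real_sqrt_mult_self) (simp add: field_simps)
  moreover have "(600 * d)\<^sup>2 \<le> B\<^sup>2" using Bd by (intro power_mono) (auto simp: d_def)
  then have "n * (600 * d)\<^sup>2 \<le> n * B\<^sup>2" by (intro mult_left_mono) auto
  ultimately have nB: "360000 * (sqrt (real n * p) * sqrt (ln n)) \<le> n * B\<^sup>2" by (simp add: power_mult_distrib)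
  have "R = sqrt 12 * sqrt (ln n)" unfolding R by (rule real_sqrt_mult)
  also have "\<dots> \<le> 4 * sqrt (ln n)" using ln by (intro mult_right_mono) (auto simp: real_le_lsqrt)
  finally have "R * sqrt (real n * p) \<le> 4 * (sqrt (real n * p) * sqrt (ln n))"
    using mult_right_mono[of R "4 * sqrt (ln n)" "sqrt (real n * p)"] by (simp add: mult_ac)
  moreover have "0 \<le> sqrt (real n * p) * sqrt (ln n)" using ln by simp
  moreover have "16 * (R * (132 * sqrt (real n * p))) = 2112 * (R * sqrt (real n * p))" by simp
  ultimately have RA: "16 * (R * (132 * sqrt (real n * p))) \<le> n * B\<^sup>2" using nB by linarith
  have A: "132 * sqrt (real n * p) \<le> R * (132 * sqrt (real n * p))"
    using mult_right_mono[OF R1, of "132 * sqrt (real n * p)"] by simp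
  have "8 * (R * R) * (n * B) \<le> B * (n * B)" using RB B0 by (intro mult_right_mono) auto
  then have 1: "8 * (R * (n * (R * B))) \<le> n * B\<^sup>2" by (simp add: power2_eq_square mult_ac)
  have "8 * R * (n * B) \<le> B * (n * B)" using R_le B0 by (intro mult_right_mono) auto
  then have 2: "8 * (n * (R * B)) \<le> n * B\<^sup>2" by (simp add: power2_eq_square mult_ac)
  have 3: "0 \<le> n * B\<^sup>2" by simp
  have "R * (n * (R * B) + 132 * sqrt (real n * p)) = R * (n * (R * B)) + R * (132 * sqrt (real n * p))"
    by (rule distrib_left)
  moreover have "2 * n * (R * B) = 2 * (n * (R * B))" by simp
  ultimately show ?thesis using 1 2 3 A RA by linarith
qed

theorem theorem4:
  shows "\<exists>C D\<^sub>1 :: real. 0 < C \<and> 0 < D\<^sub>1 \<and>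
    (\<forall>(n :: nat) (p :: nat) (\<beta> :: real vec) (l :: nat \<Rightarrow> nat).
      0 < n \<longrightarrow> 0 < p \<longrightarrow> real p \<ge> C * real n \<longrightarrow>
      \<beta> \<in> carrier_vec p \<longrightarrow> (\<forall>i<n. l i \<in> {0, 1}) \<longrightarrow>
      l2_norm \<beta> \<ge> D\<^sub>1 * max (real n powr (1/6))
        (max (real p powr (1/8)) ((real p * ln (real n) / real n) powr (1/4))) \<longrightarrow>
      (\<exists>E \<in> sets (noise_law n p).
        measure (noise_law n p) E \<ge> 1 - 1 / real n \<and>
        (\<forall>\<epsilon>\<in>E. \<forall>u. leading_left_singular_vector (data_matrix n p \<beta> l \<epsilon>) u \<longrightarrow>
          estimated_class0 u = label_class n l 0 \<or>
          estimated_class0 u = label_class n l 1)))"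
proof (rule exI[of _ 256], rule exI[of _ 600], intro conjI allI impI)
  fix n p :: nat and \<beta> :: "real vec" and l :: "nat \<Rightarrow> nat"
  assume n0: "0 < n" and p0: "0 < p" and pn: "real p \<ge> 256 * real n" and \<beta>: "\<beta> \<in> carrier_vec p"
    and l: "\<forall>i<n. l i \<in> {0, 1}"
    and norm: "l2_norm \<beta> \<ge> 600 * max (real n powr (1/6))
        (max (real p powr (1/8)) ((real p * ln (real n) / real n) powr (1/4)))"
  show "\<exists>E \<in> sets (noise_law n p). measure (noise_law n p) E \<ge> 1 - 1 / real n \<and>
        (\<forall>\<epsilon>\<in>E. \<forall>u. leading_left_singular_vector (data_matrix n p \<beta> l \<epsilon>) u \<longrightarrow>
          estimated_class0 u = label_class n l 0 \<or> estimated_class0 u = label_class n l 1)"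
  proof (cases "n = 1")
    case True
    \<comment> \<open>For \<open>n = 1\<close> the required probability is 0, so the empty event
      will do.\<close>
    then show ?thesis by (intro bexI[of _ "{}"]) auto
  next
    case False
    with n0 have n: "2 \<le> n" by simp
    have p: "256 * n \<le> p" using pn by (metis of_nat_le_iff of_nat_mult of_nat_numeral)
    define s where "s i = 1 - 2 * real (l i)" for i
    define b where "b j = \<beta> $ j" for j
    define B where "B = l2_norm \<beta>"
    define R where "R = sqrt (12 * ln n)"
    have s_cases: "(l i = 0 \<and> s i = 1) \<or> (l i = 1 \<and> s i = - 1)" if "i < n" for i
      using l that by (auto simp: s_def)
    then have s: "s i * s i = 1" if "i < n" for i using that by fastforce
    have B2: "B\<^sup>2 = (\<Sum>j<p. (b j)\<^sup>2)" using \<beta> by (simp add: B_def l2_norm_def L2_set_def b_def sum_nonneg)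
    have "0 < 600 * real n powr (1/6)" using n by simp
    also have "\<dots> \<le> B" using norm by (simp add: B_def)
    finally have B0: "0 < B" .
    have "0 < ln n" using n by simp
    then have R: "R\<^sup>2 = 12 * ln n" "0 < R" by (auto simp: R_def)
    let ?G = "gauss (grid n p)"
    interpret G: prob_space ?G by (rule prob_space_gauss)
    define Bad where "Bad = {\<omega>\<in>space ?G. bad n p s b \<omega>}"
    have Bad_m: "Bad \<in> sets ?G" unfolding Bad_def by (rule bad_measurable) (use n in simp)
    have Bad_le: "measure ?G Bad \<le> 1 / n"
      unfolding Bad_def
      by (rule measure_bad[OF n p _ B2 B0 R gap_condition[OF n R_def norm[folded B_def]]]) (rule s)
    \<comment> \<open>The event lives on the iterated product: \<open>flatten\<close> pulls the bad
      set back to it, and \<open>curry\<close> carries the law on the grid to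
      \<open>noise_law\<close>.\<close>
    define flatten where "flatten \<epsilon> = (\<lambda>(i, j)\<in>grid n p. \<epsilon> i j)" for \<epsilon> :: "nat \<Rightarrow> nat \<Rightarrow> real"
    define curry where "curry \<omega> = (\<lambda>i\<in>{..<n}. \<lambda>j\<in>{..<p}. \<omega> (i, j))" for \<omega> :: "nat \<times> nat \<Rightarrow> real"
    have curry_m: "curry \<in> measurable ?G (noise_law n p)"
      unfolding curry_def noise_law_def std_gaussian_def
      by (intro measurable_restrict measurable_component_singleton) auto
    have flatten_m: "flatten \<in> measurable (noise_law n p) ?G"
      unfolding flatten_def noise_law_def std_gaussian_def
    proof (rule measurable_restrict)
      fix z assume z: "z \<in> grid n p"
      obtain i j where ij: "z = (i, j)" by force
      have i: "i \<in> {..<n}" and j: "j \<in> {..<p}" using z ij by auto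
      have "(\<lambda>\<epsilon>. \<epsilon> i) \<in> measurable (\<Pi>\<^sub>M i\<in>{..<n}. gauss {..<p}) (gauss {..<p})"
        by (rule measurable_component_singleton[OF i])
      moreover have "(\<lambda>x. x j) \<in> measurable (gauss {..<p}) (density lborel std_normal_density)"
        by (rule measurable_component_singleton[OF j])
      ultimately have "(\<lambda>\<epsilon>. \<epsilon> i j) \<in> measurable (\<Pi>\<^sub>M i\<in>{..<n}. gauss {..<p}) (density lborel std_normal_density)"
        by (rule measurable_compose)
      then show "(\<lambda>\<epsilon>. case z of (i, j) \<Rightarrow> \<epsilon> i j) \<in> measurable (\<Pi>\<^sub>M i\<in>{..<n}. gauss {..<p}) (density lborel std_normal_density)"
        by (simp only: ij prod.case)
    qed
    have fc: "flatten (curry \<omega>) = \<omega>" if "\<omega> \<in> space ?G" for \<omega>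
      using that by (auto simp: flatten_def curry_def space_PiM PiE_iff extensional_def fun_eq_iff restrict_def)
    define E where "E = flatten -` (space ?G - Bad) \<inter> space (noise_law n p)"
    have E: "E \<in> sets (noise_law n p)" unfolding E_def using Bad_m by (intro measurable_sets[OF flatten_m]) auto
    show ?thesis
    proof (intro bexI[OF _ E] conjI ballI allI impI)
      have "measure (noise_law n p) E = measure (distr ?G (noise_law n p) curry) E"
        using noise_law_eq_distr_gauss[OF n0 p0] by (simp add: curry_def[abs_def])
      also have "\<dots> = measure ?G (curry -` E \<inter> space ?G)" by (rule measure_distr[OF curry_m E])
      also have "curry -` E \<inter> space ?G = space ?G - Bad"
        using measurable_space[OF curry_m] by (auto simp: E_def fc)
      also have "measure ?G (space ?G - Bad) = 1 - measure ?G Bad" by (rule G.prob_compl[OF Bad_m])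
      finally show "1 - 1 / real n \<le> measure (noise_law n p) E" using Bad_le by simp
    next
      fix \<epsilon> u assume \<epsilon>: "\<epsilon> \<in> E" and u: "leading_left_singular_vector (data_matrix n p \<beta> l \<epsilon>) u"
      define x where "x = (\<lambda>i. if i < n then u $ i else 0)"
      have entry: "data_matrix n p \<beta> l \<epsilon> $$ (i, j) = data s b (flatten \<epsilon>) (i, j)" if "i < n" "j < p" for i j
        using that by (simp add: data_matrix_entry[OF \<beta>] data_def s_def b_def flatten_def)
      note max = leading_left_singular_vector_maximises[where Y = "data s b (flatten \<epsilon>)", OF n0 data_matrix_carrier entry u, folded x_def]
      have not_bad: "\<not> bad n p s b (flatten \<epsilon>)"
        using \<epsilon> by (auto simp: E_def Bad_def)
      define d where "d = ip n x (hartley n s 0)"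
      have "bform n p (data s b (flatten \<epsilon>)) z z \<le> bform n p (data s b (flatten \<epsilon>)) x x" if "z \<in> sphere_n n" for z
        using max(3)[of z] that by (simp add: sphere_n_def)
      \<comment> \<open>Outside the bad event every coordinate agrees strictly with \<open>s\<close>
        up to the one global sign of \<open>d\<close>.\<close>
      then have sign: "0 < s i * x i * d" if "i < n" for i
        using not_bad max(2) that unfolding bad_def d_def by (meson not_less)
      have x_u: "x i = u $ i" if "i < n" for i using that by (simp add: x_def)
      have est: "estimated_class0 u = {i. i < n \<and> 0 \<le> x i}"
      proof -
        have "dim_vec u = n" by (rule max(1))
        then show ?thesis unfolding estimated_class0_def by (auto simp: x_u)
      qed
      \<comment> \<open>\<open>d\<close> is nonzero because the product at index 0 is positive; its
        sign decides which class is returned.\<close>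
      consider "0 < d" | "d < 0" using sign[OF n0] by (cases d "0 :: real" rule: linorder_cases) auto
      then show "estimated_class0 u = label_class n l 0 \<or> estimated_class0 u = label_class n l 1"
      proof cases
        case 1
        then have "0 \<le> x i \<longleftrightarrow> l i = 0" if "i < n" for i
          using sign[OF that] s_cases[OF that] by (auto simp: zero_less_mult_iff mult_less_0_iff)
        then show ?thesis unfolding est label_class_def by auto
      next
        case 2
        then have "0 \<le> x i \<longleftrightarrow> l i = 1" if "i < n" for i
          using sign[OF that] s_cases[OF that] by (auto simp: zero_less_mult_iff mult_less_0_iff)
        then show ?thesis unfolding est label_class_def by auto
      qed
    qed
  qed
qed auto

end
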